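(* Let $p>0$. Then there is an FPTAS for ${\rm Holant}(\mathcal{F}_{1.17,+\infty}^{p},\Lambda_{1,+\infty})$.
   Context: A weighted Holant instance is $\Omega=(G(V,E),\{F_v\}_{v\in V},\{\lambda_e\}_{e\in E})$, where $G(V,E)$ is a graph, $F_v:\{0,1\}^{d_v}\to\mathbb{R}_{\ge 0}$ with $d_v$ the degree of $v$, and $\lambda_e\ge 0$ is the weight of edge $e$. Its partition function is $$Z(\Omega)=\sum_{\sigma:E\to\{0,1\}}\ \prod_{e\in E}\lambda_e^{\sigma(e)}\prod_{v\in V}F_v(\sigma|_{E(v)}),$$ where $E(v)$ is the set of edges incident to $v$. ${\rm Holant}(\mathcal{F},\Lambda)$ is the problem of computing $Z(\Omega)$, given an instance $\Omega$ with all $F_v\in\mathcal{F}$ and all $\lambda_e\in\Lambda$. A symmetric function of arity $d$ is written $[f_0,f_1,\dots,f_d]$, with $f_i\ge 0$ its value on inputs of Hamming weight $i$. $\mathcal{F}_c$ is the set of (generalized) Fibonacci functions with parameter $c$, i.e. symmetric functions with $f_{i+2}=c f_{i+1}+f_i$ for $i=0,\dots,d-2$. $\mathcal{F}_c^{p}$ is the set of functions in $\mathcal{F}_c$ (of any arity) with $f_{i+1}\ge p f_i$ for all $i=0,\dots,d-1$. $\mathcal{F}_{1.17,+\infty}^{p}=\bigcup_{c\ge 1.17}\mathcal{F}_c^{p}$ (so different vertices may have functions with different parameters $c$). $\Lambda_{1,+\infty}$ is the set of edge weights $\lambda_e\ge 1$. An FPTAS is a deterministic algorithm which, given an instance of size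 $n$ and $\varepsilon>0$, outputs $Z'$ with $(1-\varepsilon)Z<Z'<(1+\varepsilon)Z$, where $Z$ is the correct value, in time polynomial in $n$ and $1/\varepsilon$.
   Formalization: When Z = 0 (possible, e.g. if some F_v is identically 0) the strict inequalities (1-ε)Z < Z' < (1+ε)Z cannot be satisfied; in that case the formal statement requires Z' = 0 exactly. *)

theory Defs
  imports Complex_Main "HOL-Library.FuncSet" "HOL-Library.Log_Nat"
begin

section \<open>Weighted Holant problems with symmetric functions\<close>

text \<open>
  A list \<open>[f\<^sub>0, \<dots>, f\<^sub>d]\<close> stands for the symmetric function of arity \<open>d\<close> on \<open>{0,1}\<^sup>d\<close> whose
  value on inputs of Hamming weight \<open>i\<close> is \<open>f\<^sub>i\<close>.
\<close>

definition sym_fun :: "real list \<Rightarrow> bool list \<Rightarrow> real" where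
  "sym_fun f xs = f ! count_list xs True"

text \<open>
  The vertices are the indices of \<open>vertex_funs\<close> and the edges are the indices of \<open>endpoints\<close>.
  Parallel edges are allowed. Loops are not, so that the degree of a vertex is the number of
  edges incident to it.
\<close>

record holant_instance =
  vertex_funs :: "real list list"
  endpoints :: "(nat \<times> nat) list"
  weights :: "real list"

definition incident_edges :: "holant_instance \<Rightarrow> nat \<Rightarrow> nat list" where
  "incident_edges \<Omega> v =
     filter (\<lambda>e. fst (endpoints \<Omega> ! e) = v \<or> snd (endpoints \<Omega> ! e) = v)
       [0..<length (endpoints \<Omega>)]"

definition vertex_degree :: "holant_instance \<Rightarrow> nat \<Rightarrow> nat" where
  "vertex_degree \<Omega> v = length (incident_edges \<Omega> v)"

definition well_formed :: "holant_instance \<Rightarrow> bool" where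
  "well_formed \<Omega> \<longleftrightarrow>
     (\<forall>(u, v) \<in> set (endpoints \<Omega>).
        u < length (vertex_funs \<Omega>) \<and> v < length (vertex_funs \<Omega>) \<and> u \<noteq> v) \<and>
     length (weights \<Omega>) = length (endpoints \<Omega>) \<and>
     (\<forall>v < length (vertex_funs \<Omega>). length (vertex_funs \<Omega> ! v) = vertex_degree \<Omega> v + 1)"

definition partition_function :: "holant_instance \<Rightarrow> real" where
  "partition_function \<Omega> =
     (\<Sum>\<sigma> \<in> {..<length (endpoints \<Omega>)} \<rightarrow>\<^sub>E (UNIV :: bool set).
        (\<Prod>e < length (endpoints \<Omega>). (weights \<Omega> ! e) ^ of_bool (\<sigma> e)) *
        (\<Prod>v < length (vertex_funs \<Omega>). sym_fun (vertex_funs \<Omega> ! v) (map \<sigma> (incident_edges \<Omega> v))))"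

definition holant :: "real list set \<Rightarrow> real set \<Rightarrow> holant_instance set" where
  "holant \<F> \<Lambda> = {\<Omega>. well_formed \<Omega> \<and> set (vertex_funs \<Omega>) \<subseteq> \<F> \<and> set (weights \<Omega>) \<subseteq> \<Lambda>}"

definition fibonacci :: "real \<Rightarrow> real list set" where
  "fibonacci c =
     {f. f \<noteq> [] \<and> (\<forall>x \<in> set f. 0 \<le> x) \<and>
         (\<forall>i. i + 2 < length f \<longrightarrow> f ! (i + 2) = c * f ! (i + 1) + f ! i)}"

definition fibonacci_p :: "real \<Rightarrow> real \<Rightarrow> real list set" where
  "fibonacci_p p c =
     {f \<in> fibonacci c. \<forall>i. i + 1 < length f \<longrightarrow> f ! (i + 1) \<ge> p * f ! i}"

definition fibonacci_from :: "real \<Rightarrow> real \<Rightarrow> real list set" where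
  "fibonacci_from p c0 = (\<Union>c \<in> {c0..}. fibonacci_p p c)"


section \<open>Algorithms and their running time\<close>

text \<open>
  Programs are finite systems of first-order recursive functions on binary trees whose leaves
  are \<open>VNil\<close> or exact numbers. The only numeric constants are 0 and 1; in particular there is
  no rounding and no conversion of numbers to anything but numbers.
\<close>

datatype (nums: 'a) val = VNil | VNum 'a | VPair "'a val" "'a val"

datatype arith = Add | Sub | Mul | Div

datatype expr =
    Arg nat
  | Nil_const
  | Zero_const
  | One_const
  | Arith arith expr expr
  | Mk_pair expr expr
  | First expr
  | Second expr
  | Let_in expr expr
  | If_pair expr expr expr
  | If_less expr expr expr expr
  | Call nat "expr list"

type_synonym algorithm = "expr list"

fun arith_op :: "arith \<Rightarrow> real \<Rightarrow> real \<Rightarrow> real" where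
  "arith_op Add x y = x + y"
| "arith_op Sub x y = x - y"
| "arith_op Mul x y = x * y"
| "arith_op Div x y = x / y"

text \<open>
  \<open>eval \<kappa> P env e v t\<close>: with local variables \<open>env\<close>, the expression \<open>e\<close> evaluates to \<open>v\<close> in
  time \<open>t\<close>. A computation that diverges, divides by zero or is applied to a value of the wrong
  shape has no result. The parameter \<open>\<kappa>\<close> gives the size of a number: an operation on numbers
  costs the size of its operands, and every step costs 1 in addition. \<open>Let_in\<close> puts the new
  variable at index 0, and a called function sees exactly its arguments.
\<close>

inductive
  eval :: "(real \<Rightarrow> nat) \<Rightarrow> algorithm \<Rightarrow> real val list \<Rightarrow> expr \<Rightarrow> real val \<Rightarrow> nat \<Rightarrow> bool" and
  evals :: "(real \<Rightarrow> nat) \<Rightarrow> algorithm \<Rightarrow> real val list \<Rightarrow> expr list \<Rightarrow> real val list \<Rightarrow> nat \<Rightarrow> bool"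
  for \<kappa> :: "real \<Rightarrow> nat" and P :: algorithm
where
  Arg: "i < length env \<Longrightarrow> eval \<kappa> P env (Arg i) (env ! i) 1"
| Nil_const: "eval \<kappa> P env Nil_const VNil 1"
| Zero_const: "eval \<kappa> P env Zero_const (VNum 0) 1"
| One_const: "eval \<kappa> P env One_const (VNum 1) 1"
| Arith: "eval \<kappa> P env a (VNum x) s \<Longrightarrow> eval \<kappa> P env b (VNum y) t \<Longrightarrow> op = Div \<longrightarrow> y \<noteq> 0 \<Longrightarrow>
    eval \<kappa> P env (Arith op a b) (VNum (arith_op op x y)) (1 + s + t + \<kappa> x + \<kappa> y)"
| Mk_pair: "eval \<kappa> P env a v s \<Longrightarrow> eval \<kappa> P env b w t \<Longrightarrow>
    eval \<kappa> P env (Mk_pair a b) (VPair v w) (1 + s + t)"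
| First: "eval \<kappa> P env a (VPair v w) t \<Longrightarrow> eval \<kappa> P env (First a) v (1 + t)"
| Second: "eval \<kappa> P env a (VPair v w) t \<Longrightarrow> eval \<kappa> P env (Second a) w (1 + t)"
| Let_in: "eval \<kappa> P env a v s \<Longrightarrow> eval \<kappa> P (v # env) b w t \<Longrightarrow>
    eval \<kappa> P env (Let_in a b) w (1 + s + t)"
| If_pair: "eval \<kappa> P env a v s \<Longrightarrow>
    eval \<kappa> P env (case v of VPair _ _ \<Rightarrow> b | _ \<Rightarrow> c) w t \<Longrightarrow>
    eval \<kappa> P env (If_pair a b c) w (1 + s + t)"
| If_less: "eval \<kappa> P env a (VNum x) r \<Longrightarrow> eval \<kappa> P env b (VNum y) s \<Longrightarrow>
    eval \<kappa> P env (if x < y then c else d) w t \<Longrightarrow>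
    eval \<kappa> P env (If_less a b c d) w (1 + r + s + t + \<kappa> x + \<kappa> y)"
| Call: "f < length P \<Longrightarrow> evals \<kappa> P env es vs s \<Longrightarrow> eval \<kappa> P vs (P ! f) w t \<Longrightarrow>
    eval \<kappa> P env (Call f es) w (1 + s + t)"
| Nil_args: "evals \<kappa> P env [] [] 0"
| Cons_args: "eval \<kappa> P env e v s \<Longrightarrow> evals \<kappa> P env es vs t \<Longrightarrow>
    evals \<kappa> P env (e # es) (v # vs) (s + t)"

inductive_cases eval_cases:
  "eval \<kappa> P env (Arg i) v t"
  "eval \<kappa> P env Nil_const v t"
  "eval \<kappa> P env Zero_const v t"
  "eval \<kappa> P env One_const v t"
  "eval \<kappa> P env (Arith op a b) v t"
  "eval \<kappa> P env (Mk_pair a b) v t"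
  "eval \<kappa> P env (First a) v t"
  "eval \<kappa> P env (Second a) v t"
  "eval \<kappa> P env (Let_in a b) v t"
  "eval \<kappa> P env (If_pair a b c) v t"
  "eval \<kappa> P env (If_less a b c d) v t"
  "eval \<kappa> P env (Call f es) v t"
  "evals \<kappa> P env [] vs t"
  "evals \<kappa> P env (e # es) vs t"

lemma eval_deterministic:
  "eval \<kappa> P env e v t \<Longrightarrow> eval \<kappa> P env e v' t' \<Longrightarrow> v' = v \<and> t' = t"
  "evals \<kappa> P env es vs t \<Longrightarrow> evals \<kappa> P env es vs' t' \<Longrightarrow> vs' = vs \<and> t' = t"
proof (induction arbitrary: v' t' and vs' t' rule: eval_evals.inducts)
  case (Arg i env)
  from Arg.prems show ?case by (rule eval_cases) simp
next
  case (Nil_const env)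
  then show ?case by (rule eval_cases) simp
next
  case (Zero_const env)
  then show ?case by (rule eval_cases) simp
next
  case (One_const env)
  then show ?case by (rule eval_cases) simp
next
  case (Arith env a x s b y t op)
  from Arith.prems show ?case by (rule eval_cases) (auto dest!: Arith.IH(2,4))
next
  case (Mk_pair env a v s b w t)
  from Mk_pair.prems show ?case by (rule eval_cases) (auto dest!: Mk_pair.IH(2,4))
next
  case (First env a v w t)
  from First.prems show ?case by (rule eval_cases) (auto dest!: First.IH(2))
next
  case (Second env a v w t)
  from Second.prems show ?case by (rule eval_cases) (auto dest!: Second.IH(2))
next
  case (Let_in env a v s b w t)
  from Let_in.prems show ?case by (rule eval_cases) (fastforce dest!: Let_in.IH(2) dest: Let_in.IH(4))
next
  case (If_pair env a v s b c w t)
  from If_pair.prems show ?case by (rule eval_cases) (fastforce dest!: If_pair.IH(2) dest: If_pair.IH(4))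
next
  case (If_less env a x r b y s c d w t)
  from If_less.prems show ?case by (rule eval_cases) (fastforce dest!: If_less.IH(2,4) dest: If_less.IH(6))
next
  case (Call f env es vs s w t)
  from Call.prems show ?case by (rule eval_cases) (fastforce dest!: Call.IH(3) dest: Call.IH(5))
next
  case (Nil_args env)
  then show ?case by (rule eval_cases) simp
next
  case (Cons_args env e v s es vs t)
  from Cons_args.prems show ?case by (rule eval_cases) (fastforce dest!: Cons_args.IH(2) dest: Cons_args.IH(4))
qed

text \<open>
  \<open>runs \<kappa> P x y t\<close>: on input \<open>x\<close> the main function, which is the first one, returns \<open>y\<close> in
  time \<open>t\<close>.
\<close>

definition runs :: "(real \<Rightarrow> nat) \<Rightarrow> algorithm \<Rightarrow> real val \<Rightarrow> real val \<Rightarrow> nat \<Rightarrow> bool" where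
  "runs \<kappa> P x y t \<longleftrightarrow> P \<noteq> [] \<and> eval \<kappa> P [x] (hd P) y t"

primrec val_size :: "(real \<Rightarrow> nat) \<Rightarrow> real val \<Rightarrow> nat" where
  "val_size \<kappa> VNil = 1"
| "val_size \<kappa> (VNum x) = \<kappa> x"
| "val_size \<kappa> (VPair v w) = 1 + val_size \<kappa> v + val_size \<kappa> w"

text \<open>
  With \<open>unit_size\<close> the model is a real RAM: arbitrary real inputs, arithmetic at unit cost.
  With \<open>bit_size\<close>, which is meant for rational numbers only, it is the logarithmic cost model
  on rational inputs, polynomially equivalent to Turing machines. Starting from rational inputs
  all intermediate numbers are rational.
\<close>

definition unit_size :: "real \<Rightarrow> nat" where
  "unit_size x = 1"

definition bit_size :: "real \<Rightarrow> nat" where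
  "bit_size x = (case quotient_of (inv (of_rat :: rat \<Rightarrow> real) x) of
     (a, b) \<Rightarrow> 1 + nat (bitlen \<bar>a\<bar>) + nat (bitlen b))"

text \<open>
  If \<open>Z = 0\<close> then no \<open>Z'\<close> satisfies \<open>(1 - \<epsilon>) Z < Z' < (1 + \<epsilon>) Z\<close>; in this case the exact
  value is required. The case does occur for generalized Fibonacci functions, since these
  include the functions that are identically 0.
\<close>

definition approximates :: "real \<Rightarrow> real \<Rightarrow> real \<Rightarrow> bool" where
  "approximates \<epsilon> Z Z' \<longleftrightarrow>
     (if Z = 0 then Z' = 0 else (1 - \<epsilon>) * Z < Z' \<and> Z' < (1 + \<epsilon>) * Z)"

text \<open>
  \<open>P\<close> is an FPTAS for the function \<open>Z\<close> on the instances \<open>I\<close> that are encoded with numbers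
  in \<open>N\<close>. The tolerance \<open>\<epsilon>\<close> is part of the input. Since \<open>n \<ge> 2\<close> for the size \<open>n\<close> of the input, a
  bound by some polynomial in \<open>n\<close> and \<open>1/\<epsilon>\<close> is the same as one of the form \<open>C (n + 1/\<epsilon>)\<^sup>k\<close>.
\<close>

definition fptas ::
  "(real \<Rightarrow> nat) \<Rightarrow> real set \<Rightarrow> ('i \<Rightarrow> real val) \<Rightarrow> 'i set \<Rightarrow> ('i \<Rightarrow> real) \<Rightarrow> algorithm \<Rightarrow> bool" where
  "fptas \<kappa> N enc I Z P \<longleftrightarrow>
     (\<exists>(C :: real) (k :: nat). \<forall>\<Omega> \<in> I. \<forall>\<epsilon> > 0.
        let x = VPair (VNum \<epsilon>) (enc \<Omega>) in
        nums x \<subseteq> N \<longrightarrow>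
        (\<exists>Z' t. runs \<kappa> P x (VNum Z') t \<and> approximates \<epsilon> (Z \<Omega>) Z' \<and>
                real t \<le> C * (real (val_size \<kappa> x) + 1 / \<epsilon>) ^ k))"

definition encode_list :: "('b \<Rightarrow> real val) \<Rightarrow> 'b list \<Rightarrow> real val" where
  "encode_list enc xs = foldr (\<lambda>x. VPair (enc x)) xs VNil"

definition encode_instance :: "holant_instance \<Rightarrow> real val" where
  "encode_instance \<Omega> =
     VPair (encode_list (encode_list VNum) (vertex_funs \<Omega>))
       (VPair (encode_list (\<lambda>(u, v). VPair (VNum (real u)) (VNum (real v))) (endpoints \<Omega>))
         (encode_list VNum (weights \<Omega>)))"

text \<open>
  One and the same algorithm has to work on all real instances with polynomially many
  operations, and on rational instances within polynomial bit complexity.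
\<close>

definition has_fptas :: "holant_instance set \<Rightarrow> bool" where
  "has_fptas I \<longleftrightarrow>
     (\<exists>P. fptas unit_size UNIV encode_instance I partition_function P \<and>
          fptas bit_size \<rat> encode_instance I partition_function P)"

end

theory Submission
  imports Defs "HOL-Analysis.Analysis"
begin

text \<open>
  The edges are processed one by one. For an edge \<open>uv\<close> of weight \<open>\<lambda>\<close>, the partition function is that
  of the rest, with the functions at \<open>u\<close> and \<open>v\<close> shifted by one, times \<open>\<lambda>\<close> plus the product of two ratios
  \<open>r = Z(f\<^sub>0, f\<^sub>1, \<dots>) / Z(f\<^sub>1, f\<^sub>2, \<dots>)\<close> for a dangling half-edge, so it suffices to approximate such
  ratios. The Fibonacci recurrence expresses a ratio at \<open>v\<close> by three ratios of the instance without one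
  edge at \<open>v\<close>, namely \<open>r = (x a + (c + a)/(c + b)) / (c + a + x)\<close>.

  This map is not a contraction everywhere. However, replacing the function at one vertex by another
  one with the same parameter moves any ratio by at most as much as the local ratio, in the metric
  \<open>dr / min (1 + 2 r) 5\<close>. This bound on the influence, proved simultaneously with the contraction,
  forces the true ratio to be below a cap \<open>2 + K/(K + 1) max 0 (min b x - 2)\<close>. The map capped there is
  a contraction: along a segment between two arguments, wherever the uncapped value is the smaller
  one, the derivative is controlled by a polynomial inequality, and the cap is itself a contraction.
  So recursion to depth \<open>O(log (m/\<epsilon>))\<close> suffices; it has polynomially many calls, and since it is a tree
  of logarithmic depth, the exact rational numbers in it have polynomially many bits.
\<close>

section \<open>The polynomial inequalities behind the contraction\<close>

text \<open>The obstacle behind the cap: fix \<open>b\<close>, \<open>x\<close> >= 2 and let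
  \<open>a\<close> tend to infinity. Then \<open>gw\<close> is 5 at all three arguments and at the
  value, the derivatives with respect to \<open>a\<close>, \<open>b\<close>, \<open>x\<close> tend
  to 0, -1/(c + b)^2 and 1, and so the map expands in the maximum norm. Its value tends to x + 1/(c
  + b) > x, which is what the cap forbids. Approximations may violate the cap although true ratios
  do not, hence it is applied at every level of the recursion. The factor K/(K + 1) < 1 makes the
  cap a strict contraction; true ratios still obey it because all of them are at most
  \<open>K\<close>, where K p >= 1.

  Weights at least 1 serve three purposes: dividing a ratio by a weight does not increase distances,
  the influence across an edge stays below \<open>gw b\<close>, and each factor of the partition
  function is at least 1, so that absolute errors of ratios become relative errors of the factor.
  The bound 1.17 enters the polynomial inequalities mainly through 1/(c + b) <= 171/200 and 2 c - 1
  >= 67/50.\<close>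

definition gw :: "real \<Rightarrow> real" where
  "gw r = min (1 + 2 * r) 5"

lemma gw_bounds: "gw r \<le> 1 + 2 * r" "gw r \<le> 5" "r \<ge> 0 \<Longrightarrow> 1 \<le> gw r"
  and gw_low: "r \<le> 2 \<Longrightarrow> gw r = 1 + 2 * r"
  and gw_high: "r \<ge> 2 \<Longrightarrow> gw r = 5"
  by (auto simp: gw_def)

lemmas poly_simps = power2_eq_square algebra_simps add_divide_distrib diff_divide_distrib
  times_divide_eq_left times_divide_eq_right

lemma linear_nonneg:
  fixes x :: real
  assumes "0 \<le> x" "x \<le> 2" "0 \<le> p" "0 \<le> p + 2 * q"
  shows "0 \<le> p + q * x"
proof -
  have "0 \<le> p * (1 - x / 2) + (p + 2 * q) * (x / 2)"
    using assms mult_nonneg_nonneg[of p "1 - x / 2"] mult_nonneg_nonneg[of "p + 2 * q" "x / 2"] by simp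
  then show ?thesis by (simp add: algebra_simps)
qed

lemma linear_nonneg_ge:
  fixes x :: real
  assumes "2 \<le> x" "0 \<le> p + 2 * q" "0 \<le> q"
  shows "0 \<le> p + q * x"
proof -
  have "0 \<le> q * (x - 2)" using assms by simp
  then show ?thesis using assms(2) by (simp add: algebra_simps)
qed

text \<open>Used with \<open>d = m - a\<close> and \<open>q = (2 * c - 1) * m\<^sup>2\<close>, where
  \<open>m = 1 / (c + b)\<close>. Once \<open>gx\<close> is replaced by its two bounds, and
  \<open>c\<close> by \<open>A\<close> in the last term, the claim is affine in \<open>x\<close> on
  each side of 2; so the values at 0 and 2 (\<open>f0\<close>, \<open>f2\<close>) and the slope
  beyond 2 decide it.\<close>

lemma contraction_case_below:
  fixes a c d q x gx :: real
  assumes c: "c \<ge> (117/100)" and a: "a \<ge> 0" and d: "d \<ge> 0" and x: "x \<ge> 0"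
    and m: "a + d \<le> (171/200)" and q: "(67/50) * d\<^sup>2 \<le> q"
    and gx: "gx \<le> 1 + 2 * x" "gx \<le> 5"
  defines "A \<equiv> c + a"
  shows "0 \<le> A\<^sup>2 + x * (c + a - d) - 2 * x * a * d + q * A * (A + x) - gx * (A * d) - c * (A + x) / 10"
proof -
  have A: "A \<ge> (117/100)" "A > 0" using a c by (auto simp: A_def)
  have q0: "q \<ge> 0" using q by (rule order_trans[rotated]) simp
  have Ad: "0 \<le> A * d" using A d by simp
  have cA: "c * (A + x) / 10 \<le> A * (A + x) / 10"
    using a A x by (intro divide_right_mono mult_right_mono) (auto simp: A_def)
  have f0: "0 \<le> A\<^sup>2 + q * A\<^sup>2 - A * d - A\<^sup>2 / 10"
  proof -
    have "d \<le> (9/10) * A" using m a A by linarith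
    then have "A * d \<le> A * ((9/10) * A)" using A by (intro mult_left_mono) auto
    moreover have "0 \<le> q * A\<^sup>2" using q0 by simp
    ultimately show ?thesis by (simp only: power2_eq_square algebra_simps)
  qed
  have f2: "0 \<le> A\<^sup>2 + 2 * (c + a - d - 2 * a * d) + q * A * (A + 2) - 5 * (A * d) - A * (A + 2) / 10"
  proof -
    have "a * d \<le> (A - (117/100)) * d" using c d by (intro mult_right_mono) (auto simp: A_def)
    then have 1: "4 * (a * d) \<le> 4 * (A * d) - (117/25) * d" by (simp add: algebra_simps)
    have 2: "((67/50) * d\<^sup>2) * (A * (A + 2)) \<le> q * (A * (A + 2))"
      using q A by (intro mult_right_mono) auto
    \<comment> \<open>219/268 is the minimiser of (67/50) d^2 - (219/100) d; 211/200 below is close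
      to the minimiser of the quadratic in \<open>A\<close>.\<close>
    have "0 \<le> (d - 219/268)\<^sup>2" by simp
    then have "(219/100) * d \<le> (67/50) * d\<^sup>2 + (9/10)" by (simp only: power2_eq_square algebra_simps)
    then have 3: "((219/100) * d) * (A * (A + 2)) \<le> ((67/50) * d\<^sup>2 + (9/10)) * (A * (A + 2))"
      using A by (intro mult_right_mono) auto
    have "0 \<le> (A - (211/200))\<^sup>2" by simp
    with A(2) have "0 \<le> (219/100) * A\<^sup>2 - (231/50) * A + (67/25)" by (simp only: poly_simps; linarith)
    then have 4: "0 \<le> d * ((219/100) * A\<^sup>2 - (231/50) * A + (67/25))" using d by simp
    from 1 2 3 4 show ?thesis
      by (simp only: A_def poly_simps; linarith)
  qed
  have slope: "0 \<le> (c + a - d - 2 * a * d) + q * A - A / 10"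
  proof -
    have "d * (1 + 2 * a) \<le> ((171/200) - a) * (1 + 2 * a)" using m a by (intro mult_right_mono) auto
    moreover have "0 \<le> q * A" using q0 A by simp
    ultimately show ?thesis using c a zero_le_power2[of a]
      by (simp only: A_def poly_simps; linarith)
  qed
  show ?thesis
  proof (cases "x \<le> 2")
    case True
    let ?p = "A\<^sup>2 + q * A\<^sup>2 - A * d - A\<^sup>2 / 10"
    let ?q = "c + a - d - 2 * a * d + q * A - 2 * (A * d) - A / 10"
    have "0 \<le> ?p + 2 * ?q" using f2 by (simp only: poly_simps; linarith)
    then have "0 \<le> ?p + ?q * x" by (rule linear_nonneg[OF x True f0])
    moreover have "gx * (A * d) \<le> (1 + 2 * x) * (A * d)" using gx(1) Ad by (rule mult_right_mono)
    ultimately show ?thesis using cA by (simp only: poly_simps; linarith)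
  next
    case False
    let ?p = "A\<^sup>2 + q * A\<^sup>2 - 5 * (A * d) - A\<^sup>2 / 10"
    let ?q = "c + a - d - 2 * a * d + q * A - A / 10"
    have "0 \<le> ?p + 2 * ?q" using f2 by (simp only: poly_simps; linarith)
    then have "0 \<le> ?p + ?q * x" by (rule linear_nonneg_ge[rotated]) (use False slope in simp_all)
    moreover have "gx * (A * d) \<le> 5 * (A * d)" using gx(2) Ad by (rule mult_right_mono)
    ultimately show ?thesis using cA by (simp only: poly_simps; linarith)
  qed
qed

text \<open>Used with \<open>e = a - 1 / (c + b)\<close>. Again the claim is affine in
  \<open>x\<close> on both sides of 2.\<close>

lemma contraction_case_above_small:
  fixes a c e q x gx :: real
  assumes c: "c \<ge> (117/100)" and a: "a \<ge> 0" "a \<le> 2" and e: "e \<ge> 0" "e \<le> a" and x: "x \<ge> 0"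
    and q: "q \<ge> 0" and gx: "gx \<le> 1 + 2 * x" "gx \<le> 5"
  defines "A \<equiv> c + a"
  shows "0 \<le> A\<^sup>2 + x * (c + a + e) + 2 * x * a * e + q * A * (A + x) - gx * (A * e) - c * (A + x) / 10"
proof -
  have A: "A \<ge> (117/100)" "A > 0" using a c by (auto simp: A_def)
  have Ae: "0 \<le> A * e" using A e by simp
  have ae: "0 \<le> a * e" using a e by simp
  have ac: "0 \<le> a * c" using a c by simp
  have c2: "117 * c \<le> 100 * (c * c)" using mult_right_mono[of "117/100" c c] c by simp
  have qA: "0 \<le> q * A * (A + x)" using q A x by simp
  have Aea: "A * e \<le> A * a" using A e by (intro mult_left_mono) auto
  have ac2: "a * c \<le> 2 * c" using a c by (intro mult_right_mono) auto
  have f0: "0 \<le> A\<^sup>2 - A * e - c * A / 10"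
    using Aea ac zero_le_square[of a] zero_le_square[of c] c a by (simp only: A_def poly_simps; linarith)
  have f2: "0 \<le> A\<^sup>2 + 2 * (c + a + e + 2 * a * e) - 5 * (A * e) - c * (A + 2) / 10"
  proof -
    \<comment> \<open>In the claim \<open>f2\<close> the coefficient of \<open>e\<close> is 2 - a -
      5 c < 0, so \<open>e = a\<close> is the worst case. The rest is bounded below by interpolating
      in \<open>a\<close> between 0 and 2.\<close>
    have "(a + 5 * c - 2) * e \<le> (a + 5 * c - 2) * a"
      using a c e by (intro mult_left_mono) auto
    moreover have "0 \<le> a * (2 - a)" "0 \<le> a * (2 - a) * c"
      using a c by auto
    moreover have "0 \<le> (a / 2) * ((9/10) * c\<^sup>2 - (23/5) * c + (36/5)) + (1 - a / 2) * ((9/10) * c\<^sup>2 + (9/5) * c)"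
    proof -
      have "0 \<le> (9/10) * (c - 23/9)\<^sup>2" by simp
      then have "0 \<le> (9/10) * c\<^sup>2 - (23/5) * c + (36/5)" by (simp only: poly_simps; linarith)
      then have "0 \<le> (a / 2) * ((9/10) * c\<^sup>2 - (23/5) * c + (36/5))" using a by (intro mult_nonneg_nonneg) auto
      moreover have "0 \<le> (1 - a / 2) * ((9/10) * c\<^sup>2 + (9/5) * c)"
        using a c by (intro mult_nonneg_nonneg add_nonneg_nonneg) auto
      ultimately show ?thesis by linarith
    qed
    ultimately show ?thesis using a ac ac2 c2 ae
      by (simp only: A_def poly_simps; linarith)
  qed
  have slope: "0 \<le> c + a + e + 2 * a * e - c / 10" using c a e ae by simp
  show ?thesis
  proof (cases "x \<le> 2")
    case True
    let ?p = "A\<^sup>2 - A * e - c * A / 10"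
    let ?q = "c + a + e + 2 * a * e - 2 * (A * e) - c / 10"
    have "0 \<le> ?p + 2 * ?q" using f2 by (simp only: poly_simps; linarith)
    then have "0 \<le> ?p + ?q * x" by (rule linear_nonneg[OF x True f0])
    moreover have "gx * (A * e) \<le> (1 + 2 * x) * (A * e)" using gx(1) Ae by (rule mult_right_mono)
    ultimately show ?thesis using qA by (simp only: poly_simps; linarith)
  next
    case False
    let ?p = "A\<^sup>2 - 5 * (A * e) - c * A / 10"
    let ?q = "c + a + e + 2 * a * e - c / 10"
    have "0 \<le> ?p + 2 * ?q" using f2 by (simp only: poly_simps; linarith)
    then have "0 \<le> ?p + ?q * x" by (rule linear_nonneg_ge[rotated]) (use False slope in simp_all)
    moreover have "gx * (A * e) \<le> 5 * (A * e)" using gx(2) Ae by (rule mult_right_mono)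
    ultimately show ?thesis using qA by (simp only: poly_simps; linarith)
  qed
qed

text \<open>The first two terms are \<open>(1 + 2 * r) * D\<^sup>2\<close> for the value
  \<open>r\<close> of the map. With the constant weight 5 at \<open>a\<close>, the cancellation of
  x^2 that makes the two previous cases affine is lost.\<close>

lemma contraction_case_above_large:
  fixes a c m x gx q :: real
  assumes c: "c \<ge> (117/100)" and a: "a \<ge> 2" and m: "m \<ge> 0" "m \<le> 1" and x: "x \<ge> 0"
    and q: "q \<ge> 0" and gx: "gx \<le> 1 + 2 * x" "gx \<le> 5"
  defines "A \<equiv> c + a"
  shows "0 \<le> (A + x)\<^sup>2 + 2 * (x * a + A * m) * (A + x) - 5 * (x * (c + x + m)) 
     - (2 * m - q) * A * (A + x) - gx * (A * (a - m)) - c * (A + x) / 10"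
proof -
  have A: "A \<ge> (317/100)" "A > 0" using a c by (auto simp: A_def)
  have Aam: "0 \<le> A * (a - m)" using A a m by simp
  have qA: "0 \<le> q * A * (A + x)" using q A x by simp
  have Am: "0 \<le> A * m" using A m by simp
  have Am2: "(317/100) * m \<le> A * m" using A m by (intro mult_right_mono) auto
  have Axm: "0 \<le> x * ((2 * A - 5) * m)" using A m x by (intro mult_nonneg_nonneg) auto
  have ac: "2 * c \<le> a * c" using a c by (intro mult_right_mono) auto
  have c2: "117 * c \<le> 100 * (c * c)" using mult_right_mono[of "117/100" c c] c by simp
  have quad: "0 \<le> (9/10) * c\<^sup>2 - (22/5) * c + 8"
  proof -
    have "0 \<le> (9/10) * (c - 22/9)\<^sup>2" by simp
    then show ?thesis by (simp only: power2_eq_square algebra_simps)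
  qed
  show ?thesis
  proof (cases "x \<le> 2")
    case True
    have "0 \<le> ((9/10) * c\<^sup>2 + (9/5) * c) + (4 - (31/10) * c) * x"
    proof (rule linear_nonneg[OF x True])
      show "0 \<le> (9/10) * c\<^sup>2 + (9/5) * c" using c by simp
      show "0 \<le> (9/10) * c\<^sup>2 + (9/5) * c + 2 * (4 - (31/10) * c)" using quad by (simp add: algebra_simps)
    qed
    moreover have "0 \<le> (a - 2) * ((9/10) * c + 2 * x + 2 * x\<^sup>2)"
      using a c x by (intro mult_nonneg_nonneg) auto
    moreover have "gx * (A * (a - m)) \<le> (1 + 2 * x) * (A * (a - m))" using gx(1) Aam by (rule mult_right_mono)
    ultimately show ?thesis using qA Am Axm
      by (simp only: A_def poly_simps; linarith)
  next
    case False
    have "0 \<le> (a - 2) * ((9/10) * c + 12)" using a c by simp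
    then have f2: "0 \<le> c\<^sup>2 + a * c - 6 * c + 12 * a - 16 - c * (c + a + 2) / 10"
      using quad by (simp only: poly_simps; linarith)
    have "0 \<le> (x - 2) * (2 * A + 2 * a * A - 5 * c - 5 * m + (x + 2) * (2 * a - 4) - c / 10)"
    proof (intro mult_nonneg_nonneg)
      have "2 * A \<le> a * A" using a A by (intro mult_right_mono) auto
      moreover have "0 \<le> (x + 2) * (2 * a - 4)" using a x by simp
      ultimately show "0 \<le> 2 * A + 2 * a * A - 5 * c - 5 * m + (x + 2) * (2 * a - 4) - c / 10"
        using m a c by (simp add: A_def)
    qed (use False in simp)
    moreover have "gx * (A * (a - m)) \<le> 5 * (A * (a - m))" using gx(2) Aam by (rule mult_right_mono)
    moreover have "0 \<le> (A - 2) * m" using A m by simp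
    ultimately show ?thesis using qA f2
      by (simp only: A_def poly_simps; linarith)
  qed
qed

text \<open>All four weights are 5, and expanding \<open>D\<^sup>2\<close> reduces the claim to
  \<open>key\<close>. For fixed \<open>b\<close> and \<open>x\<close> its left-hand side is
  quadratic in \<open>a\<close> and its right-hand side linear, so the hypotheses on
  \<open>r\<close> have to bound \<open>a\<close>; \<open>r \<le> x\<close> yields
  \<open>Am1\<close> and \<open>r \<le> b\<close> yields \<open>Am2\<close>.\<close>

lemma contraction_case_high:
  fixes a b c x m r :: real
  assumes c: "c \<ge> (117/100)" and a: "a \<ge> 2" and b: "b \<ge> 2" and x: "x \<ge> 2"
    and m: "m = 1 / (c + b)" and A: "A = c + a" and D: "D = A + x"
    and r: "r * D = x * a + A * m" "r \<le> b" "r \<le> x"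
  shows "5 * (x * (c + x + m)) + 5 * (A * m\<^sup>2 * D) + 5 * (A * (a - m)) + c * D / 10 \<le> 5 * D\<^sup>2"
proof -
  define s where "s = c + x"
  have pos: "A > 0" "D > 0" "s > 0" "s \<ge> (317/100)" "c + b > 0" using a b c x A D by (auto simp: s_def)
  have m01: "m > 0" "m \<le> (8/25)" using b c by (auto simp: m field_simps)
  have mb: "m * (c + b) = 1" using pos by (simp add: m)
  have Am1: "A * m \<le> x * s"
  proof -
    have "r * D \<le> x * D" using r pos by (intro mult_right_mono) auto
    then show ?thesis using r by (simp add: A D s_def algebra_simps)
  qed
  have Am2: "A * m * s \<le> D"
  proof -
    have "x * a \<le> b * D"
    proof -
      have "r * D \<le> b * D" using r pos by (intro mult_right_mono) auto
      moreover have "0 \<le> A * m" using pos m01 by simp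
      ultimately show ?thesis using r by linarith
    qed
    then have "A * s \<le> (c + b) * D" by (simp add: A D s_def algebra_simps)
    then have "m * (A * s) \<le> m * ((c + b) * D)" using m01 by (intro mult_left_mono) auto
    also have "\<dots> = D" using mb by (simp flip: mult.assoc)
    finally show ?thesis by (simp add: mult_ac)
  qed
  have cx: "0 \<le> c * x" "0 \<le> a * c" "2 * c \<le> a * c" "2 * c \<le> c * x" "(117/100) * c \<le> c * c" "(117/100) * x \<le> c * x" "(117/100) * a \<le> a * c"
    using mult_right_mono[of 2 a c] mult_left_mono[of 2 x c] mult_right_mono[of "117/100" c c]
      mult_right_mono[of "117/100" c x] mult_left_mono[of "117/100" c a] c a x by auto
  have ax: "2 * x \<le> a * x" "2 * a \<le> a * x" using mult_right_mono[of 2 a x] mult_left_mono[of 2 x a] a x by auto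
  have xm: "x * m \<le> x * (8/25)" "0 \<le> x * m" using mult_left_mono[of m "8/25" x] m01 x by auto
  have am: "a * m \<le> a * (8/25)" using mult_left_mono[of m "8/25" a] m01 a by auto
  have Am: "0 \<le> A * m" using pos m01 by simp
  have key: "A * m\<^sup>2 * D + c * D / 50 \<le> A * (c + m) + x * (c + 2 * a - m)"
  \<comment> \<open>Note that D = a + s. For \<open>a \<le> s\<close>, \<open>Am2\<close> gives
    \<open>A * m \<le> 2\<close>; otherwise the product of \<open>Am1\<close> and \<open>Am2\<close>
    gives \<open>A * m * (A * m) \<le> D * x\<close>.\<close>
  proof (cases "a \<le> s")
    case True
    have "A * m * s \<le> 2 * s" using Am2 True by (simp add: A D s_def)
    then have "A * m \<le> 2" using pos by simp
    then have "A * m * (A * m) \<le> 2 * 2" "A * m * (x * m) \<le> 2 * (x * m)"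
      using mult_mono[of "A * m" 2 "A * m" 2] mult_right_mono[of "A * m" 2 "x * m"] Am xm by auto
    then have "A * m\<^sup>2 * D \<le> 4 + 2 * (x * m)" by (simp add: D power2_eq_square algebra_simps)
    then show ?thesis using xm Am cx ax x c a by (simp only: A D poly_simps; linarith)
  next
    case False
    have "A * m * s * (A * m) \<le> D * (x * s)" using mult_mono[OF Am2 Am1] Am pos by simp
    then have "(A * m * (A * m)) * s \<le> (D * x) * s" by (simp add: algebra_simps)
    then have 1: "A * m * (A * m) \<le> D * x" using pos by simp
    have "A * m * s * (x * m) \<le> D * (x * m)" using Am2 xm by (intro mult_right_mono) auto
    also have "D * (x * m) \<le> (x * m + a * m) * s"
    proof -
      have "a * m * x \<le> a * m * s" using a m01 c by (intro mult_left_mono) (auto simp: s_def)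
      then show ?thesis by (simp add: A D s_def algebra_simps)
    qed
    finally have "(A * m * (x * m)) * s \<le> (x * m + a * m) * s" by (simp add: algebra_simps)
    then have 2: "A * m * (x * m) \<le> x * m + a * m" using pos by simp
    have 3: "A * m\<^sup>2 * D = A * m * (A * m) + A * m * (x * m)" by (simp add: D power2_eq_square algebra_simps)
    have "x * s \<le> x * a" using False x by (intro mult_left_mono) auto
    then have "x * c + x * x \<le> x * a" by (simp add: s_def algebra_simps)
    then show ?thesis using 1 2 xm am Am cx ax x c a unfolding 3 by (simp only: A D poly_simps; linarith)
  qed
  have "D\<^sup>2 = x * (c + x + m) + A * (a - m) + (A * (c + m) + x * (c + 2 * a - m))"
    by (simp add: A D power2_eq_square algebra_simps)
  then show ?thesis using key by (simp add: algebra_simps)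
qed

section \<open>Contraction of the capped recursion\<close>

definition step :: "real \<Rightarrow> real \<Rightarrow> real \<Rightarrow> real \<Rightarrow> real" where
  "step c a b x = (x * a + (c + a) / (c + b)) / (c + a + x)"

text \<open>The slack c D / 10 of the next lemma, as a fraction of \<open>gw r * D\<^sup>2\<close>:
  for arguments at most \<open>K\<close> it is at least 1/(50 (1 + 2 K)), because gw <= 5 and D <= c
  (1 + 2 K).\<close>

definition rate :: "real \<Rightarrow> real" where
  "rate K = 1 - 1 / (50 * (1 + 2 * K))"

text \<open>The first three summands are \<open>D\<^sup>2\<close> times the absolute partial
  derivatives of \<open>step\<close> in \<open>a\<close>, \<open>b\<close> and \<open>x\<close>,
  each times the weight of its variable. The fourth is the margin that leads to a rate below
  1.\<close>

lemma step_contraction_slack: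
  fixes a b c x :: real
  assumes c: "c \<ge> 117/100" and a: "a \<ge> 0" and b: "b \<ge> 0" and x: "x \<ge> 0"
    and region: "step c a b x \<le> max 2 (min b x)"
  defines "m \<equiv> 1 / (c + b)" and "A \<equiv> c + a" and "D \<equiv> c + a + x"
  shows "gw a * (x * (c + x + m)) + gw b * (A * m\<^sup>2 * D) + gw x * (A * \<bar>a - m\<bar>) + c * D / 10
    \<le> gw (step c a b x) * D\<^sup>2"
proof -
  define r where "r = step c a b x"
  have D: "D = A + x" by (simp add: D_def A_def)
  have pos: "A > 0" "D > 0" "c + b > 0" using a b c x by (auto simp: A_def D_def)
  have mb: "m * (c + b) = 1" using pos by (simp add: m_def)
  have m: "m > 0" "m \<le> 171/200" using b c by (auto simp: m_def field_simps)
  have rD: "r * D = x * a + A * m" using pos by (simp add: r_def step_def m_def D_def A_def)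
  show ?thesis
  proof (cases "r \<le> 2")
    case True
    \<comment> \<open>Chosen so that (1 + 2 b) m^2 = 2 m - q, a consequence of m (c + b) = 1; the
      term 2 m then cancels against the one in \<open>gr\<close>.\<close>
    define q where "q = (2 * c - 1) * m\<^sup>2"
    have q0: "q \<ge> 0" using c by (simp add: q_def)
    have gb: "gw b * (A * m\<^sup>2 * D) \<le> (2 * m - q) * A * D"
    proof -
      have "m * b = 1 - m * c" using mb by (simp add: algebra_simps)
      then have "m * (m * b) = m * (1 - m * c)" by simp
      then have "(1 + 2 * b) * m\<^sup>2 = 2 * m - q" by (simp add: q_def power2_eq_square algebra_simps)
      moreover have "gw b * m\<^sup>2 \<le> (1 + 2 * b) * m\<^sup>2" by (intro mult_right_mono gw_bounds) auto
      ultimately have "gw b * m\<^sup>2 * (A * D) \<le> (2 * m - q) * (A * D)"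
        using pos by (intro mult_right_mono) auto
      then show ?thesis by (simp add: mult_ac)
    qed
    have "(1 + 2 * r) * D\<^sup>2 = D * D + 2 * (r * D) * D" by (simp add: power2_eq_square algebra_simps)
    then have gr: "gw r * D\<^sup>2 = D\<^sup>2 + 2 * (x * a + A * m) * D"
      using True by (simp add: gw_low rD power2_eq_square)
    have gx: "gw x \<le> 1 + 2 * x" "gw x \<le> 5" by (rule gw_bounds)+
    consider "a \<le> m" | "m < a" "a \<le> 2" | "2 < a" by linarith
    then show ?thesis
    proof cases
      case 1
      have ga: "gw a = 1 + 2 * a" using 1 m by (intro gw_low) simp
      have "(m - a)\<^sup>2 \<le> m\<^sup>2" using a 1 by (intro power_mono) auto
      then have "67/50 * (m - a)\<^sup>2 \<le> q" unfolding q_def using c by (intro mult_mono) auto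
      from contraction_case_below[OF c a _ x _ this gx] 1 m
      have "0 \<le> A\<^sup>2 + x * (c + a - (m - a)) - 2 * x * a * (m - a) + q * A * (A + x) - gw x * (A * (m - a)) - c * (A + x) / 10"
        by (simp add: A_def)
      moreover have "A\<^sup>2 + x * (c + a - (m - a)) - 2 * x * a * (m - a)
         = D\<^sup>2 + 2 * x * a * D - (1 + 2 * a) * (x * (c + x + m))"
        by (simp add: D A_def power2_eq_square algebra_simps)
      moreover have "\<bar>a - m\<bar> = m - a" using 1 by simp
      ultimately show ?thesis using gb unfolding r_def[symmetric] gr ga
        by (simp add: D algebra_simps)
    next
      case 2
      have ga: "gw a = 1 + 2 * a" using 2 by (intro gw_low) simp
      from contraction_case_above_small[OF c a 2(2) _ _ x q0 gx, of "a - m"] 2 m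
      have "0 \<le> A\<^sup>2 + x * (c + a + (a - m)) + 2 * x * a * (a - m) + q * A * (A + x) - gw x * (A * (a - m)) - c * (A + x) / 10"
        by (simp add: A_def)
      moreover have "A\<^sup>2 + x * (c + a + (a - m)) + 2 * x * a * (a - m)
         = D\<^sup>2 + 2 * x * a * D - (1 + 2 * a) * (x * (c + x + m))"
        by (simp add: D A_def power2_eq_square algebra_simps)
      moreover have "\<bar>a - m\<bar> = a - m" using 2 by simp
      ultimately show ?thesis using gb unfolding r_def[symmetric] gr ga
        by (simp add: D algebra_simps)
    next
      case 3
      have ga: "gw a = 5" using 3 by (intro gw_high) simp
      from contraction_case_above_large[OF c _ _ _ x q0 gx, of a m] 3 m
      have "0 \<le> (A + x)\<^sup>2 + 2 * (x * a + A * m) * (A + x) - 5 * (x * (c + x + m)) 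
       - (2 * m - q) * A * (A + x) - gw x * (A * (a - m)) - c * (A + x) / 10"
        by (simp add: A_def)
      moreover have "\<bar>a - m\<bar> = a - m" using 3 m by simp
      ultimately show ?thesis using gb unfolding r_def[symmetric] gr unfolding ga D by linarith
    qed
  next
    case False
    have bx: "r \<le> b" "r \<le> x" "b \<ge> 2" "x \<ge> 2" using region False by (auto simp: r_def[symmetric] split: if_splits)
    \<comment> \<open>\<open>r\<close> is the mean of \<open>a\<close> and \<open>m\<close> with
      weights \<open>x\<close> and \<open>A\<close>. As \<open>m\<close> is below 2, a value above 2
      forces \<open>a\<close> above 2.\<close>
    have a2: "a \<ge> 2"
    proof (rule ccontr)
      assume "\<not> a \<ge> 2"
      then have "x * a \<le> x * 2" using x by (intro mult_left_mono) auto
      moreover have "A * m \<le> A * 2" using pos m by (intro mult_left_mono) auto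
      ultimately have "r * D \<le> 2 * D" unfolding rD by (simp add: D)
      then show False using pos False by simp
    qed
    have "m = 1 / (c + b)" "A = c + a" by (simp_all add: m_def A_def)
    from contraction_case_high[OF c a2 bx(3,4) this D rD bx(1,2)]
    have "5 * (x * (c + x + m)) + 5 * (A * m\<^sup>2 * D) + 5 * (A * (a - m)) + c * D / 10 \<le> 5 * D\<^sup>2" .
    moreover have "gw a = 5" "gw b = 5" "gw x = 5" "gw r = 5" using a2 bx False by (auto intro!: gw_high)
    moreover have "\<bar>a - m\<bar> = a - m" using a2 m by simp
    ultimately show ?thesis unfolding r_def[symmetric] by simp
  qed
qed

lemma step_contraction:
  fixes a b c x :: real
  assumes c: "c \<ge> 117/100" and a: "a \<ge> 0" "a \<le> K" and b: "b \<ge> 0" and x: "x \<ge> 0" "x \<le> K"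
    and region: "step c a b x \<le> max 2 (min b x)"
  defines "m \<equiv> 1 / (c + b)" and "A \<equiv> c + a" and "D \<equiv> c + a + x"
  shows "gw a * (x * (c + x + m) / D\<^sup>2) + gw b * (A * m\<^sup>2 / D) + gw x * (A * \<bar>a - m\<bar> / D\<^sup>2)
    \<le> rate K * gw (step c a b x)"
proof -
  define g where "g = gw (step c a b x)"
  have D: "D > 0" using a x c by (simp add: D_def)
  have K: "K \<ge> 0" using a by simp
  have g5: "g \<le> 5" by (simp add: g_def gw_def)
  have "2 * K \<le> c * (2 * K)" using c K mult_right_mono[of 1 c "2 * K"] by simp
  then have "D \<le> c * (1 + 2 * K)" using a x by (simp add: D_def algebra_simps)
  then have "D * D / (50 * (1 + 2 * K)) \<le> D * (c * (1 + 2 * K)) / (50 * (1 + 2 * K))"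
    using D K by (intro divide_right_mono mult_left_mono) auto
  also have "\<dots> = c * D / 50" using K by (simp add: field_simps)
  finally have 1: "D\<^sup>2 / (50 * (1 + 2 * K)) \<le> c * D / 50" by (simp only: power2_eq_square)
  have "g * (D\<^sup>2 / (50 * (1 + 2 * K))) \<le> 5 * (D\<^sup>2 / (50 * (1 + 2 * K)))"
    using g5 K by (intro mult_right_mono) auto
  also have "\<dots> \<le> c * D / 10" using 1 by linarith
  finally have "g * D\<^sup>2 - c * D / 10 \<le> rate K * g * D\<^sup>2"
    by (simp add: rate_def algebra_simps)
  with step_contraction_slack[OF c a(1) b x(1) region]
  have "gw a * (x * (c + x + m)) + gw b * (A * m\<^sup>2 * D) + gw x * (A * \<bar>a - m\<bar>) \<le> rate K * g * D\<^sup>2"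
    by (simp add: g_def m_def A_def D_def)
  then have "(gw a * (x * (c + x + m)) + gw b * (A * m\<^sup>2 * D) + gw x * (A * \<bar>a - m\<bar>)) / D\<^sup>2 \<le> rate K * g"
    using D by (simp add: field_simps)
  moreover have "gw b * (A * m\<^sup>2 * D) / D\<^sup>2 = gw b * (A * m\<^sup>2 / D)"
    using D by (simp add: power2_eq_square)
  ultimately show ?thesis by (simp add: add_divide_distrib g_def)
qed

text \<open>The arc length of the metric \<open>dr / gw r\<close>; \<open>pinv\<close> is its inverse on \<open>r \<ge> 0\<close>.\<close>

definition psi :: "real \<Rightarrow> real" where
  "psi r = (if r \<le> 2 then ln (1 + 2 * r) / 2 else ln 5 / 2 + (r - 2) / 5)"

definition pinv :: "real \<Rightarrow> real" where
  "pinv s = (if s \<le> ln 5 / 2 then (exp (2 * s) - 1) / 2 else 2 + 5 * (s - ln 5 / 2))"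

lemma DERIV_glue:
  fixes f g :: "real \<Rightarrow> real"
  assumes f: "x \<le> t \<Longrightarrow> DERIV f x :> d" and g: "x \<ge> t \<Longrightarrow> DERIV g x :> d" and eq: "f t = g t"
  shows "DERIV (\<lambda>y. if y \<le> t then f y else g y) x :> d"
proof -
  have 1: "DERIV h x :> d" if "DERIV f x :> d" "x < t" "h = (\<lambda>y. if y \<le> t then f y else g y)" for h
    using has_field_derivative_transform_within_open[OF that(1), of "{..<t}" h] that by auto
  have 2: "DERIV h x :> d" if "DERIV g x :> d" "x > t" "h = (\<lambda>y. if y \<le> t then f y else g y)" for h
    using has_field_derivative_transform_within_open[OF that(1), of "{t<..}" h] that by auto
  have 3: "DERIV (\<lambda>y. if y \<le> t then f y else g y) t :> d" if "x = t"
  proof -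
    have "((\<lambda>y. (f y - f t) / (y - t)) \<longlongrightarrow> d) (at_left t)"
      using f that unfolding has_field_derivative_iff by (auto simp: filterlim_at_split)
    moreover have "((\<lambda>y. (g y - g t) / (y - t)) \<longlongrightarrow> d) (at_right t)"
      using g that unfolding has_field_derivative_iff by (auto simp: filterlim_at_split)
    ultimately show ?thesis
      unfolding has_field_derivative_iff filterlim_at_split
      using eq by (auto elim!: Lim_transform_eventually simp: eventually_at_filter)
  qed
  show ?thesis using 1 2 3 f g by (cases x t rule: linorder_cases) auto
qed

lemma psi_DERIV: "r \<ge> 0 \<Longrightarrow> DERIV psi r :> 1 / gw r"
proof -
  assume "r \<ge> 0"
  have "DERIV (\<lambda>y. if y \<le> 2 then ln (1 + 2 * y) / 2 else ln 5 / 2 + (y - 2) / 5) r :> 1 / gw r"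
    using \<open>r \<ge> 0\<close>
    by (intro DERIV_glue) (auto intro!: derivative_eq_intros simp: gw_low gw_high field_simps)
  then show ?thesis by (simp add: psi_def[abs_def])
qed

lemma gw_pinv:
  shows gw_pinv_low: "s \<le> ln 5 / 2 \<Longrightarrow> gw (pinv s) = exp (2 * s)"
    and gw_pinv_high: "s \<ge> ln 5 / 2 \<Longrightarrow> gw (pinv s) = 5"
proof -
  show low: "gw (pinv s) = exp (2 * s)" if "s \<le> ln 5 / 2" for s
  proof -
    have "exp (2 * s) \<le> exp (ln 5)" using that by (subst exp_le_cancel_iff) simp
    then have "exp (2 * s) \<le> 5" by simp
    then show ?thesis using that by (simp add: pinv_def gw_def min_def field_simps)
  qed
  show "gw (pinv s) = 5" if "s \<ge> ln 5 / 2"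
  proof (cases "s = ln 5 / 2")
    case True
    then have "2 * s = ln 5" by simp
    then have "exp (2 * s) = 5" by (simp only: exp_ln)
    moreover have "s \<le> ln 5 / 2" using True by simp
    ultimately show ?thesis using low by simp
  next
    case False
    then show ?thesis using that by (simp add: pinv_def gw_def)
  qed
qed

lemma gw_pinv_pos: "0 < gw (pinv s)"
  using gw_pinv_low[of s] gw_pinv_high[of s] by (cases "s \<le> ln 5 / 2") auto

lemma pinv_DERIV: "DERIV pinv s :> gw (pinv s)"
proof -
  have "DERIV (\<lambda>y. if y \<le> ln 5 / 2 then (exp (2 * y) - 1) / 2 else 2 + 5 * (y - ln 5 / 2)) s :> gw (pinv s)"
    by (intro DERIV_glue) (auto intro!: derivative_eq_intros simp: gw_pinv_low gw_pinv_high)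
  then show ?thesis by (simp add: pinv_def[abs_def])
qed

lemma pinv_psi: "r \<ge> 0 \<Longrightarrow> pinv (psi r) = r"
  by (auto simp: pinv_def psi_def field_simps)

lemma psi_0: "psi 0 = 0" by (simp add: psi_def)

lemma psi_strict_mono: "0 \<le> r \<Longrightarrow> r < r' \<Longrightarrow> psi r < psi r'"
proof (rule DERIV_pos_imp_increasing[of r r' psi])
  fix x assume "0 \<le> r" "r \<le> x"
  then show "\<exists>y. DERIV psi x :> y \<and> 0 < y"
    using psi_DERIV[of x] gw_bounds(3)[of x] by (intro exI[of _ "1 / gw x"]) auto
qed

lemma psi_mono: "0 \<le> r \<Longrightarrow> r \<le> r' \<Longrightarrow> psi r \<le> psi r'"
  using psi_strict_mono[of r r'] by (cases "r = r'") auto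

lemma psi_min: "0 \<le> r \<Longrightarrow> 0 \<le> s \<Longrightarrow> psi (min r s) = min (psi r) (psi s)"
  using psi_mono[of r s] psi_mono[of s r] by (auto simp: min_def)

lemma psi_max: "0 \<le> r \<Longrightarrow> 0 \<le> s \<Longrightarrow> psi (max r s) = max (psi r) (psi s)"
  using psi_mono[of r s] psi_mono[of s r] by (auto simp: max_def)

lemma pinv_mono: "s \<le> t \<Longrightarrow> pinv s \<le> pinv t"
  using pinv_DERIV gw_pinv_pos by (blast intro: DERIV_nonneg_imp_nondecreasing less_imp_le)

lemma psi_MVT:
  assumes "0 \<le> r" "r < s"
  obtains z where "r < z" "z < s" "psi s - psi r = (s - r) / gw z"
proof -
  have "\<exists>z. r < z \<and> z < s \<and> psi s - psi r = (s - r) * (1 / gw z)"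
    using assms psi_DERIV by (intro MVT2) auto
  then show ?thesis using that by auto
qed

text \<open>The derivative 1 / gw of \<open>psi\<close> lies between 1/5 and 1.\<close>

lemma psi_dist:
  assumes "0 \<le> r" "0 \<le> s"
  shows "\<bar>psi r - psi s\<bar> \<le> \<bar>r - s\<bar>" "\<bar>r - s\<bar> \<le> 5 * \<bar>psi r - psi s\<bar>"
proof -
  have *: "psi s - psi r \<le> s - r \<and> s - r \<le> 5 * (psi s - psi r) \<and> psi r < psi s" if rs: "0 \<le> r" "r < s" for r s
  proof -
    obtain z where z: "r < z" "psi s - psi r = (s - r) / gw z" using psi_MVT[OF rs] by metis
    have g: "1 \<le> gw z" "gw z \<le> 5" using z rs gw_bounds[of z] by auto
    have "(s - r) / gw z \<le> (s - r) / 1"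
      using g rs by (intro divide_left_mono) auto
    then have 1: "psi s - psi r \<le> s - r" by (simp add: z(2))
    have "(s - r) / 5 \<le> (s - r) / gw z"
      using g rs by (intro divide_left_mono) auto
    then have 2: "(s - r) / 5 \<le> psi s - psi r" by (simp only: z(2))
    then have "s - r \<le> 5 * (psi s - psi r)" by (simp add: field_simps)
    then show ?thesis using 1 psi_strict_mono[OF rs] by blast
  qed
  show "\<bar>psi r - psi s\<bar> \<le> \<bar>r - s\<bar>" "\<bar>r - s\<bar> \<le> 5 * \<bar>psi r - psi s\<bar>"
    using *[of r s] *[of s r] assms by (cases r s rule: linorder_cases; auto)+
qed

definition cap :: "real \<Rightarrow> real \<Rightarrow> real \<Rightarrow> real" where
  "cap K b x = 2 + K / (K + 1) * max 0 (min b x - 2)"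

definition capped_step :: "real \<Rightarrow> real \<Rightarrow> real \<Rightarrow> real \<Rightarrow> real \<Rightarrow> real" where
  "capped_step K c a b x = min (step c a b x) (cap K b x)"

text \<open>Only where \<open>h \<le> k\<close> is a derivative bound on \<open>h\<close> available, so the mean value theorem is applied up to
  the first point where \<open>h\<close> reaches \<open>k\<close>, and from there on \<open>k\<close> bounds the minimum.\<close>

lemma first_crossing:
  fixes h k :: "real \<Rightarrow> real"
  assumes cont: "continuous_on {0..1} h" and B: "B \<ge> 0"
    and h: "\<And>t. 0 \<le> t \<Longrightarrow> t \<le> 1 \<Longrightarrow> h t \<le> k t \<Longrightarrow> \<exists>d. DERIV h t :> d \<and> \<bar>d\<bar> \<le> B"
    and k: "\<And>s t. 0 \<le> s \<Longrightarrow> s \<le> t \<Longrightarrow> t \<le> 1 \<Longrightarrow> \<bar>k t - k s\<bar> \<le> B * (t - s)"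
  shows "min (h 1) (k 1) \<le> min (h 0) (k 0) + B"
proof (cases "k 0 \<le> h 0")
  case True
  then show ?thesis using k[of 0 1] by auto
next
  case False
  have mvt: "\<bar>h s - h 0\<bar> \<le> B * s" if s: "0 \<le> s" "s \<le> 1" and below: "\<And>t. 0 < t \<Longrightarrow> t < s \<Longrightarrow> h t \<le> k t" for s
  proof (cases "s = 0")
    case False
    have "\<exists>l z. 0 < z \<and> z < s \<and> DERIV h z :> l \<and> h s - h 0 = (s - 0) * l"
    proof (rule MVT)
      show "0 < s" using s False by simp
      show "continuous_on {0..s} h" using cont by (rule continuous_on_subset) (use s in auto)
      show "h differentiable at x" if "0 < x" "x < s" for x
        using h[of x] below[of x] that s by (auto simp: real_differentiable_def)
    qed
    then obtain l z where z: "0 < z" "z < s" "DERIV h z :> l" "h s - h 0 = s * l" by auto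
    from h[of z] below[of z] z s obtain d where "DERIV h z :> d" "\<bar>d\<bar> \<le> B" by auto
    with z have "\<bar>l\<bar> \<le> B" using DERIV_unique by blast
    then show ?thesis using z s by (simp add: abs_mult mult.commute mult_right_mono)
  qed simp
  have contk: "continuous_on {0..1} k"
  proof (rule lipschitz_on_continuous_on[OF lipschitz_onI])
    fix s t :: real assume "s \<in> {0..1}" "t \<in> {0..1}"
    then show "dist (k s) (k t) \<le> B * dist s t"
      using k[of s t] k[of t s] by (cases "s \<le> t") (auto simp: dist_real_def abs_minus_commute)
  qed (rule B)
  define S where "S = {t \<in> {0..1}. k t \<le> h t}"
  have "closed S" unfolding S_def by (rule continuous_on_closed_Collect_le[OF contk cont]) simp
  then have "compact S" by (rule compact_eq_bounded_closed[THEN iffD2, OF conjI, rotated])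
      (auto simp: S_def intro: bounded_subset[of "{0..1}"])
  show ?thesis
  proof (cases "S = {}")
    case True
    have "\<bar>h 1 - h 0\<bar> \<le> B * 1"
    proof (rule mvt)
      show "h t \<le> k t" if "0 < t" "t < 1" for t
      proof -
        have "t \<notin> S" using True by simp
        then show ?thesis using that by (auto simp: S_def)
      qed
    qed auto
    then show ?thesis using False by auto
  next
    case nonempty: False
    obtain s where s: "s \<in> S" "\<forall>t\<in>S. s \<le> t"
      using compact_attains_inf[OF \<open>compact S\<close> nonempty] by auto
    then have s01: "0 \<le> s" "s \<le> 1" "k s \<le> h s" by (auto simp: S_def)
    have "\<bar>h s - h 0\<bar> \<le> B * s"
    proof (rule mvt[OF s01(1,2)])
      show "h t \<le> k t" if "0 < t" "t < s" for t
        using s(2)[rule_format, of t] that s01 by (force simp: S_def)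
    qed
    moreover have "\<bar>k 1 - k s\<bar> \<le> B * (1 - s)" using k[of s 1] s01 by simp
    ultimately have "k 1 \<le> k s + B * (1 - s)" "h s \<le> h 0 + B * s" by linarith+
    then have "k 1 \<le> h 0 + B" using s01(3) by (simp add: algebra_simps)
    then show ?thesis using False by auto
  qed
qed

text \<open>The reversed path t -> 1 - t satisfies the same hypotheses, which gives the opposite
  inequality.\<close>

lemma first_crossing_abs:
  fixes h k :: "real \<Rightarrow> real"
  assumes cont: "continuous_on {0..1} h" and B: "B \<ge> 0"
    and h: "\<And>t. 0 \<le> t \<Longrightarrow> t \<le> 1 \<Longrightarrow> h t \<le> k t \<Longrightarrow> \<exists>d. DERIV h t :> d \<and> \<bar>d\<bar> \<le> B"
    and k: "\<And>s t. 0 \<le> s \<Longrightarrow> s \<le> t \<Longrightarrow> t \<le> 1 \<Longrightarrow> \<bar>k t - k s\<bar> \<le> B * (t - s)"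
  shows "\<bar>min (h 1) (k 1) - min (h 0) (k 0)\<bar> \<le> B"
proof -
  have "min (h (1 - 1)) (k (1 - 1)) \<le> min (h (1 - 0)) (k (1 - 0)) + B"
  proof (rule first_crossing[where h = "\<lambda>t. h (1 - t)" and k = "\<lambda>t. k (1 - t)"])
    show "continuous_on {0..1} (\<lambda>t. h (1 - t))"
      by (rule continuous_on_compose2[OF cont]) (auto intro!: continuous_intros)
    fix t :: real assume t: "0 \<le> t" "t \<le> 1" "h (1 - t) \<le> k (1 - t)"
    then obtain d where d: "DERIV h (1 - t) :> d" "\<bar>d\<bar> \<le> B" using h[of "1 - t"] by auto
    have "DERIV (\<lambda>t. h (1 - t)) t :> d * (0 - 1)"
      by (rule DERIV_chain2[where f = h and g = "\<lambda>t. 1 - t", OF d(1)]) (auto intro!: derivative_eq_intros)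
    then show "\<exists>d. DERIV (\<lambda>t. h (1 - t)) t :> d \<and> \<bar>d\<bar> \<le> B" using d(2) by (intro exI[of _ "-d"]) auto
  next
    fix s t :: real assume "0 \<le> s" "s \<le> t" "t \<le> 1"
    then show "\<bar>k (1 - t) - k (1 - s)\<bar> \<le> B * (t - s)"
      using k[of "1 - t" "1 - s"] by (auto simp: abs_minus_commute)
  qed (rule B)
  moreover have "min (h 1) (k 1) \<le> min (h 0) (k 0) + B"
    by (rule first_crossing[OF cont B h k])
  ultimately show ?thesis by simp
qed

text \<open>The geodesic from \<open>a\<close> to \<open>a'\<close>: in the coordinate
  \<open>psi\<close> it is traversed with constant speed.\<close>

definition path :: "real \<Rightarrow> real \<Rightarrow> real \<Rightarrow> real" where
  "path a a' t = pinv ((1 - t) * psi a + t * psi a')"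

lemma path_ends: "a \<ge> 0 \<Longrightarrow> path a a' 0 = a" "a' \<ge> 0 \<Longrightarrow> path a a' 1 = a'"
  by (simp_all add: path_def pinv_psi)

lemma path_range:
  assumes "0 \<le> t" "t \<le> 1" "0 \<le> a" "a \<le> K" "0 \<le> a'" "a' \<le> K"
  shows "0 \<le> path a a' t" "path a a' t \<le> K"
proof -
  have p: "0 \<le> psi a" "psi a \<le> psi K" "0 \<le> psi a'" "psi a' \<le> psi K"
    using psi_mono[of 0 a] psi_mono[of 0 a'] assms by (auto simp: psi_0 intro: psi_mono)
  have "0 \<le> (1 - t) * psi a + t * psi a'" using p assms by simp
  moreover have "(1 - t) * psi a + t * psi a' \<le> (1 - t) * psi K + t * psi K"
    using p assms by (intro add_mono mult_left_mono) auto
  ultimately have "pinv (psi 0) \<le> path a a' t" "path a a' t \<le> pinv (psi K)"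
    unfolding path_def by (auto intro!: pinv_mono simp: psi_0 algebra_simps)
  then show "0 \<le> path a a' t" "path a a' t \<le> K" using assms by (simp_all add: pinv_psi)
qed

lemma psi_pinv: "0 \<le> s \<Longrightarrow> psi (pinv s) = s"
  by (auto simp: psi_def pinv_def field_simps) (metis exp_le_cancel_iff exp_ln ln_exp mult.commute zero_less_numeral)+

lemma psi_path:
  assumes "0 \<le> t" "t \<le> 1" "0 \<le> a" "0 \<le> a'"
  shows "psi (path a a' t) = (1 - t) * psi a + t * psi a'"
proof -
  have "0 \<le> psi a" "0 \<le> psi a'" using psi_mono[of 0] assms by (auto simp: psi_0)
  then show ?thesis using assms by (simp add: path_def psi_pinv)
qed

lemma path_DERIV: "DERIV (path a a') t :> (psi a' - psi a) * gw (path a a' t)"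
proof -
  have "DERIV (\<lambda>t. pinv ((1 - t) * psi a + t * psi a')) t :> gw (path a a' t) * (psi a' - psi a)"
    unfolding path_def
    by (rule DERIV_chain2[OF pinv_DERIV]) (auto intro!: derivative_eq_intros)
  then show ?thesis by (simp add: path_def[abs_def] mult.commute)
qed

lemma step_DERIV:
  fixes A B X :: "real \<Rightarrow> real"
  assumes A: "DERIV A t :> A'" and B: "DERIV B t :> B'" and X: "DERIV X t :> X'"
    and nz: "c + B t \<noteq> 0" "c + A t + X t \<noteq> 0"
  defines "m \<equiv> 1 / (c + B t)" and "D \<equiv> c + A t + X t"
  shows "DERIV (\<lambda>t. step c (A t) (B t) (X t)) t :>
     X t * (c + X t + m) / D\<^sup>2 * A' - (c + A t) * m\<^sup>2 / D * B' + (c + A t) * (A t - m) / D\<^sup>2 * X'"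
proof -
  have mB: "m * (c + B t) = 1" using nz by (simp add: m_def)
  have D0: "D \<noteq> 0" using nz by (simp add: D_def)
  have 1: "(A' * (c + B t) - (c + A t) * B') / ((c + B t) * (c + B t)) = A' * m - (c + A t) * m\<^sup>2 * B'"
    using nz by (simp add: m_def power2_eq_square divide_simps)
  have 2: "(c + A t) / (c + B t) = (c + A t) * m" by (simp add: m_def)
  have "DERIV (\<lambda>t. step c (A t) (B t) (X t)) t :>
    ((X' * A t + A' * X t + (A' * (c + B t) - (c + A t) * B') / ((c + B t) * (c + B t))) * D
      - (X t * A t + (c + A t) / (c + B t)) * (A' + X')) / (D * D)"
    unfolding step_def D_def using nz by (auto intro!: derivative_eq_intros A B X simp: algebra_simps)
  also have "((X' * A t + A' * X t + (A' * (c + B t) - (c + A t) * B') / ((c + B t) * (c + B t))) * D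
      - (X t * A t + (c + A t) / (c + B t)) * (A' + X')) / (D * D)
     = X t * (c + X t + m) / D\<^sup>2 * A' - (c + A t) * m\<^sup>2 / D * B' + (c + A t) * (A t - m) / D\<^sup>2 * X'"
    unfolding 1 2 using D0 by (simp add: divide_simps power2_eq_square) (simp add: D_def algebra_simps)
  finally show ?thesis .
qed

lemma step_nonneg: "c \<ge> 1 \<Longrightarrow> a \<ge> 0 \<Longrightarrow> b \<ge> 0 \<Longrightarrow> x \<ge> 0 \<Longrightarrow> 0 \<le> step c a b x"
  unfolding step_def by (intro divide_nonneg_nonneg add_nonneg_nonneg mult_nonneg_nonneg) auto

lemma cap_le: "K \<ge> 0 \<Longrightarrow> cap K b x \<le> max 2 (min b x)"
proof -
  assume K: "K \<ge> 0"
  have "K / (K + 1) * max 0 (min b x - 2) \<le> 1 * max 0 (min b x - 2)"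
    using K by (intro mult_right_mono) (auto simp: field_simps)
  then show ?thesis by (auto simp: cap_def)
qed

lemma cap_ge: "K \<ge> 0 \<Longrightarrow> 2 \<le> cap K b x"
  by (simp add: cap_def)

text \<open>Since \<open>gw\<close> is constant beyond 2, \<open>psi\<close> is affine there, and
  the cap remains an affine contraction in the coordinate \<open>psi\<close>, with the same
  factor.\<close>

lemma psi_cap:
  assumes "K \<ge> 0" "b \<ge> 0" "x \<ge> 0"
  shows "psi (cap K b x) = psi 2 + K / (K + 1) * (max (psi 2) (min (psi b) (psi x)) - psi 2)"
proof -
  have lin: "psi r = psi 2 + (r - 2) / 5" if "r \<ge> 2" for r
    using that by (auto simp: psi_def)
  have "max (psi 2) (min (psi b) (psi x)) = psi (max 2 (min b x))"
    using assms by (simp add: psi_max psi_min)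
  also have "\<dots> = psi 2 + (max 2 (min b x) - 2) / 5" by (rule lin) simp
  finally have 1: "max (psi 2) (min (psi b) (psi x)) - psi 2 = (max 2 (min b x) - 2) / 5" by simp
  have 2: "max 0 (min b x - 2) = max 2 (min b x) - 2" by simp
  show ?thesis
    unfolding 1 lin[OF cap_ge[OF assms(1), of b x]] unfolding cap_def 2 by simp
qed

lemma rate_bounds: "K \<ge> 0 \<Longrightarrow> 0 < rate K" "K \<ge> 0 \<Longrightarrow> rate K < 1" "K \<ge> 0 \<Longrightarrow> K / (K + 1) \<le> rate K"
  by (auto simp: rate_def field_simps)

theorem capped_step_contraction:
  fixes K c :: real
  assumes c: "c \<ge> 117/100" and K: "K \<ge> 0"
    and a: "0 \<le> a" "a \<le> K" "0 \<le> a'" "a' \<le> K" and b: "0 \<le> b" "b \<le> K" "0 \<le> b'" "b' \<le> K"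
    and x: "0 \<le> x" "x \<le> K" "0 \<le> x'" "x' \<le> K"
    and E: "\<bar>psi a - psi a'\<bar> \<le> E" "\<bar>psi b - psi b'\<bar> \<le> E" "\<bar>psi x - psi x'\<bar> \<le> E"
  shows "\<bar>psi (capped_step K c a b x) - psi (capped_step K c a' b' x')\<bar> \<le> rate K * E"
proof -
  define h where "h t = psi (step c (path a a' t) (path b b' t) (path x x' t))" for t
  define k where "k t = psi (cap K (path b b' t) (path x x' t))" for t
  have E0: "E \<ge> 0" using E(1) by linarith
  note r = path_range[OF _ _ a] path_range[OF _ _ b] path_range[OF _ _ x]
  have V: "step c (path a a' t) (path b b' t) (path x x' t) \<ge> 0" if "0 \<le> t" "t \<le> 1" for t
    using r[OF that] c by (intro step_nonneg) auto
  have D: "DERIV h t :> 1 / gw (step c (path a a' t) (path b b' t) (path x x' t)) *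
      (path x x' t * (c + path x x' t + 1 / (c + path b b' t)) / (c + path a a' t + path x x' t)\<^sup>2 * ((psi a' - psi a) * gw (path a a' t))
       - (c + path a a' t) * (1 / (c + path b b' t))\<^sup>2 / (c + path a a' t + path x x' t) * ((psi b' - psi b) * gw (path b b' t))
       + (c + path a a' t) * (path a a' t - 1 / (c + path b b' t)) / (c + path a a' t + path x x' t)\<^sup>2 * ((psi x' - psi x) * gw (path x x' t)))"
    if "0 \<le> t" "t \<le> 1" for t
  proof -
    have nz: "c + path b b' t \<noteq> 0" "c + path a a' t + path x x' t \<noteq> 0" using r[OF that] c by auto
    show ?thesis unfolding h_def[abs_def]
      by (rule DERIV_chain2[OF psi_DERIV[OF V[OF that]] step_DERIV[OF path_DERIV path_DERIV path_DERIV nz]])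
  qed
  have "\<bar>min (h 1) (k 1) - min (h 0) (k 0)\<bar> \<le> rate K * E"
  proof (rule first_crossing_abs)
    show "continuous_on {0..1} h"
      using D by (intro DERIV_continuous_on) (auto intro: has_field_derivative_at_within)
    show "0 \<le> rate K * E" using E0 rate_bounds[OF K] by simp
  next
    fix t :: real assume t: "0 \<le> t" "t \<le> 1" and hk: "h t \<le> k t"
    define p q y where "p = path a a' t" and "q = path b b' t" and "y = path x x' t"
    define m where "m = 1 / (c + q)"
    have rng: "0 \<le> p" "p \<le> K" "0 \<le> q" "q \<le> K" "0 \<le> y" "y \<le> K" using r[OF t] by (auto simp: p_def q_def y_def)
    have V0: "0 \<le> step c p q y" using V[OF t] by (simp add: p_def q_def y_def)
    have "step c p q y \<le> cap K q y"
    proof (rule ccontr)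
      assume "\<not> step c p q y \<le> cap K q y"
      then have "psi (cap K q y) < psi (step c p q y)" using cap_ge[OF K, of q y] by (intro psi_strict_mono) auto
      then show False using hk by (simp add: h_def k_def p_def q_def y_def)
    qed
    then have "step c p q y \<le> max 2 (min q y)" using cap_le[OF K, of q y] by linarith
    note con = step_contraction[OF c rng(1,2,3,5,6) this, folded m_def]
    define g where "g = gw (step c p q y)"
    have g: "g \<ge> 1" using gw_bounds(3)[OF V0] by (simp add: g_def)
    have gs: "gw p > 0" "gw q > 0" "gw y > 0" using gw_bounds(3) rng by force+
    have m0: "m > 0" using c rng by (simp add: m_def)
    define d1 d2 d3 where "d1 = y * (c + y + m) / (c + p + y)\<^sup>2" and "d2 = (c + p) * m\<^sup>2 / (c + p + y)"
      and "d3 = (c + p) * (p - m) / (c + p + y)\<^sup>2"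
    have pos: "d1 \<ge> 0" "d2 \<ge> 0" using rng c m0 by (auto simp: d1_def d2_def)
    have d3: "\<bar>d3\<bar> = (c + p) * \<bar>p - m\<bar> / (c + p + y)\<^sup>2" using c rng by (simp add: d3_def abs_mult)
    have con': "gw p * d1 + gw q * d2 + gw y * \<bar>d3\<bar> \<le> rate K * g"
      using con unfolding d3 d1_def d2_def g_def by simp
    have De: "DERIV h t :> 1 / g * (d1 * ((psi a' - psi a) * gw p) - d2 * ((psi b' - psi b) * gw q) + d3 * ((psi x' - psi x) * gw y))"
      using D[OF t] by (simp only: p_def[symmetric] q_def[symmetric] y_def[symmetric] m_def[symmetric] g_def[symmetric] d1_def[symmetric] d2_def[symmetric] d3_def[symmetric])
    have "\<bar>d1 * ((psi a' - psi a) * gw p)\<bar> \<le> d1 * (E * gw p)"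
      "\<bar>d2 * ((psi b' - psi b) * gw q)\<bar> \<le> d2 * (E * gw q)"
      "\<bar>d3 * ((psi x' - psi x) * gw y)\<bar> \<le> \<bar>d3\<bar> * (E * gw y)"
      using E gs pos by (auto simp: abs_mult abs_minus_commute intro!: mult_left_mono mult_right_mono)
    then have "\<bar>d1 * ((psi a' - psi a) * gw p) - d2 * ((psi b' - psi b) * gw q) + d3 * ((psi x' - psi x) * gw y)\<bar>
       \<le> E * (gw p * d1 + gw q * d2 + gw y * \<bar>d3\<bar>)" by (simp add: algebra_simps)
    also have "\<dots> \<le> E * (rate K * g)" using con' E0 by (intro mult_left_mono) auto
    finally have "\<bar>1 / g * (d1 * ((psi a' - psi a) * gw p) - d2 * ((psi b' - psi b) * gw q) + d3 * ((psi x' - psi x) * gw y))\<bar> \<le> rate K * E"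
      using g by (simp add: abs_mult field_simps)
    then show "\<exists>d. DERIV h t :> d \<and> \<bar>d\<bar> \<le> rate K * E" using De by blast
  next
    fix s t :: real assume st: "0 \<le> s" "s \<le> t" "t \<le> 1"
    have lip: "\<bar>psi (path u u' t) - psi (path u u' s)\<bar> \<le> E * (t - s)" if "0 \<le> u" "0 \<le> u'" "\<bar>psi u - psi u'\<bar> \<le> E" for u u'
    proof -
      have "psi (path u u' t) - psi (path u u' s) = (t - s) * (psi u' - psi u)"
        using psi_path[of t u u'] psi_path[of s u u'] st that by (simp add: algebra_simps)
      then have "\<bar>psi (path u u' t) - psi (path u u' s)\<bar> = (t - s) * \<bar>psi u - psi u'\<bar>"
        using st by (simp add: abs_mult abs_minus_commute)
      also have "\<dots> \<le> (t - s) * E" using that st by (intro mult_left_mono) auto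
      finally show ?thesis by (simp add: mult.commute)
    qed
    define M where "M t = max (psi 2) (min (psi (path b b' t)) (psi (path x x' t)))" for t
    have "\<bar>M t - M s\<bar> \<le> E * (t - s)"
      using lip[OF b(1,3) E(2)] lip[OF x(1,3) E(3)] by (auto simp: M_def)
    then have "K / (K + 1) * \<bar>M t - M s\<bar> \<le> rate K * (E * (t - s))"
      using rate_bounds[OF K] K by (intro mult_mono) auto
    moreover have "k t - k s = K / (K + 1) * (M t - M s)"
      using r[of t] r[of s] st K by (simp add: k_def psi_cap M_def right_diff_distrib)
    ultimately show "\<bar>k t - k s\<bar> \<le> rate K * E * (t - s)"
      using K by (simp add: abs_mult mult.assoc)
  qed
  moreover have "psi (capped_step K c a b x) = min (h 0) (k 0)" "psi (capped_step K c a' b' x') = min (h 1) (k 1)"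
    using V[of 0] V[of 1] cap_ge[OF K] a b x
    by (auto simp: capped_step_def h_def k_def path_ends intro!: psi_min order_trans[OF _ cap_ge[OF K]])
  ultimately show ?thesis by (simp add: abs_minus_commute)
qed

section \<open>Instances with shifted functions\<close>

text \<open>A state assigns a sequence to each vertex. Selecting an edge at \<open>v\<close> removes the first entry of the
  sequence at \<open>v\<close>; infinite sequences make this total.\<close>

type_synonym edge = "nat \<times> nat \<times> real"
type_synonym state = "nat \<Rightarrow> nat \<Rightarrow> real"

definition shift :: "nat \<Rightarrow> state \<Rightarrow> state" where
  "shift v \<phi> = \<phi>(v := \<lambda>i. \<phi> v (Suc i))"

text \<open>The two summands correspond to the head edge being absent and selected. The index set
  \<open>V\<close> is kept apart from the edges, so that a vertex without edges is counted exactly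
  if it belongs to \<open>V\<close>.\<close>

fun Z :: "edge list \<Rightarrow> nat set \<Rightarrow> state \<Rightarrow> real" where
  "Z [] V \<phi> = (\<Prod>w\<in>V. \<phi> w 0)"
| "Z ((u, v, l) # es) V \<phi> = Z es V \<phi> + l * Z es V (shift u (shift v \<phi>))"

definition verts :: "edge list \<Rightarrow> nat set" where
  "verts es = (\<Union>(u, v, l) \<in> set es. {u, v})"

lemma verts_simps [simp]:
  "verts [] = {}" "verts ((u, v, l) # es) = insert u (insert v (verts es))"
  by (auto simp: verts_def)

lemma finite_verts [simp]: "finite (verts es)"
  by (auto simp: verts_def)

lemma shift_commute: "shift u (shift v \<phi>) = shift v (shift u \<phi>)"
  by (auto simp: shift_def fun_eq_iff)

lemma shift_apply: "shift u \<phi> w i = (if w = u then \<phi> w (Suc i) else \<phi> w i)"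
  by (simp add: shift_def)

lemma shift_upd: "shift u (\<phi>(w := f)) = (if u = w then \<phi>(w := \<lambda>i. f (Suc i)) else (shift u \<phi>)(w := f))"
  by (auto simp: shift_def fun_eq_iff)

lemma Z_swap: "Z (e # e' # es) V \<phi> = Z (e' # e # es) V \<phi>"
proof -
  obtain u v l u' v' l' where e: "e = (u, v, l)" "e' = (u', v', l')" by (cases e, cases e')
  have "shift u' (shift v' (shift u (shift v \<phi>))) = shift u (shift v (shift u' (shift v' \<phi>)))"
    by (metis shift_commute)
  then show ?thesis by (simp add: e algebra_simps)
qed

lemma Z_move: "Z (xs @ e # es) V \<phi> = Z (e # xs @ es) V \<phi>"
proof (induction xs arbitrary: \<phi>)
  case (Cons x xs)
  obtain u v l where x: "x = (u, v, l)" by (cases x)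
  have "Z ((x # xs) @ e # es) V \<phi> = Z (x # e # xs @ es) V \<phi>"
    using Cons.IH by (simp add: x)
  then show ?case by (simp only: Z_swap append_Cons)
qed simp

text \<open>Each product contains exactly one entry of the sequence at \<open>u\<close>, and
  shifting is linear in the sequence.\<close>

lemma Z_linear:
  assumes "finite V" "u \<in> V" "\<And>i. h i = s * f i + t * g i"
  shows "Z es V (\<phi>(u := h)) = s * Z es V (\<phi>(u := f)) + t * Z es V (\<phi>(u := g))"
  using assms(3)
proof (induction es arbitrary: \<phi> f g h)
  case Nil
  have *: "(\<Prod>w\<in>V. (\<phi>(u := h)) w 0) = h 0 * (\<Prod>w\<in>V - {u}. \<phi> w 0)" for h
    using assms(1,2) by (subst prod.remove[of V u]) (auto intro!: prod.cong)
  show ?case using Nil unfolding Z.simps * by (simp add: algebra_simps)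
next
  case (Cons e es)
  obtain a b l where e: "e = (a, b, l)" by (cases e)
  have 1: "Z es V (\<phi>(u := h)) = s * Z es V (\<phi>(u := f)) + t * Z es V (\<phi>(u := g))"
    using Cons by blast
  have 2: "Z es V (shift a (shift b (\<phi>(u := h)))) = s * Z es V (shift a (shift b (\<phi>(u := f)))) + t * Z es V (shift a (shift b (\<phi>(u := g))))"
    unfolding shift_upd[of b] by (auto simp: shift_upd[of a] Cons.prems intro!: Cons.IH)
  show ?case unfolding e Z.simps 1 2 by (simp add: algebra_simps)
qed

lemma Z_insert:
  assumes "finite V" "w \<notin> V" "w \<notin> verts es"
  shows "Z es (insert w V) \<phi> = \<phi> w 0 * Z es V \<phi>"
  using assms(3)
proof (induction es arbitrary: \<phi>)
  case (Cons e es)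
  obtain a b l where e: "e = (a, b, l)" by (cases e)
  with Cons.prems have "w \<noteq> a" "w \<noteq> b" "w \<notin> verts es" by auto
  then show ?case using Cons.IH by (simp add: e shift_apply algebra_simps)
qed (use assms in simp)

text \<open>\<open>K\<close> stands for an upper bound on 1/p. Bounding the first quotient suffices,
  since the recurrence makes all later quotients at most 1; \<open>0 < f 1\<close> excludes the zero
  function and keeps denominators positive.\<close>

definition good :: "real \<Rightarrow> (nat \<Rightarrow> real) \<Rightarrow> bool" where
  "good K f \<longleftrightarrow> 0 \<le> f 0 \<and> 0 < f 1 \<and> f 0 \<le> K * f 1 \<and>
     (\<exists>c\<ge>117/100. \<forall>i. f (i + 2) = c * f (i + 1) + f i)"

definition coef :: "(nat \<Rightarrow> real) \<Rightarrow> real" where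
  "coef f = (f 2 - f 0) / f 1"

lemma good_coef:
  assumes "good K f"
  shows "coef f \<ge> 117/100" "f (Suc (Suc i)) = coef f * f (Suc i) + f i"
proof -
  obtain c where c: "c \<ge> 117/100" "\<And>i. f (i + 2) = c * f (i + 1) + f i" "f 1 > 0"
    using assms by (auto simp: good_def)
  have "coef f = c" using c(2)[of 0] c(3) by (simp add: coef_def numeral_2_eq_2)
  then show "coef f \<ge> 117/100" "f (Suc (Suc i)) = coef f * f (Suc i) + f i" using c by auto
qed

lemma good_pos: "good K f \<Longrightarrow> 0 < f (Suc i)"
proof -
  assume g: "good K f"
  have "0 < f (Suc i) \<and> 0 \<le> f i"
  proof (induction i)
    case 0
    then show ?case using g by (auto simp: good_def)
  next
    case (Suc i)
    have "0 < coef f * f (Suc i)" using good_coef(1)[OF g] Suc by simp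
    then show ?case using Suc by (simp add: good_coef(2)[OF g])
  qed
  then show ?thesis by simp
qed

lemma good_nonneg: "good K f \<Longrightarrow> 0 \<le> f i"
  using good_pos[of K f "i - 1"] by (cases i) (auto simp: good_def)

lemma good_tail:
  assumes g: "good K f" and K: "K \<ge> 1"
  shows "good K (\<lambda>i. f (Suc i))" "coef (\<lambda>i. f (Suc i)) = coef f"
proof -
  have f2: "f (Suc (Suc 0)) = coef f * f (Suc 0) + f 0" by (rule good_coef(2)[OF g])
  have "f (Suc 0) \<le> coef f * f (Suc 0)"
    using good_coef(1)[OF g] good_pos[OF g, of 0] by simp
  then have "f (Suc 0) \<le> f (Suc (Suc 0))" using f2 good_nonneg[OF g, of 0] by simp
  also have "\<dots> \<le> K * f (Suc (Suc 0))" using K good_pos[OF g, of 1] by simp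
  finally have "f (Suc 0) \<le> K * f (Suc (Suc 0))" .
  moreover have "\<exists>c\<ge>117/100. \<forall>i. f (Suc (i + 2)) = c * f (Suc (i + 1)) + f (Suc i)"
    using good_coef[OF g] by (intro exI[of _ "coef f"]) simp
  ultimately show "good K (\<lambda>i. f (Suc i))"
    using good_pos[OF g, of 0] good_pos[OF g, of 1] unfolding good_def by simp
  show "coef (\<lambda>i. f (Suc i)) = coef f"
    using good_coef(2)[OF g, of 1] good_pos[OF g, of 1]
    by (simp add: coef_def numeral_2_eq_2)
qed

definition good_state :: "real \<Rightarrow> state \<Rightarrow> bool" where
  "good_state K \<phi> \<longleftrightarrow> (\<forall>v. good K (\<phi> v))"

lemma good_state_shift: "K \<ge> 1 \<Longrightarrow> good_state K \<phi> \<Longrightarrow> good_state K (shift v \<phi>)"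
  by (auto simp: good_state_def shift_def good_tail)

definition weights_ok :: "edge list \<Rightarrow> bool" where
  "weights_ok es \<longleftrightarrow> (\<forall>(u, v, l) \<in> set es. u \<noteq> v \<and> 1 \<le> l)"

lemma weights_ok_Cons [simp]: "weights_ok ((u, v, l) # es) \<longleftrightarrow> u \<noteq> v \<and> 1 \<le> l \<and> weights_ok es"
  by (auto simp: weights_ok_def)

lemma Z_nonneg:
  assumes "K \<ge> 1" "weights_ok es" "good_state K \<phi>"
  shows "0 \<le> Z es V \<phi>"
  using assms
proof (induction es V \<phi> rule: Z.induct)
  case (1 V \<phi>)
  then have "0 \<le> \<phi> w 0" for w using good_nonneg[of K "\<phi> w" 0] by (simp add: good_state_def)
  then show ?case by (simp add: prod_nonneg)
next
  case (2 u v l es V \<phi>)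
  then show ?case by (auto intro!: add_nonneg_nonneg mult_nonneg_nonneg good_state_shift)
qed

lemma Z_pos:
  assumes "K \<ge> 1" "weights_ok es" "good_state K \<phi>" "\<And>w. w \<in> V \<Longrightarrow> 0 < \<phi> w 0 \<or> w \<in> verts es"
  shows "0 < Z es V \<phi>"
  using assms
proof (induction es V \<phi> rule: Z.induct)
  case (1 V \<phi>)
  then show ?case by (auto intro!: prod_pos)
next
  case (2 u v l es V \<phi>)
  have g: "good_state K (shift u (shift v \<phi>))" using 2 by (intro good_state_shift)
  have "0 < Z es V (shift u (shift v \<phi>))"
  proof (rule "2.IH"(2))
    fix w assume "w \<in> V"
    moreover have "0 < \<phi> w (Suc i)" for i using "2.prems"(3) by (auto simp: good_state_def intro: good_pos)
    ultimately show "0 < shift u (shift v \<phi>) w 0 \<or> w \<in> verts es"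
      using "2.prems"(4)[of w] by (auto simp: shift_apply)
  qed (use 2 g in auto)
  moreover have "0 \<le> Z es V \<phi>" using Z_nonneg[of K es \<phi> V] 2 by auto
  ultimately show ?case using "2.prems"(2) by (simp add: add_nonneg_pos)
qed

text \<open>Isolated vertices other than the root are left out, since the quotient would be 0/0 if one of
  them had the value 0.\<close>

definition ratio :: "edge list \<Rightarrow> state \<Rightarrow> nat \<Rightarrow> real" where
  "ratio es \<phi> v = Z es (insert v (verts es)) \<phi> / Z es (insert v (verts es)) (shift v \<phi>)"

lemma Z_shift_pos:
  assumes "K \<ge> 1" "weights_ok es" "good_state K \<phi>" "V \<subseteq> insert v (verts es)"
  shows "0 < Z es V (shift v \<phi>)"
proof (rule Z_pos[OF assms(1,2) good_state_shift[OF assms(1,3)]])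
  fix w assume "w \<in> V"
  then show "0 < shift v \<phi> w 0 \<or> w \<in> verts es"
    using assms by (auto simp: shift_apply good_state_def intro: good_pos)
qed

lemma Z_union:
  assumes "finite F" "finite W" "F \<inter> W = {}" "verts es \<subseteq> W"
  shows "Z es (F \<union> W) \<phi> = (\<Prod>w\<in>F. \<phi> w 0) * Z es W \<phi>"
  using assms(1,3)
proof (induction F rule: finite_induct)
  case (insert w F)
  have "Z es (insert w (F \<union> W)) \<phi> = \<phi> w 0 * Z es (F \<union> W) \<phi>"
    using insert assms by (intro Z_insert) auto
  then show ?case using insert by simp
qed simp

text \<open>A vertex outside \<open>insert v (verts es)\<close> contributes the same factor to both
  sides, so the ratio over the smallest vertex set serves every larger one. The product form
  survives when such a factor is 0.\<close>

lemma ratio_times: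
  assumes K: "K \<ge> 1" and ok: "weights_ok es" and g: "good_state K \<phi>"
    and V: "finite V" "insert v (verts es) \<subseteq> V"
  shows "Z es V \<phi> = ratio es \<phi> v * Z es V (shift v \<phi>)"
proof -
  let ?W = "insert v (verts es)"
  have "Z es ?W \<phi> = ratio es \<phi> v * Z es ?W (shift v \<phi>)"
    using Z_shift_pos[OF K ok g, of ?W v] by (simp add: ratio_def)
  moreover have "Z es V \<psi> = (\<Prod>w\<in>V - ?W. \<psi> w 0) * Z es ?W \<psi>" for \<psi>
  proof -
    have "V - ?W \<union> ?W = V" using V by auto
    then show ?thesis using Z_union[of "V - ?W" ?W es \<psi>] V by auto
  qed
  moreover have "(\<Prod>w\<in>V - ?W. shift v \<phi> w 0) = (\<Prod>w\<in>V - ?W. \<phi> w 0)"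
    by (intro prod.cong) (auto simp: shift_apply)
  ultimately show ?thesis by simp
qed

lemma ratio_base:
  assumes "K \<ge> 1" "weights_ok es" "good_state K \<phi>" "v \<notin> verts es"
  shows "ratio es \<phi> v = \<phi> v 0 / \<phi> v 1"
proof -
  have "Z es (insert v (verts es)) \<psi> = \<psi> v 0 * Z es (verts es) \<psi>" for \<psi>
    using assms(4) by (intro Z_insert) auto
  moreover have "Z es (verts es) \<phi> > 0" by (rule Z_pos[OF assms(1-3)]) auto
  moreover have "Z es W (\<psi>(v := f)) = Z es W \<psi>" if "v \<notin> verts es" "v \<notin> W" for \<psi> f W es
    using that by (induction es arbitrary: \<psi>) (auto simp: shift_upd intro!: prod.cong)
  ultimately show ?thesis using assms(4) by (simp add: ratio_def shift_def)
qed

fun find_edge :: "nat \<Rightarrow> edge list \<Rightarrow> ((nat \<times> real) \<times> edge list) option" where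
  "find_edge v [] = None"
| "find_edge v ((a, b, l) # es) =
     (if a = v then Some ((b, l), es) else if b = v then Some ((a, l), es)
      else map_option (\<lambda>(p, rest). (p, (a, b, l) # rest)) (find_edge v es))"

lemma find_edge_None: "find_edge v es = None \<longleftrightarrow> v \<notin> verts es"
  by (induction v es rule: find_edge.induct) auto

lemma find_edge_Some:
  assumes "find_edge v es = Some ((u, l), rest)"
  shows "Z es V \<phi> = Z ((v, u, l) # rest) V \<phi>" "verts es = insert u (insert v (verts rest))"
    "weights_ok es \<longleftrightarrow> weights_ok ((v, u, l) # rest)" "length es = Suc (length rest)"
proof -
  have "(\<forall>V \<phi>. Z es V \<phi> = Z ((v, u, l) # rest) V \<phi>) \<and> verts es = insert u (insert v (verts rest)) \<and>
    (weights_ok es \<longleftrightarrow> weights_ok ((v, u, l) # rest)) \<and> length es = Suc (length rest)"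
    using assms
  proof (induction v es arbitrary: rest rule: find_edge.induct)
    case (2 v a b k es)
    consider "a = v" | "a \<noteq> v" "b = v" | "a \<noteq> v" "b \<noteq> v" by blast
    then show ?case
    proof cases
      case 1
      then show ?thesis using 2 by auto
    next
      case 2
      then show ?thesis using "2.prems" by (auto simp: shift_commute)
    next
      case 3
      then obtain r where r: "find_edge v es = Some ((u, l), r)" "rest = (a, b, k) # r"
        using "2.prems" by auto
      note IH = "2.IH"[OF 3 r(1)]
      have "Z ((a, b, k) # es) V \<phi> = Z ((v, u, l) # rest) V \<phi>" for V \<phi>
      proof -
        have "Z ((a, b, k) # es) V \<phi> = Z ((a, b, k) # (v, u, l) # r) V \<phi>" using IH by simp
        also have "\<dots> = Z ((v, u, l) # (a, b, k) # r) V \<phi>" by (rule Z_swap)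
        finally show ?thesis by (simp only: r(2))
      qed
      then show ?thesis using IH r by auto
    qed
  qed simp
  then show "Z es V \<phi> = Z ((v, u, l) # rest) V \<phi>" "verts es = insert u (insert v (verts rest))"
    "weights_ok es \<longleftrightarrow> weights_ok ((v, u, l) # rest)" "length es = Suc (length rest)" by auto
qed

lemma shift_shift_Z:
  assumes "good K (\<phi> v)" "finite V" "v \<in> V"
  shows "Z es V (shift v (shift v \<phi>)) = coef (\<phi> v) * Z es V (shift v \<phi>) + Z es V \<phi>"
proof -
  have "Z es V (\<phi>(v := \<lambda>i. \<phi> v (Suc (Suc i)))) =
     coef (\<phi> v) * Z es V (\<phi>(v := \<lambda>i. \<phi> v (Suc i))) + 1 * Z es V (\<phi>(v := \<phi> v))"
    using assms good_coef(2)[OF assms(1)] by (intro Z_linear) auto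
  then show ?thesis by (simp add: shift_def)
qed

section \<open>The recursion for ratios\<close>

locale recursion_step =
  fixes K l :: real and es rest :: "edge list" and u v :: nat and \<phi> :: state
  assumes K: "K \<ge> 1" and ok: "weights_ok es" and gs: "good_state K \<phi>"
    and fe: "find_edge v es = Some ((u, l), rest)"
begin

definition "c = coef (\<phi> v)"
definition "a = ratio rest \<phi> v"
definition "b = ratio rest (shift u \<phi>) v"
definition "x = ratio rest (shift v (shift v \<phi>)) u / l"
definition "V = insert u (insert v (verts rest))"

lemma basics: "u \<noteq> v" "l \<ge> 1" "weights_ok rest" "c \<ge> 117/100" "good K (\<phi> v)" "good K (\<phi> u)"
  "good_state K (shift u \<phi>)" "good_state K (shift v \<phi>)" "good_state K (shift v (shift v \<phi>))" "good_state K (shift u (shift v \<phi>))"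
  "finite V" "v \<in> V" "u \<in> V"
  using find_edge_Some(3)[OF fe] ok gs good_state_shift[OF K] good_coef(1)[of K "\<phi> v"]
  by (auto simp: c_def good_state_def V_def)

text \<open>The two digits count the shifts at \<open>u\<close> and at \<open>v\<close>, in this
  order.\<close>

definition "Z00 = Z rest V \<phi>"
definition "Z01 = Z rest V (shift v \<phi>)"
definition "Z10 = Z rest V (shift u \<phi>)"
definition "Z11 = Z rest V (shift u (shift v \<phi>))"
definition "Z02 = Z rest V (shift v (shift v \<phi>))"
definition "Z12 = Z rest V (shift u (shift v (shift v \<phi>)))"

lemma Z02: "Z02 = c * Z01 + Z00"
  using shift_shift_Z[where \<phi> = \<phi>, OF basics(5,11,12)] by (simp add: Z02_def Z01_def Z00_def c_def)

lemma Z12: "Z12 = c * Z11 + Z10"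
proof -
  have g: "good K (shift u \<phi> v)" using basics by (simp add: good_state_def)
  have "c = coef (shift u \<phi> v)" using basics(1) by (simp add: c_def shift_def)
  then show ?thesis using shift_shift_Z[where \<phi> = "shift u \<phi>", OF g basics(11,12)]
    by (simp add: Z12_def Z11_def Z10_def shift_commute[of u])
qed

lemma Z11_pos: "0 < Z11"
  unfolding Z11_def
  by (rule Z_pos[OF K basics(3)])
     (use basics gs in \<open>auto simp: V_def shift_apply good_state_def intro: good_pos\<close>)

lemma Z_nn: "0 \<le> Z00" "0 \<le> Z01" "0 \<le> Z10"
  unfolding Z00_def Z01_def Z10_def using Z_nonneg[OF K basics(3)] basics gs by auto

lemma Z00: "Z00 = a * Z01"
  unfolding Z00_def Z01_def a_def by (rule ratio_times[OF K basics(3) gs]) (auto simp: V_def)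

lemma Z10: "Z10 = b * Z11"
  unfolding Z10_def Z11_def b_def shift_commute[of u v]
  by (rule ratio_times[OF K basics(3,7)]) (auto simp: V_def)

lemma Z02_x: "Z02 = x * (l * Z12)"
proof -
  have "Z02 = ratio rest (shift v (shift v \<phi>)) u * Z12"
    unfolding Z02_def Z12_def
    by (rule ratio_times[OF K basics(3,9)]) (auto simp: V_def)
  then show ?thesis using basics(2) by (simp add: x_def)
qed

lemma ratio_rec: "ratio es \<phi> v = (Z00 + l * Z11) / (Z01 + l * Z12)"
proof -
  have V: "insert v (verts es) = V" using find_edge_Some(2)[OF fe] by (auto simp: V_def)
  show ?thesis unfolding ratio_def V find_edge_Some(1)[OF fe]
    by (simp add: Z00_def Z01_def Z11_def Z12_def shift_commute[of u v])
qed

end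

text \<open>By \<open>ratio_rec\<close> the ratio is a mediant of two parts bounded separately:
  \<open>Z00 \<le> K * Z01\<close> by induction, and \<open>Z11 \<le> Z12 \<le> K * Z12\<close> by
  the recurrence with c >= 1.\<close>

lemma ratio_range:
  assumes K: "K \<ge> 1"
  shows "weights_ok es \<Longrightarrow> good_state K \<phi> \<Longrightarrow> 0 \<le> ratio es \<phi> v \<and> ratio es \<phi> v \<le> K"
proof (induction "length es" arbitrary: es \<phi> v rule: less_induct)
  case less
  show ?case
  proof (cases "find_edge v es")
    case None
    then have "ratio es \<phi> v = \<phi> v 0 / \<phi> v 1" using ratio_base[OF K less.prems] by (simp add: find_edge_None)
    then show ?thesis using less.prems(2) by (auto simp: good_state_def good_def field_simps)
  next
    case (Some p)
    obtain u l rest where p: "p = ((u, l), rest)" by (cases p) auto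
    interpret recursion_step K l es rest u v \<phi>
      using Some p less.prems K by unfold_locales auto
    have len: "length rest < length es" using find_edge_Some(4)[OF fe] by simp
    note IH = less.hyps[OF len basics(3)]
    have a: "0 \<le> a" "a \<le> K" "0 \<le> b" "0 \<le> x"
      using IH[OF gs, of v] IH[OF basics(7), of v] IH[OF basics(9), of u] basics(2)
      by (auto simp: a_def b_def x_def)
    have den: "0 < Z01 + l * Z12"
    proof -
      have "0 < c * Z11" using Z11_pos basics(4) by simp
      then have "0 < Z12" using Z_nn by (simp add: Z12)
      then have "0 < l * Z12" using basics(2) by simp
      then show ?thesis using Z_nn by simp
    qed
    have "Z00 + l * Z11 \<le> K * (Z01 + l * Z12)"
    proof -
      have "Z00 \<le> K * Z01" unfolding Z00 using a Z_nn by (intro mult_right_mono) auto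
      moreover have "Z11 \<le> K * Z12"
      proof -
        have "Z11 \<le> c * Z11" using basics(4) Z11_pos by simp
        also have "\<dots> \<le> Z12" using Z_nn by (simp add: Z12)
        also have "\<dots> \<le> K * Z12" using K calculation Z11_pos by simp
        finally show ?thesis .
      qed
      then have "l * Z11 \<le> l * (K * Z12)" using basics(2) by (intro mult_left_mono) auto
      ultimately show ?thesis by (simp add: algebra_simps)
    qed
    moreover have "0 \<le> Z00 + l * Z11" using Z_nn Z11_pos basics(2) by simp
    ultimately show ?thesis unfolding ratio_rec using den by (simp add: field_simps)
  qed
qed

context recursion_step
begin

lemma ranges: "0 \<le> a" "a \<le> K" "0 \<le> b" "b \<le> K" "0 \<le> x" "x \<le> K"
proof -
  note r = ratio_range[OF K basics(3)]
  show "0 \<le> a" "a \<le> K" "0 \<le> b" "b \<le> K" "0 \<le> x"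
    using r[OF gs, of v] r[OF basics(7), of v] r[OF basics(9), of u] basics(2)
    by (auto simp: a_def b_def x_def)
  have "ratio rest (shift v (shift v \<phi>)) u / l \<le> ratio rest (shift v (shift v \<phi>)) u / 1"
    using r[OF basics(9), of u] basics(2) by (intro divide_left_mono) auto
  then show "x \<le> K" using r[OF basics(9), of u] by (simp add: x_def)
qed

text \<open>The recurrence at \<open>v\<close> gives Z02 = (c + a) Z01 and Z12 = (c + b) Z11. With
  Z02 = x l Z12, all four terms of \<open>ratio_rec\<close> become multiples of l Z12 with
  coefficients in \<open>a\<close>, \<open>b\<close>, \<open>c\<close>, \<open>x\<close>.\<close>

lemma ratio_eq_step: "ratio es \<phi> v = step c a b x"
proof -
  have pos: "c + a > 0" "c + b > 0" "c + a + x > 0" using ranges basics(4) by auto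
  have Z12': "Z12 = (c + b) * Z11" by (simp add: Z12 Z10 algebra_simps)
  have Z01: "Z01 = x * (l * Z12) / (c + a)"
    using Z02_x pos by (simp add: Z02 Z00 field_simps)
  have lZ: "l * Z12 > 0" using basics(2) Z11_pos pos by (simp add: Z12')
  define W where "W = l * Z12"
  have W: "W > 0" using lZ by (simp add: W_def)
  have lZ11: "l * Z11 = W / (c + b)" using pos by (simp add: W_def Z12')
  have Z01W: "Z01 = x * W / (c + a)" by (simp add: Z01 W_def)
  have "Z00 + l * Z11 = W * ((a * x + (c + a) / (c + b)) / (c + a))"
  proof -
    have "(c + a) / (c + b) / (c + a) = 1 / (c + b)" using pos by simp
    then show ?thesis
      unfolding lZ11 Z00 Z01W by (simp only: add_divide_distrib distrib_left) (simp add: mult_ac)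
  qed
  moreover have "Z01 + l * Z12 = W * ((c + a + x) / (c + a))"
    unfolding W_def[symmetric] Z01W using pos by (simp add: field_simps)
  ultimately have "ratio es \<phi> v = ((a * x + (c + a) / (c + b)) / (c + a)) / ((c + a + x) / (c + a))"
    unfolding ratio_rec using W by simp
  then show ?thesis using pos by (simp add: step_def mult.commute)
qed

end

text \<open>The hypothesis says that \<open>F\<close>, read in the coordinate \<open>psi\<close>,
  has derivative at most 1 in absolute value. The mean value theorem along the geodesic does the
  rest.\<close>

lemma psi_nonexpansive:
  assumes F: "\<And>z. 0 \<le> z \<Longrightarrow> 0 \<le> F z \<and> (\<exists>d. DERIV F z :> d \<and> \<bar>d\<bar> * gw z \<le> gw (F z))"
    and z: "0 \<le> z" "0 \<le> z'"
  shows "\<bar>psi (F z) - psi (F z')\<bar> \<le> \<bar>psi z - psi z'\<bar>"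
proof -
  obtain d where d: "\<And>z. 0 \<le> z \<Longrightarrow> 0 \<le> F z" "\<And>z. 0 \<le> z \<Longrightarrow> DERIV F z :> d z"
    "\<And>z. 0 \<le> z \<Longrightarrow> \<bar>d z\<bar> * gw z \<le> gw (F z)"
    using F by metis
  define p where "p = path z z'"
  have p0: "0 \<le> p t" if "0 \<le> t" "t \<le> 1" for t
    using path_range[OF that z(1) _ z(2), of "max z z'"] by (simp add: p_def)
  have D: "DERIV (\<lambda>t. psi (F (p t))) t :> 1 / gw (F (p t)) * (d (p t) * ((psi z' - psi z) * gw (p t)))"
    if "0 \<le> t" "t \<le> 1" for t
  proof -
    have "DERIV p t :> (psi z' - psi z) * gw (p t)" by (simp add: p_def path_DERIV)
    then have "DERIV (\<lambda>t. F (p t)) t :> d (p t) * ((psi z' - psi z) * gw (p t))"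
      by (rule DERIV_chain2[where f = F and g = p, OF d(2)[OF p0[OF that]]])
    then show ?thesis
      by (rule DERIV_chain2[where f = psi and g = "\<lambda>t. F (p t)", OF psi_DERIV[OF d(1)[OF p0[OF that]]]])
  qed
  obtain t where t: "0 < t" "t < 1" "psi (F (p 1)) - psi (F (p 0)) =
      (1 - 0) * (1 / gw (F (p t)) * (d (p t) * ((psi z' - psi z) * gw (p t))))"
    using MVT2[of 0 1, OF _ D] by auto
  have pt: "0 \<le> p t" using p0[of t] t by simp
  have g: "gw (F (p t)) > 0" "gw (p t) > 0"
    using gw_bounds(3)[OF d(1)[OF pt]] gw_bounds(3)[OF pt] by linarith+
  have "\<bar>d (p t)\<bar> * gw (p t) / gw (F (p t)) \<le> 1"
    using d(3)[OF pt] g(1) by simp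
  then have "\<bar>d (p t)\<bar> * gw (p t) / gw (F (p t)) * \<bar>psi z' - psi z\<bar> \<le> 1 * \<bar>psi z' - psi z\<bar>"
    by (rule mult_right_mono) simp
  then have "\<bar>psi (F (p 1)) - psi (F (p 0))\<bar> \<le> \<bar>psi z' - psi z\<bar>"
    unfolding t(3) using g by (simp add: abs_mult mult_ac)
  then show ?thesis using z by (simp add: p_def path_ends abs_minus_commute)
qed

lemma psi_divide_nonexpansive:
  assumes "l \<ge> 1" "0 \<le> z" "0 \<le> z'"
  shows "\<bar>psi (z / l) - psi (z' / l)\<bar> \<le> \<bar>psi z - psi z'\<bar>"
proof (rule psi_nonexpansive[OF _ assms(2,3)])
  fix z :: real assume z: "0 \<le> z"
  have "gw z / l \<le> 1 + 2 * (z / l)" "gw z / l \<le> 5"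
    using gw_bounds[of z] assms(1) z by (auto simp: field_simps intro: order_trans)
  then have "\<bar>1 / l\<bar> * gw z \<le> gw (z / l)" using assms(1) by (simp add: gw_def)
  moreover have "DERIV (\<lambda>z. z / l) z :> 1 / l" using assms(1) by (auto intro!: derivative_eq_intros)
  ultimately show "0 \<le> z / l \<and> (\<exists>d. DERIV (\<lambda>z. z / l) z :> d \<and> \<bar>d\<bar> * gw z \<le> gw (z / l))"
    using z assms(1) by auto
qed

text \<open>How the ratio at a vertex depends on the local ratio \<open>z\<close> there; \<open>A\<close> and \<open>B\<close> are the partition functions
  with the local sequences starting with 1, 0 and 0, 1.\<close>

lemma psi_moebius_nonexpansive:
  assumes AB: "0 \<le> A" "0 \<le> B" "0 < A + B" and c: "c \<ge> 117/100" and z: "0 \<le> z" "0 \<le> z'"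
  shows "\<bar>psi ((z * A + B) / (A + (c + z) * B)) - psi ((z' * A + B) / (A + (c + z') * B))\<bar> \<le> \<bar>psi z - psi z'\<bar>"
proof (rule psi_nonexpansive[OF _ z])
  fix z :: real assume z: "0 \<le> z"
  define D where "D = A + (c + z) * B"
  define r where "r = (z * A + B) / D"
  define m where "m = 1 / (c + z)"
  have m: "m > 0" "m * (c + z) = 1" using c z by (auto simp: m_def)
  have D: "D > 0"
  proof -
    have "1 * B \<le> (c + z) * B" using c z AB by (intro mult_right_mono) auto
    then show ?thesis using AB by (simp add: D_def)
  qed
  have r0: "r \<ge> 0" using AB z D by (simp add: r_def)
  have "gw z \<le> (c + z)\<^sup>2"
  proof -
    have "117/100 * (117/100) \<le> c * c" using c by (intro mult_mono) auto
    moreover have "1 * z \<le> c * z" using c z by (intro mult_right_mono) auto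
    ultimately show ?thesis using gw_bounds(1)[of z] zero_le_square[of z] unfolding power2_eq_square
      by (simp only: algebra_simps; linarith)
  qed
  then have "gw z * (m * m) \<le> (c + z)\<^sup>2 * (m * m)" using m by (intro mult_right_mono) auto
  also have "(c + z)\<^sup>2 * (m * m) = (m * (c + z)) * (m * (c + z))" by (simp add: power2_eq_square)
  also have "\<dots> = 1" by (simp add: m)
  also have "1 \<le> gw m" using m by (intro gw_bounds) auto
  finally have "gw z * (m * m) * (c + z) \<le> gw m * (c + z)" using c z by (intro mult_right_mono) auto
  \<comment> \<open>This is the case \<open>A = 0\<close>, the map z -> 1/(c + z), whose derivative
    is -m^2.\<close>
  then have gm: "gw z * m \<le> gw m * (c + z)" by (simp add: m mult.assoc)
  \<comment> \<open>Concavity of \<open>gw\<close>: \<open>r\<close> is the mean of \<open>z\<close>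
    and \<open>m\<close> with weights \<open>A\<close> and \<open>(c + z) * B\<close>, whose sum is
    \<open>D\<close>.\<close>
  have conc: "A * gw z + (c + z) * B * gw m \<le> gw r * D"
  proof -
    have "A * gw z + (c + z) * B * gw m \<le> A * (1 + 2 * z) + (c + z) * B * (1 + 2 * m)"
      "A * gw z + (c + z) * B * gw m \<le> A * 5 + (c + z) * B * 5"
      using AB c z by (auto intro!: add_mono mult_left_mono gw_bounds)
    moreover have "A * (1 + 2 * z) + (c + z) * B * (1 + 2 * m) = (1 + 2 * r) * D"
    proof -
      have "(c + z) * B * m = B" using m by (simp add: mult_ac)
      moreover have "r * D = z * A + B" using D by (simp add: r_def)
      ultimately show ?thesis by (simp add: algebra_simps D_def)
    qed
    moreover have "A * 5 + (c + z) * B * 5 = 5 * D" by (simp add: D_def algebra_simps)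
    ultimately show ?thesis by (cases "1 + 2 * r \<le> 5") (auto simp: gw_def min_def)
  qed
  have "gw z * (A + m * B) \<le> gw r * D"
    using conc mult_left_mono[OF gm AB(2)] by (simp add: algebra_simps)
  then have main: "gw z * ((A + m * B) * D) \<le> gw r * (D * D)"
    using D by (simp add: mult.assoc[symmetric] mult_right_mono)
  have "\<bar>A * A + c * A * B - B * B\<bar> \<le> (A + m * B) * D"
  proof -
    have "(A + m * B) * D = A * A + (c + z) * (A * B) + m * (A * B) + (m * (c + z)) * (B * B)"
      by (simp add: D_def algebra_simps)
    then have eq: "(A + m * B) * D = A * A + (c * (A * B) + z * (A * B)) + m * (A * B) + B * B"
      by (simp only: m distrib_right mult_1_left)
    have "0 \<le> A * A" "0 \<le> B * B" "0 \<le> c * (A * B)" "0 \<le> z * (A * B)" "0 \<le> m * (A * B)"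
      using AB z c m by auto
    then show ?thesis unfolding eq abs_le_iff mult.assoc by (intro conjI) linarith+
  qed
  then have "gw z * \<bar>A * A + c * A * B - B * B\<bar> \<le> gw z * ((A + m * B) * D)"
    using gw_bounds(3)[OF z] by (intro mult_left_mono) auto
  with main have "gw z * \<bar>A * A + c * A * B - B * B\<bar> \<le> gw r * (D * D)" by linarith
  then have 1: "\<bar>(A * A + c * A * B - B * B) / (D * D)\<bar> * gw z \<le> gw r"
    using D by (simp add: abs_divide pos_divide_le_eq mult.commute)
  have "DERIV (\<lambda>z. (z * A + B) / (A + (c + z) * B)) z :> (A * D - (z * A + B) * B) / (D * D)"
    using D unfolding D_def by (auto intro!: derivative_eq_intros)
  moreover have "A * D - (z * A + B) * B = A * A + c * A * B - B * B"
    by (simp add: D_def algebra_simps)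
  ultimately have 2: "DERIV (\<lambda>z. (z * A + B) / (A + (c + z) * B)) z :> (A * A + c * A * B - B * B) / (D * D)"
    by simp
  show "0 \<le> (z * A + B) / (A + (c + z) * B) \<and> (\<exists>d. DERIV (\<lambda>z. (z * A + B) / (A + (c + z) * B)) z :> d
      \<and> \<bar>d\<bar> * gw z \<le> gw ((z * A + B) / (A + (c + z) * B)))"
    using 1 2 r0 unfolding r_def D_def by blast
qed

section \<open>Dependence of a ratio on one local function\<close>

fun fibs :: "real \<Rightarrow> real \<Rightarrow> real \<Rightarrow> nat \<Rightarrow> real" where
  "fibs c s t 0 = s"
| "fibs c s t (Suc 0) = t"
| "fibs c s t (Suc (Suc i)) = c * fibs c s t (Suc i) + fibs c s t i"

lemma good_fibs: "good K f \<Longrightarrow> f i = f 0 * fibs (coef f) 1 0 i + f 1 * fibs (coef f) 0 1 i"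
proof (induction "coef f" "1::real" "0::real" i rule: fibs.induct)
  case (3 i)
  then show ?case by (simp add: good_coef(2)[OF 3(3)] algebra_simps)
qed auto

lemma fibs_nonneg: "c \<ge> 0 \<Longrightarrow> s \<ge> 0 \<Longrightarrow> t \<ge> 0 \<Longrightarrow> 0 \<le> fibs c s t i"
  by (induction c s t i rule: fibs.induct) auto

lemma fibs_good: "c \<ge> 117/100 \<Longrightarrow> 0 \<le> s \<Longrightarrow> s \<le> K \<Longrightarrow> good K (fibs c s 1)"
  by (auto simp: good_def intro!: exI[of _ c])

lemma coef_fibs: "coef (fibs c s 1) = c"
  by (simp add: coef_def numeral_2_eq_2)

lemma Z_decompose:
  assumes "good K f" "finite V" "u \<in> V"
  shows "Z es V (\<phi>(u := f)) = f 0 * Z es V (\<phi>(u := fibs (coef f) 1 0)) + f 1 * Z es V (\<phi>(u := fibs (coef f) 0 1))"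
  by (rule Z_linear[OF assms(2,3) good_fibs[OF assms(1)]])

text \<open>For the basis sequence starting with 1, 0, which is not \<open>good\<close> because its
  second entry vanishes.\<close>

lemma Z_fibs_nonneg:
  assumes "weights_ok es" "\<And>w i. 0 \<le> \<phi> w i"
  shows "0 \<le> Z es V \<phi>"
  using assms
proof (induction es V \<phi> rule: Z.induct)
  case (1 V \<phi>)
  then show ?case by (simp add: prod_nonneg)
next
  case (2 u v l es V \<phi>)
  have "0 \<le> Z es V (shift u (shift v \<phi>))"
    using "2.prems" by (intro "2.IH"(2)) (auto simp: shift_apply)
  moreover have "0 \<le> Z es V \<phi>" using "2.prems" by (intro "2.IH"(1)) auto
  ultimately show ?case using "2.prems"(1) by simp
qed

text \<open>By linearity the ratio at \<open>v\<close> is the Moebius map of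
  \<open>psi_moebius_nonexpansive\<close> applied to the local ratio, and its coefficients
  \<open>A\<close>, \<open>B\<close> are the same for \<open>f\<close> and \<open>g\<close> because
  the parameters agree.\<close>

lemma own_influence:
  assumes K: "K \<ge> 1" and ok: "weights_ok es" and gs: "good_state K \<phi>"
    and f: "good K f" and g: "good K g" and c: "coef f = coef g"
  shows "\<bar>psi (ratio es (\<phi>(v := f)) v) - psi (ratio es (\<phi>(v := g)) v)\<bar> \<le> \<bar>psi (f 0 / f 1) - psi (g 0 / g 1)\<bar>"
proof -
  define V where "V = insert v (verts es)"
  define A B where "A = Z es V (\<phi>(v := fibs (coef f) 1 0))" and "B = Z es V (\<phi>(v := fibs (coef f) 0 1))"
  have c1: "coef f \<ge> 117/100" by (rule good_coef(1)[OF f])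
  have nn: "0 \<le> \<phi> w i" for w i using gs by (auto simp: good_state_def intro: good_nonneg)
  have AB: "0 \<le> A" "0 \<le> B" unfolding A_def B_def using c1 nn
    by (auto intro!: Z_fibs_nonneg[OF ok] fibs_nonneg)
  have R: "0 < A + B \<and> ratio es (\<phi>(v := h)) v = (h 0 / h 1 * A + B) / (A + (coef f + h 0 / h 1) * B)"
    if h: "good K h" "coef h = coef f" for h
  proof -
    have h1: "h 1 > 0" using h by (simp add: good_def)
    have gh: "good_state K (\<phi>(v := h))" using gs h by (simp add: good_state_def)
    have t: "good K (\<lambda>i. h (Suc i))" "coef (\<lambda>i. h (Suc i)) = coef f" using good_tail[OF h(1) K] h by auto
    have 1: "Z es V (\<phi>(v := h)) = h 0 * A + h 1 * B"
      unfolding A_def B_def h(2)[symmetric] by (rule Z_decompose[OF h(1)]) (auto simp: V_def)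
    have sh: "shift v (\<phi>(v := h)) = \<phi>(v := \<lambda>i. h (Suc i))" by (simp add: shift_upd)
    have "Z es V (\<phi>(v := \<lambda>i. h (Suc i))) = h (Suc 0) * A + h (Suc 1) * B"
      unfolding A_def B_def t(2)[symmetric] by (rule Z_decompose[OF t(1)]) (auto simp: V_def)
    also have "h (Suc 1) = coef f * h 1 + h 0" using good_coef(2)[OF h(1), of 0] h by simp
    finally have 2: "Z es V (shift v (\<phi>(v := h))) = h 1 * A + (coef f * h 1 + h 0) * B" by (simp only: sh One_nat_def)
    have pos: "0 < Z es V (shift v (\<phi>(v := h)))"
      by (rule Z_shift_pos[OF K ok gh]) (simp add: V_def)
    have "A + B \<noteq> 0"
    proof
      assume "A + B = 0"
      then have "A = 0" "B = 0" using AB by auto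
      then show False using pos 2 by simp
    qed
    moreover have "ratio es (\<phi>(v := h)) v = (h 0 / h 1 * A + B) / (A + (coef f + h 0 / h 1) * B)"
    proof -
      have "h 0 * A + h 1 * B = h 1 * (h 0 / h 1 * A + B)"
        "h 1 * A + (coef f * h 1 + h 0) * B = h 1 * (A + (coef f + h 0 / h 1) * B)"
        using h1 by (auto simp: field_simps)
      then show ?thesis unfolding ratio_def V_def[symmetric] 1 2 using h1 by simp
    qed
    ultimately show ?thesis using AB by simp
  qed
  have z: "0 \<le> f 0 / f 1" "0 \<le> g 0 / g 1" using f g by (auto simp: good_def)
  show ?thesis
    using R[OF f refl] R[OF g c[symmetric]] psi_moebius_nonexpansive[OF AB _ c1 z] by simp
qed

text \<open>Turns the Lipschitz form of the influence bound into a bound on a derivative.\<close>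

lemma DERIV_abs_le_one:
  fixes h :: "real \<Rightarrow> real"
  assumes D: "DERIV h z :> d" and lip: "\<And>t. 0 < t \<Longrightarrow> t < k \<Longrightarrow> \<bar>h t - h z\<bar> \<le> \<bar>t - z\<bar>" and z: "0 < z" "z < k"
  shows "\<bar>d\<bar> \<le> 1"
proof -
  have "((\<lambda>t. \<bar>(h t - h z) / (t - z)\<bar>) \<longlongrightarrow> \<bar>d\<bar>) (at z)"
    using D unfolding has_field_derivative_iff by (rule tendsto_rabs)
  moreover have "eventually (\<lambda>t. t \<in> {0<..<k}) (at z)"
    using z by (intro eventually_at_in_open') auto
  then have "eventually (\<lambda>t. \<bar>(h t - h z) / (t - z)\<bar> \<le> 1) (at z)"
  proof (rule eventually_mono)
    fix t assume t: "t \<in> {0<..<k}"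
    show "\<bar>(h t - h z) / (t - z)\<bar> \<le> 1"
      using lip[of t] t by (cases "t = z") (simp_all add: abs_divide)
  qed
  ultimately show ?thesis by (rule tendsto_upperbound) simp
qed

text \<open>With \<open>\<Delta>\<close> measuring the influence of one end of the edge on the ratio at the other end, the true
  ratio is the left-hand side of the conclusion.\<close>

lemma cap_valid:
  fixes b c x xt \<Delta> K :: real
  assumes c: "c \<ge> 117/100" and K: "K \<ge> 1" and b: "0 \<le> b" "b \<le> K" and x: "0 \<le> x" "x \<le> K" and xt: "0 \<le> xt"
    and \<Delta>: "\<bar>\<Delta>\<bar> \<le> gw b" and eq: "x = xt + \<Delta> / (c + b)"
  shows "(1 + xt * b + \<Delta>) / (c + b + xt) \<le> cap K b x"
proof -
  define \<eta> where "\<eta> = K / (K + 1)"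
  define D where "D = c + b + xt"
  have D: "D > 0" using c b xt by (simp add: D_def)
  have \<eta>: "0 \<le> \<eta>" "\<eta> \<le> 1" using K by (auto simp: \<eta>_def)
  have \<eta>1: "1 - \<eta> = 1 / (K + 1)" using K by (simp add: \<eta>_def field_simps)
  have \<Delta>1: "\<Delta> \<le> 1 + 2 * b" "\<Delta> \<le> 5" "-\<Delta> \<le> 5" using \<Delta> gw_bounds[of b] by linarith+
  have goal: "1 + xt * b + \<Delta> \<le> cap K b x * D"
  proof (cases "b \<le> 2")
    case True
    have "xt * b \<le> xt * 2" using True xt by (intro mult_left_mono) auto
    then have "1 + xt * b + \<Delta> \<le> 2 * D" using \<Delta>1 c by (simp add: D_def)
    then show ?thesis using True by (simp add: cap_def)
  next
    case b2: False
    have q: "(b - 2) / (c + b) \<le> 1" "0 \<le> (b - 2) / (c + b)" using b2 c by auto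
    have xt_eq: "xt = x - \<Delta> / (c + b)" using eq by simp
    \<comment> \<open>Replacing \<open>xt\<close> by \<open>x\<close> returns the fraction (b -
      2)/(c + b) of \<open>\<Delta>\<close> with the opposite sign. The fraction lies in [0, 1], so
      the total contribution of \<open>\<Delta>\<close> stays at most 5.\<close>
    have up: "(b - 2) * xt + \<Delta> \<le> (b - 2) * x + 5"
    proof -
      have "(b - 2) * xt = (b - 2) * x - (b - 2) / (c + b) * \<Delta>"
        unfolding xt_eq by (simp add: right_diff_distrib)
      moreover have "\<Delta> - (b - 2) / (c + b) * \<Delta> \<le> 5"
      proof (cases "\<Delta> \<ge> 0")
        case True
        then have "0 \<le> (b - 2) / (c + b) * \<Delta>" using q(2) by (rule mult_nonneg_nonneg[rotated])
        then show ?thesis using \<Delta>1 by linarith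
      next
        case False
        then have "\<Delta> * 1 \<le> \<Delta> * ((b - 2) / (c + b))" using q by (intro mult_left_mono_neg) auto
        then show ?thesis by (simp add: mult.commute)
      qed
      ultimately show ?thesis by linarith
    qed
    have num: "1 + xt * b + \<Delta> - 2 * D \<le> (b - 2) * (x - 2)"
      using up c b2 by (simp add: D_def algebra_simps)
    show ?thesis
    proof (cases "x \<le> 2")
      case True
      have "(b - 2) * (x - 2) \<le> 0" using True b2 by (intro mult_nonneg_nonpos) auto
      then have "1 + xt * b + \<Delta> \<le> 2 * D" using num by linarith
      then show ?thesis using True by (simp add: cap_def)
    next
      case x2: False
      \<comment> \<open>The cap in terms of \<open>x\<close>: here b <= K is used, in the form b - 2
        <= \<eta> b.\<close>
      have "1 + xt * b + \<Delta> \<le> (2 + \<eta> * (x - 2)) * D"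
      proof -
        have "b * (1 - \<eta>) \<le> 1" unfolding \<eta>1 using b K by simp
        then have "b - 2 \<le> \<eta> * b" by (simp add: algebra_simps)
        also have "\<dots> \<le> \<eta> * D" using \<eta> c xt by (intro mult_left_mono) (auto simp: D_def)
        finally have "(b - 2) * (x - 2) \<le> \<eta> * D * (x - 2)" using x2 by (intro mult_right_mono) auto
        then show ?thesis using num by (simp add: algebra_simps)
      qed
      \<comment> \<open>The cap in terms of \<open>b\<close>: it needs
        \<open>xt \<le> \<eta> * D\<close>, which is equivalent to
        \<open>xt \<le> K * (c + b)\<close>.\<close>
      moreover have "1 + xt * b + \<Delta> \<le> (2 + \<eta> * (b - 2)) * D"
      proof -
        have "- \<Delta> / (c + b) \<le> 5 / (c + b)" using \<Delta>1 c b by (intro divide_right_mono) auto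
        also have "\<dots> \<le> 5 / 3" using c b2 by (intro divide_left_mono) auto
        finally have "xt \<le> x + 5 / 3" using xt_eq by simp
        also have "\<dots> \<le> K * 1 + K * 2" using x K by linarith
        also have "\<dots> \<le> K * (c + b)" using K c b2 mult_left_mono[of 3 "c + b" K] by simp
        finally have "xt \<le> K * (c + b)" .
        then have "xt * (K + 1) \<le> K * D" by (simp add: D_def algebra_simps)
        then have "xt \<le> \<eta> * D" using K by (simp add: \<eta>_def field_simps)
        then have "(b - 2) * xt \<le> (b - 2) * (\<eta> * D)" using b2 by (intro mult_left_mono) auto
        then show ?thesis using \<Delta>1 c b2 by (simp add: D_def algebra_simps)
      qed
      ultimately show ?thesis using x2 b2
        by (auto simp: cap_def \<eta>_def[symmetric] min_def)
    qed
  qed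
  then have "(1 + xt * b + \<Delta>) / D \<le> cap K b x" using D by (simp only: divide_le_eq if_True)
  then show ?thesis by (simp only: D_def)
qed

context recursion_step
begin

text \<open>The influence of the function at \<open>u\<close> on the ratio at \<open>v\<close>,
  assumed for the smaller instance, is differentiated at the local ratio after one shift. This
  bounds the \<open>\<Delta>\<close> of \<open>cap_valid\<close> by \<open>gw b\<close>, and then
  the cap does not change the value.\<close>

lemma ratio_eq_capped_step:
  assumes lip: "\<And>f g. good K f \<Longrightarrow> good K g \<Longrightarrow> coef f = coef g \<Longrightarrow>
     \<bar>psi (ratio rest (\<phi>(u := f)) v) - psi (ratio rest (\<phi>(u := g)) v)\<bar> \<le> \<bar>psi (f 0 / f 1) - psi (g 0 / g 1)\<bar>"
  shows "ratio es \<phi> v = capped_step K c a b x"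
proof -
  define f where "f = \<phi> u"
  define c' where "c' = coef f"
  have f: "good K f" using basics by (simp add: f_def)
  have c': "c' \<ge> 117/100" unfolding c'_def by (rule good_coef(1)[OF f])
  have f2: "f 2 = c' * f 1 + f 0" using good_coef(2)[OF f, of 0] by (simp add: c'_def numeral_2_eq_2)
  have fpos: "0 \<le> f 0" "0 < f 1" using f by (auto simp: good_def)
  have "f 1 \<le> c' * f 1" using c' fpos by simp
  then have f12: "f 1 \<le> f 2" "f 0 \<le> f 2" "0 < f 2" using f2 fpos by linarith+
  define P Q S T where "P = Z rest V (\<phi>(u := fibs c' 1 0))" and "Q = Z rest V (\<phi>(u := fibs c' 0 1))"
    and "S = Z rest V ((shift v \<phi>)(u := fibs c' 1 0))" and "T = Z rest V ((shift v \<phi>)(u := fibs c' 0 1))"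
  have uv: "shift v (\<phi>(u := h)) = (shift v \<phi>)(u := h)" for h using basics(1) by (simp add: shift_upd)
  have dec: "Z rest V (\<phi>(u := h)) = h 0 * P + h 1 * Q" "Z rest V (shift v (\<phi>(u := h))) = h 0 * S + h 1 * T"
    if h: "good K h" "coef h = c'" for h
    unfolding P_def Q_def S_def T_def uv h(2)[symmetric]
    by (rule Z_decompose[OF h(1) basics(11,13)])+
  have tail: "good K (\<lambda>i. f (Suc i))" "coef (\<lambda>i. f (Suc i)) = c'" using good_tail[OF f K] by (auto simp: c'_def)
  have su: "shift u \<phi> = \<phi>(u := \<lambda>i. f (Suc i))" by (simp add: shift_def f_def)
  have pu: "\<phi> = \<phi>(u := f)" by (simp add: f_def)
  have f2': "f (Suc (Suc 0)) = f 2" by (simp add: numeral_2_eq_2)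
  have z: "Z00 = f 0 * P + f 1 * Q" "Z01 = f 0 * S + f 1 * T" "Z10 = f 1 * P + f 2 * Q" "Z11 = f 1 * S + f 2 * T"
  proof -
    show "Z00 = f 0 * P + f 1 * Q" "Z01 = f 0 * S + f 1 * T"
      using dec[OF f c'_def[symmetric]] pu by (simp_all add: Z00_def Z01_def)
    show "Z10 = f 1 * P + f 2 * Q" "Z11 = f 1 * S + f 2 * T"
      using dec[OF tail] by (simp_all add: Z10_def Z11_def shift_commute[of u v] su f2')
  qed
  define z2 where "z2 = f 1 / f 2"
  have z2: "0 < z2" "z2 < 1"
  proof -
    have "1 * f 1 < c' * f 1" using c' fpos by (intro mult_strict_right_mono) auto
    then have "f 1 < f 2" using f2 fpos by linarith
    then show "0 < z2" "z2 < 1" using fpos f12 by (auto simp: z2_def)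
  qed
  \<comment> \<open>The ratio at \<open>v\<close> as a function of the local ratio \<open>t\<close>
    at \<open>u\<close>. Its value at \<open>z2\<close>, the local ratio after one shift of
    \<open>u\<close>, is \<open>b\<close>.\<close>
  define r where "r t = (t * P + Q) / (t * S + T)" for t
  have Rr: "ratio rest (\<phi>(u := fibs c' t 1)) v = r t \<and> 0 < t * S + T \<and> 0 \<le> r t" if "0 < t" "t < 1" for t
  proof -
    have gt: "good K (fibs c' t 1)" using that K c' by (intro fibs_good) auto
    have gst: "good_state K (\<phi>(u := fibs c' t 1))" using gt gs by (simp add: good_state_def)
    have eq: "Z rest V (\<phi>(u := fibs c' t 1)) = t * P + Q" "Z rest V (shift v (\<phi>(u := fibs c' t 1))) = t * S + T"
      using dec[OF gt coef_fibs] by simp_all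
    have "0 < Z rest V (shift v (\<phi>(u := fibs c' t 1)))"
      by (rule Z_pos[OF K basics(3) good_state_shift[OF K gst]])
         (use basics gs that in \<open>auto simp: V_def shift_apply good_state_def intro: good_pos\<close>)
    moreover have "Z rest V (\<phi>(u := fibs c' t 1)) = ratio rest (\<phi>(u := fibs c' t 1)) v * Z rest V (shift v (\<phi>(u := fibs c' t 1)))"
      by (rule ratio_times[OF K basics(3) gst]) (auto simp: V_def)
    ultimately have "0 < t * S + T" "ratio rest (\<phi>(u := fibs c' t 1)) v = r t" unfolding eq by (auto simp: r_def)
    then show ?thesis using ratio_range[OF K basics(3) gst, of v] by simp
  qed
  have rb: "r z2 = b"
  proof -
    have "z2 * P + Q = Z10 / f 2" "z2 * S + T = Z11 / f 2" using f12 by (auto simp: z z2_def field_simps)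
    then have "r z2 = Z10 / Z11" using f12 by (simp add: r_def)
    then show ?thesis using Z10 Z11_pos by simp
  qed
  define W where "W = (P * T - Q * S) / ((z2 * S + T) * (z2 * S + T))"
  have den: "0 < z2 * S + T" using Rr[OF z2] by simp
  have "DERIV r z2 :> W"
    unfolding r_def[abs_def] W_def using den by (auto intro!: derivative_eq_intros simp: algebra_simps)
  then have "DERIV (\<lambda>t. psi (r t)) z2 :> 1 / gw (r z2) * W"
    using Rr[OF z2] by (intro DERIV_chain2[OF psi_DERIV]) auto
  then have "\<bar>1 / gw (r z2) * W\<bar> \<le> 1"
  proof (rule DERIV_abs_le_one[where k = 1])
    fix t :: real assume t: "0 < t" "t < 1"
    have "\<bar>psi (r t) - psi (r z2)\<bar> \<le> \<bar>psi (fibs c' t 1 0 / fibs c' t 1 1) - psi (fibs c' z2 1 0 / fibs c' z2 1 1)\<bar>"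
      using lip[OF fibs_good[of c' t K] fibs_good[of c' z2 K]] t z2 c' K Rr[OF t] Rr[OF z2]
      by (simp add: coef_fibs)
    also have "\<dots> \<le> \<bar>t - z2\<bar>" using psi_dist(1)[of t z2] t z2 by simp
    finally show "\<bar>psi (r t) - psi (r z2)\<bar> \<le> \<bar>t - z2\<bar>" .
  qed (use z2 in auto)
  moreover have gb: "gw b > 0" using gw_bounds(3)[OF ranges(3)] by simp
  ultimately have W: "\<bar>W\<bar> \<le> gw b" by (simp add: rb abs_mult)
  \<comment> \<open>Dividing numerator and denominator of \<open>ratio_rec\<close> by l Z11 gives (1
    + xt a)/(c + b + xt). Writing a = b + (a - b) isolates \<open>\<Delta>\<close>, the effect of
    shifting \<open>u\<close>.\<close>
  define xt where "xt = Z01 / (l * Z11)"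
  define \<Delta> where "\<Delta> = xt * (a - b)"
  have pos: "0 < l" "0 < Z11" "0 < c + b" using basics Z11_pos ranges by auto
  \<comment> \<open>The difference of the Moebius map \<open>r\<close> between f0/f1 and f1/f2
    carries the product of both denominators; the factor \<open>xt\<close> replaces the first of
    them by the second. So exactly the derivative \<open>W\<close> at \<open>z2\<close>
    remains.\<close>
  have \<Delta>_eq: "\<Delta> = (f 0 * f 2 - f 1 * f 1) / (l * (f 2 * f 2)) * W"
  proof -
    have "Z11 * (Z01 * (a - b)) = Z00 * Z11 - Z10 * Z01" by (simp add: Z00 Z10 algebra_simps)
    also have "\<dots> = (f 0 * f 2 - f 1 * f 1) * (P * T - Q * S)" by (simp add: z algebra_simps)
    finally have num: "Z11 * (Z01 * (a - b)) = (f 0 * f 2 - f 1 * f 1) * (P * T - Q * S)" .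
    have "\<Delta> = Z11 * (Z01 * (a - b)) / (l * (Z11 * Z11))" using pos by (simp add: \<Delta>_def xt_def)
    then have 1: "\<Delta> = (f 0 * f 2 - f 1 * f 1) * (P * T - Q * S) / (l * (Z11 * Z11))"
      by (simp only: num)
    have "Z11 = f 2 * (z2 * S + T)" using f12 by (simp add: z z2_def field_simps)
    then show ?thesis unfolding 1 W_def by (simp add: mult_ac)
  qed
  have "\<bar>(f 0 * f 2 - f 1 * f 1) / (l * (f 2 * f 2))\<bar> \<le> 1"
  proof -
    have "0 \<le> f 0 * f 2" "f 0 * f 2 \<le> f 2 * f 2" "0 \<le> f 1 * f 1" "f 1 * f 1 \<le> f 2 * f 2"
      using fpos f12 by (auto intro!: mult_mono)
    then have "\<bar>f 0 * f 2 - f 1 * f 1\<bar> \<le> 1 * (f 2 * f 2)" by linarith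
    also have "\<dots> \<le> l * (f 2 * f 2)" using basics(2) by (intro mult_right_mono) auto
    finally show ?thesis using pos f12 by (simp add: abs_mult)
  qed
  then have "\<bar>(f 0 * f 2 - f 1 * f 1) / (l * (f 2 * f 2))\<bar> * \<bar>W\<bar> \<le> 1 * gw b"
    using W by (intro mult_mono) auto
  then have \<Delta>: "\<bar>\<Delta>\<bar> \<le> gw b" by (simp add: \<Delta>_eq abs_mult)
  have Z12': "Z12 = (c + b) * Z11" by (simp add: Z12 Z10 algebra_simps)
  have xeq: "x = xt + \<Delta> / (c + b)"
  proof -
    have "x * (l * Z12) = Z01 * (c + a)" using Z02_x by (simp add: Z02 Z00 algebra_simps)
    moreover have "l * Z12 \<noteq> 0" using pos by (simp add: Z12')
    ultimately have "x = Z01 * (c + a) / (l * Z12)" by (rule nonzero_eq_divide_eq[THEN iffD2, rotated])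
    then have "x = Z01 * (c + a) / (l * ((c + b) * Z11))" by (simp only: Z12')
    also have "\<dots> = xt * ((c + a) / (c + b))" by (simp add: xt_def)
    also have "(c + a) / (c + b) = 1 + (a - b) / (c + b)" using pos by (simp add: field_simps)
    finally show ?thesis by (simp add: \<Delta>_def distrib_left)
  qed
  have "ratio es \<phi> v = (1 + xt * b + \<Delta>) / (c + b + xt)"
  proof -
    have "Z00 + l * Z11 = (l * Z11) * (1 + xt * b + \<Delta>)"
      using pos by (simp add: Z00 \<Delta>_def xt_def field_simps)
    moreover have "Z01 + l * Z12 = (l * Z11) * (c + b + xt)"
      using pos by (simp add: Z12' xt_def field_simps)
    ultimately show ?thesis unfolding ratio_rec using pos by simp
  qed
  moreover have "0 \<le> xt" using Z_nn pos by (simp add: xt_def)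
  then have "(1 + xt * b + \<Delta>) / (c + b + xt) \<le> cap K b x"
    using cap_valid[OF basics(4) K ranges(3-6) _ \<Delta> xeq] by simp
  ultimately show ?thesis using ratio_eq_step by (simp add: capped_step_def)
qed

end

text \<open>For \<open>u \<noteq> v\<close>, the induction hypothesis makes the recursion coincide with the capped one, which is a
  contraction.\<close>

theorem influence:
  assumes K: "K \<ge> 1"
  shows "weights_ok es \<Longrightarrow> good_state K \<phi> \<Longrightarrow> good K f \<Longrightarrow> good K g \<Longrightarrow> coef f = coef g \<Longrightarrow>
    \<bar>psi (ratio es (\<phi>(u := f)) v) - psi (ratio es (\<phi>(u := g)) v)\<bar> \<le> \<bar>psi (f 0 / f 1) - psi (g 0 / g 1)\<bar>"
proof (induction "length es" arbitrary: es \<phi> f g u v rule: less_induct)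
  case less
  define E where "E = \<bar>psi (f 0 / f 1) - psi (g 0 / g 1)\<bar>"
  have gs: "good_state K (\<phi>(u := f))" "good_state K (\<phi>(u := g))"
    using less.prems by (auto simp: good_state_def)
  show ?case
  proof (cases "u = v")
    case True
    then show ?thesis using own_influence[OF K less.prems] by simp
  next
    case uv: False
    show ?thesis
    proof (cases "find_edge v es")
      case None
      then have "v \<notin> verts es" by (simp add: find_edge_None)
      then show ?thesis using uv ratio_base[OF K less.prems(1) gs(1)] ratio_base[OF K less.prems(1) gs(2)] by simp
    next
      case (Some p)
      obtain w l rest where fe: "find_edge v es = Some ((w, l), rest)" using Some by (cases p) auto
      interpret s1: recursion_step K l es rest w v "\<phi>(u := f)" using less.prems K gs fe by unfold_locales auto
      interpret s2: recursion_step K l es rest w v "\<phi>(u := g)" using less.prems K gs fe by unfold_locales auto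
      have len: "length rest < length es" using find_edge_Some(4)[OF fe] by simp
      note IH = less.hyps[OF len s1.basics(3)]
      have c: "s1.c = s2.c" using uv by (simp add: s1.c_def s2.c_def)
      have ex1: "ratio es (\<phi>(u := f)) v = capped_step K s1.c s1.a s1.b s1.x"
        by (rule s1.ratio_eq_capped_step) (rule IH[OF gs(1)])
      have ex2: "ratio es (\<phi>(u := g)) v = capped_step K s2.c s2.a s2.b s2.x"
        by (rule s2.ratio_eq_capped_step) (rule IH[OF gs(2)])
      have a: "\<bar>psi s1.a - psi s2.a\<bar> \<le> E"
        unfolding s1.a_def s2.a_def E_def by (rule IH[OF less.prems(2-5)])
      have b: "\<bar>psi s1.b - psi s2.b\<bar> \<le> E"
      \<comment> \<open>If the neighbour is the perturbed vertex itself, the tails of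
        \<open>f\<close> and \<open>g\<close> are compared. Passing to the tail is z -> 1/(c + z) on
        local ratios, the Moebius map with \<open>A = 0\<close> and \<open>B = 1\<close>.\<close>
      proof (cases "w = u")
        case True
        have t: "good K (\<lambda>i. f (Suc i))" "coef (\<lambda>i. f (Suc i)) = coef f"
          "good K (\<lambda>i. g (Suc i))" "coef (\<lambda>i. g (Suc i)) = coef g"
          using good_tail[OF less.prems(3) K] good_tail[OF less.prems(4) K] by auto
        have "\<bar>psi s1.b - psi s2.b\<bar> \<le> \<bar>psi (f (Suc 0) / f (Suc 1)) - psi (g (Suc 0) / g (Suc 1))\<bar>"
          using IH[OF less.prems(2) t(1,3), of u v] t less.prems(5) True
          unfolding s1.b_def s2.b_def by (simp add: shift_upd)
        also have "\<dots> \<le> E"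
        proof -
          have h: "h (Suc 0) / h (Suc 1) = (h 0 / h 1 * 0 + 1) / (0 + (coef f + h 0 / h 1) * 1) \<and> 0 \<le> h 0 / h 1"
            if "good K h" "coef h = coef f" for h
            using good_coef(2)[OF that(1), of 0] good_pos[OF that(1), of 0] that
            by (auto simp: good_def field_simps)
          show ?thesis
            using psi_moebius_nonexpansive[of 0 1 "coef f" "f 0 / f 1" "g 0 / g 1"]
              h[OF less.prems(3) refl] h[OF less.prems(4)] good_coef(1)[OF less.prems(3)] less.prems(5)
            by (simp add: E_def)
        qed
        finally show ?thesis .
      next
        case False
        then show ?thesis
          using IH[OF good_state_shift[OF K less.prems(2), of w] less.prems(3-5), of u v]
          by (simp add: s1.b_def s2.b_def shift_upd E_def)
      qed
      have x: "\<bar>psi s1.x - psi s2.x\<bar> \<le> E"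
      proof -
        have "\<bar>psi (ratio rest (shift v (shift v (\<phi>(u := f)))) w) - psi (ratio rest (shift v (shift v (\<phi>(u := g)))) w)\<bar> \<le> E"
          using IH[OF good_state_shift[OF K good_state_shift[OF K less.prems(2), of v], of v] less.prems(3-5), of u w] uv
          by (simp add: shift_upd E_def)
        moreover have "0 \<le> ratio rest (shift v (shift v (\<phi>(u := f)))) w" "0 \<le> ratio rest (shift v (shift v (\<phi>(u := g)))) w"
          using ratio_range[OF K s1.basics(3,9)] ratio_range[OF K s2.basics(3,9)] by auto
        ultimately show ?thesis
          using psi_divide_nonexpansive[OF s1.basics(2)] unfolding s1.x_def s2.x_def
          by (meson order_trans)
      qed
      have "\<bar>psi (ratio es (\<phi>(u := f)) v) - psi (ratio es (\<phi>(u := g)) v)\<bar> \<le> rate K * E"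
        unfolding ex1 ex2 c[symmetric]
        using K by (intro capped_step_contraction s1.basics s1.ranges s2.ranges a b x) auto
      also have "\<dots> \<le> 1 * E" using rate_bounds(2)[of K] K by (intro mult_right_mono) (auto simp: E_def)
      finally show ?thesis by (simp add: E_def)
    qed
  qed
qed

section \<open>Truncation of the recursion and its error\<close>

fun ratio_approx :: "real \<Rightarrow> nat \<Rightarrow> nat \<Rightarrow> edge list \<Rightarrow> state \<Rightarrow> real" where
  "ratio_approx K 0 v es \<phi> = (case find_edge v es of None \<Rightarrow> \<phi> v 0 / \<phi> v 1 | Some _ \<Rightarrow> 0)"
| "ratio_approx K (Suc L) v es \<phi> = (case find_edge v es of None \<Rightarrow> \<phi> v 0 / \<phi> v 1
     | Some ((u, l), rest) \<Rightarrow>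
         capped_step K (coef (\<phi> v)) (ratio_approx K L v rest \<phi>) (ratio_approx K L v rest (shift u \<phi>)) (ratio_approx K L u rest (shift v (shift v \<phi>)) / l))"

text \<open>The value is a weighted mean of \<open>a\<close> and 1/(c + b), both at most
  \<open>K\<close>.\<close>

lemma step_le:
  assumes "c \<ge> 1" "K \<ge> 1" "0 \<le> a" "a \<le> K" "0 \<le> b" "0 \<le> x"
  shows "step c a b x \<le> K"
proof -
  have "1 / (c + b) \<le> 1 / 1" using assms by (intro divide_left_mono) auto
  also have "1 / 1 \<le> K" using assms by simp
  finally have "1 / (c + b) \<le> K" .
  then have "(c + a) * (1 / (c + b)) \<le> (c + a) * K" using assms by (intro mult_left_mono) auto
  moreover have "x * a \<le> x * K" using assms by (intro mult_left_mono) auto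
  ultimately have "x * a + (c + a) / (c + b) \<le> K * (c + a + x)" by (simp add: algebra_simps)
  then show ?thesis using assms by (simp add: step_def divide_le_eq)
qed

text \<open>At depth 0 the error is at most \<open>K\<close>, because ratios lie in [0, K] and
  \<open>psi\<close> is 1-Lipschitz. Each level multiplies it by \<open>rate K\<close>, as by
  \<open>influence\<close> the true ratio obeys the capped recursion too.\<close>

theorem ratio_approx_close:
  assumes K: "K \<ge> 1"
  shows "weights_ok es \<Longrightarrow> good_state K \<phi> \<Longrightarrow>
    0 \<le> ratio_approx K L v es \<phi> \<and> ratio_approx K L v es \<phi> \<le> K \<and> \<bar>psi (ratio_approx K L v es \<phi>) - psi (ratio es \<phi> v)\<bar> \<le> K * rate K ^ L"
proof (induction L arbitrary: v es \<phi>)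
  case 0
  note r = ratio_range[OF K 0, of v]
  show ?case
  proof (cases "find_edge v es")
    case None
    then have "v \<notin> verts es" by (simp add: find_edge_None)
    then show ?thesis using None ratio_base[OF K 0] r K by simp
  next
    case (Some p)
    have "\<bar>psi 0 - psi (ratio es \<phi> v)\<bar> \<le> \<bar>0 - ratio es \<phi> v\<bar>" using r by (intro psi_dist) auto
    then show ?thesis using Some r K by simp
  qed
next
  case (Suc L)
  show ?case
  proof (cases "find_edge v es")
    case None
    then have "v \<notin> verts es" by (simp add: find_edge_None)
    then show ?thesis
      using None ratio_base[OF K Suc.prems] ratio_range[OF K Suc.prems, of v] K rate_bounds(1)[of K] by simp
  next
    case (Some p)
    obtain u l rest where fe: "find_edge v es = Some ((u, l), rest)" using Some by (cases p) auto
    interpret recursion_step K l es rest u v \<phi> using Suc.prems K fe by unfold_locales auto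
    define a' b' y x' where "a' = ratio_approx K L v rest \<phi>" and "b' = ratio_approx K L v rest (shift u \<phi>)"
      and "y = ratio_approx K L u rest (shift v (shift v \<phi>))" and "x' = y / l"
    have ratio_approx: "ratio_approx K (Suc L) v es \<phi> = capped_step K c a' b' x'" by (simp add: fe a'_def b'_def x'_def y_def c_def)
    have ex: "ratio es \<phi> v = capped_step K c a b x"
      by (rule ratio_eq_capped_step) (rule influence[OF K basics(3) gs])
    define E where "E = K * rate K ^ L"
    have a: "0 \<le> a'" "a' \<le> K" "\<bar>psi a' - psi a\<bar> \<le> E"
      using Suc.IH[OF basics(3) gs, of v] by (auto simp: a'_def a_def E_def)
    have b: "0 \<le> b'" "b' \<le> K" "\<bar>psi b' - psi b\<bar> \<le> E"
      using Suc.IH[OF basics(3,7), of v] by (auto simp: b'_def b_def E_def)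
    have y: "0 \<le> y" "y \<le> K" "\<bar>psi y - psi (ratio rest (shift v (shift v \<phi>)) u)\<bar> \<le> E"
      using Suc.IH[OF basics(3,9), of u] by (auto simp: y_def E_def)
    have x: "0 \<le> x'" "x' \<le> K" "\<bar>psi x' - psi x\<bar> \<le> E"
    proof -
      show "0 \<le> x'" using y basics(2) by (simp add: x'_def)
      have "y / l \<le> y / 1" using y basics(2) by (intro divide_left_mono) auto
      then show "x' \<le> K" using y by (simp add: x'_def)
      have "0 \<le> ratio rest (shift v (shift v \<phi>)) u" using ratio_range[OF K basics(3,9)] by auto
      then show "\<bar>psi x' - psi x\<bar> \<le> E"
        using psi_divide_nonexpansive[OF basics(2) y(1)] y(3) unfolding x'_def x_def by (meson order_trans)
    qed
    have "\<bar>psi (capped_step K c a' b' x') - psi (capped_step K c a b x)\<bar> \<le> rate K * E"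
      using K by (intro capped_step_contraction basics ranges a b x) auto
    moreover have "0 \<le> capped_step K c a' b' x'" "capped_step K c a' b' x' \<le> K"
    proof -
      show "0 \<le> capped_step K c a' b' x'"
        using step_nonneg[of c a' b' x'] cap_ge[of K b' x'] basics a b x K by (simp add: capped_step_def)
      show "capped_step K c a' b' x' \<le> K"
        using step_le[of c K a' b' x'] basics a b x K by (simp add: capped_step_def min_le_iff_disj)
    qed
    ultimately show ?thesis unfolding ratio_approx ex by (simp add: E_def mult_ac)
  qed
qed

text \<open>The two shifts are undone one after the other, so the second ratio is taken in the state
  already shifted at \<open>u\<close>.\<close>

lemma Z_Cons_factor:
  assumes K: "K \<ge> 1" and ok: "weights_ok ((u, v, l) # es)" and g: "good_state K \<phi>"
    and V: "finite V" "verts ((u, v, l) # es) \<subseteq> V"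
  shows "Z ((u, v, l) # es) V \<phi> = (l + ratio es \<phi> u * ratio es (shift u \<phi>) v) * Z es V (shift u (shift v \<phi>))"
proof -
  have ok': "weights_ok es" using ok by simp
  have "Z es V \<phi> = ratio es \<phi> u * Z es V (shift u \<phi>)"
    using V by (intro ratio_times[OF K ok' g]) auto
  moreover have "Z es V (shift u \<phi>) = ratio es (shift u \<phi>) v * Z es V (shift v (shift u \<phi>))"
    using V by (intro ratio_times[OF K ok' good_state_shift[OF K g]]) auto
  ultimately show ?thesis by (simp add: shift_commute[of v u] algebra_simps)
qed

fun Z_approx :: "real \<Rightarrow> nat \<Rightarrow> edge list \<Rightarrow> nat set \<Rightarrow> state \<Rightarrow> real" where
  "Z_approx K L [] V \<phi> = (\<Prod>w\<in>V. \<phi> w 0)"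
| "Z_approx K L ((u, v, l) # es) V \<phi> =
     (l + ratio_approx K L u es \<phi> * ratio_approx K L v es (shift u \<phi>)) * Z_approx K L es V (shift u (shift v \<phi>))"

lemma ratio_approx_dist:
  assumes K: "K \<ge> 1" and ok: "weights_ok es" and g: "good_state K \<phi>"
  shows "\<bar>ratio_approx K L v es \<phi> - ratio es \<phi> v\<bar> \<le> 5 * (K * rate K ^ L)"
proof -
  note h = ratio_approx_close[OF K ok g, of L v]
  have "\<bar>ratio_approx K L v es \<phi> - ratio es \<phi> v\<bar> \<le> 5 * \<bar>psi (ratio_approx K L v es \<phi>) - psi (ratio es \<phi> v)\<bar>"
    using h ratio_range[OF K ok g, of v] by (intro psi_dist) auto
  also have "\<dots> \<le> 5 * (K * rate K ^ L)" using h by simp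
  finally show ?thesis .
qed

text \<open>Two ratios at most \<open>K\<close>, each with error at most 5 K (rate K)^L, give a
  product with error at most 10 K^2 (rate K)^L. Since each factor is at least 1, this is also a
  relative error.\<close>

lemma Z_approx_bounds:
  assumes K: "K \<ge> 1" and \<theta>: "\<theta> \<le> 1" "10 * K\<^sup>2 * rate K ^ L \<le> \<theta>" and V: "finite V"
  shows "weights_ok es \<Longrightarrow> good_state K \<phi> \<Longrightarrow> verts es \<subseteq> V \<Longrightarrow>
    0 \<le> Z_approx K L es V \<phi> \<and> (1 - \<theta>) ^ length es * Z es V \<phi> \<le> Z_approx K L es V \<phi> \<and>
    Z_approx K L es V \<phi> \<le> (1 + \<theta>) ^ length es * Z es V \<phi>"
proof (induction es arbitrary: \<phi>)
  case Nil
  have "0 \<le> Z [] V \<phi>" using Z_nonneg[OF K _ Nil(2), of "[]" V] by (simp add: weights_ok_def)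
  then show ?case by simp
next
  case (Cons e es)
  obtain u v l where e: "e = (u, v, l)" by (cases e)
  have ok: "weights_ok es" "1 \<le> l" "u \<noteq> v" using Cons.prems by (auto simp: e)
  define \<psi> where "\<psi> = shift u (shift v \<phi>)"
  have gs: "good_state K (shift u \<phi>)" "good_state K \<psi>"
    using Cons.prems by (auto simp: \<psi>_def intro!: good_state_shift[OF K])
  define r1 r2 s1 s2 where "r1 = ratio es \<phi> u" and "r2 = ratio es (shift u \<phi>) v"
    and "s1 = ratio_approx K L u es \<phi>" and "s2 = ratio_approx K L v es (shift u \<phi>)"
  define F G where "F = l + r1 * r2" and "G = l + s1 * s2"
  have r: "0 \<le> r1" "r1 \<le> K" "0 \<le> r2" "r2 \<le> K"
    using ratio_range[OF K ok(1) Cons.prems(2), of u] ratio_range[OF K ok(1) gs(1), of v] by (auto simp: r1_def r2_def)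
  have s: "0 \<le> s1" "s1 \<le> K" "0 \<le> s2" "s2 \<le> K"
    using ratio_approx_close[OF K ok(1) Cons.prems(2), of L u] ratio_approx_close[OF K ok(1) gs(1), of L v] by (auto simp: s1_def s2_def)
  define \<delta> where "\<delta> = 5 * (K * rate K ^ L)"
  have d: "\<bar>s1 - r1\<bar> \<le> \<delta>" "\<bar>s2 - r2\<bar> \<le> \<delta>"
    using ratio_approx_dist[OF K ok(1) Cons.prems(2), of L u] ratio_approx_dist[OF K ok(1) gs(1), of L v]
    by (auto simp: s1_def s2_def r1_def r2_def \<delta>_def)
  have "\<bar>G - F\<bar> = \<bar>(s1 - r1) * s2 + r1 * (s2 - r2)\<bar>" by (simp add: F_def G_def algebra_simps)
  also have "\<dots> \<le> \<bar>s1 - r1\<bar> * s2 + r1 * \<bar>s2 - r2\<bar>"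
    using abs_triangle_ineq[of "(s1 - r1) * s2" "r1 * (s2 - r2)"] r s by (simp add: abs_mult)
  also have "\<dots> \<le> \<delta> * K + K * \<delta>" using d r s by (intro add_mono mult_mono) auto
  also have "\<dots> = 10 * K\<^sup>2 * rate K ^ L" by (simp add: \<delta>_def power2_eq_square)
  also have "\<dots> \<le> \<theta>" by (rule \<theta>)
  finally have GF: "\<bar>G - F\<bar> \<le> \<theta>" .
  then have \<theta>0: "0 \<le> \<theta>" by linarith
  have F1: "1 \<le> F" using ok r by (simp add: F_def add_increasing2)
  have "\<theta> * 1 \<le> \<theta> * F" using F1 \<theta>0 by (intro mult_left_mono)
  then have G: "(1 - \<theta>) * F \<le> G" "G \<le> (1 + \<theta>) * F" "0 \<le> G"
    using GF ok s by (auto simp: algebra_simps G_def)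
  have Zf: "Z (e # es) V \<phi> = F * Z es V \<psi>"
    using Z_Cons_factor[OF K _ Cons.prems(2) V] Cons.prems by (simp add: e F_def r1_def r2_def \<psi>_def)
  have IH: "0 \<le> Z_approx K L es V \<psi>" "(1 - \<theta>) ^ length es * Z es V \<psi> \<le> Z_approx K L es V \<psi>"
    "Z_approx K L es V \<psi> \<le> (1 + \<theta>) ^ length es * Z es V \<psi>"
    using Cons.IH[OF ok(1) gs(2)] Cons.prems(3) by (auto simp: e)
  have ZAe: "Z_approx K L (e # es) V \<phi> = G * Z_approx K L es V \<psi>" by (simp add: e G_def s1_def s2_def \<psi>_def)
  have Zn: "0 \<le> Z es V \<psi>" by (rule Z_nonneg[OF K ok(1) gs(2)])
  have "((1 - \<theta>) * F) * ((1 - \<theta>) ^ length es * Z es V \<psi>) \<le> G * Z_approx K L es V \<psi>"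
    using G IH \<theta> F1 Zn by (intro mult_mono) auto
  moreover have "G * Z_approx K L es V \<psi> \<le> ((1 + \<theta>) * F) * ((1 + \<theta>) ^ length es * Z es V \<psi>)"
    using G IH \<theta>0 F1 Zn by (intro mult_mono) auto
  moreover have "0 \<le> G * Z_approx K L es V \<psi>" using G IH by simp
  ultimately show ?case unfolding ZAe Zf by (simp add: mult_ac)
qed

section \<open>From sums over edge assignments to the recursion over edges\<close>

lemma sum_PiE_lessThan_Suc:
  fixes h :: "(nat \<Rightarrow> bool) \<Rightarrow> real"
  shows "(\<Sum>\<sigma> \<in> {..<Suc k} \<rightarrow>\<^sub>E UNIV. h \<sigma>) = (\<Sum>g \<in> {..<k} \<rightarrow>\<^sub>E UNIV. h (g(k := False)) + h (g(k := True)))"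
proof -
  have "(\<Sum>\<sigma> \<in> {..<Suc k} \<rightarrow>\<^sub>E UNIV. h \<sigma>) =
      (\<Sum>\<sigma> \<in> (\<lambda>(y, g). g(k := y)) ` (UNIV \<times> ({..<k} \<rightarrow>\<^sub>E UNIV)). h \<sigma>)"
    by (simp add: lessThan_Suc PiE_insert_eq)
  also have "\<dots> = (\<Sum>(y, g) \<in> UNIV \<times> ({..<k} \<rightarrow>\<^sub>E UNIV). h (g(k := y)))"
  proof -
    have "inj_on (\<lambda>(y, g). g(k := y)) ((UNIV :: bool set) \<times> ({..<k} \<rightarrow>\<^sub>E UNIV))"
      using inj_combinator[of k "{..<k}" "\<lambda>_. UNIV :: bool set"] by simp
    then show ?thesis by (subst sum.reindex) (auto simp: case_prod_unfold)
  qed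
  also have "\<dots> = (\<Sum>y\<in>UNIV. \<Sum>g \<in> {..<k} \<rightarrow>\<^sub>E UNIV. h (g(k := y)))"
    by (simp add: sum.cartesian_product)
  finally show ?thesis by (simp add: UNIV_bool sum.distrib)
qed

text \<open>The sum over assignments is split at the last edge, whereas \<open>Z\<close> treats the
  head first; \<open>Z_move\<close> reconciles the two.\<close>

lemma Z_eq_sum:
  fixes ep :: "nat \<Rightarrow> nat \<times> nat" and wt :: "nat \<Rightarrow> real"
  assumes "\<And>e. e < k \<Longrightarrow> fst (ep e) \<noteq> snd (ep e)"
  shows "Z (map (\<lambda>e. (fst (ep e), snd (ep e), wt e)) [0..<k]) V \<phi> =
    (\<Sum>\<sigma> \<in> {..<k} \<rightarrow>\<^sub>E (UNIV :: bool set). (\<Prod>e<k. wt e ^ of_bool (\<sigma> e)) *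
       (\<Prod>v\<in>V. \<phi> v (count_list (map \<sigma> (filter (\<lambda>e. fst (ep e) = v \<or> snd (ep e) = v) [0..<k])) True)))"
  using assms
proof (induction k arbitrary: \<phi>)
  case (Suc k)
  define es where "es = map (\<lambda>e. (fst (ep e), snd (ep e), wt e)) [0..<k]"
  define u v where "u = fst (ep k)" and "v = snd (ep k)"
  define cnt where "cnt k \<sigma> w = count_list (map \<sigma> (filter (\<lambda>e. fst (ep e) = w \<or> snd (ep e) = w) [0..<k])) True"
    for k w and \<sigma> :: "nat \<Rightarrow> bool"
  have uv: "u \<noteq> v" using Suc.prems[of k] by (simp add: u_def v_def)
  have cnt: "cnt (Suc k) (g(k := y)) w = cnt k g w + (if y \<and> (w = u \<or> w = v) then 1 else 0)" for g y w
  proof -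
    have "map (g(k := y)) (filter P [0..<k]) = map g (filter P [0..<k])" for P
      by (intro map_cong) auto
    then show ?thesis by (auto simp: cnt_def u_def v_def)
  qed
  have prd: "(\<Prod>e<Suc k. wt e ^ of_bool ((g(k := y)) e)) = (\<Prod>e<k. wt e ^ of_bool (g e)) * (if y then wt k else 1)" for g y
  proof -
    have "(\<Prod>e<k. wt e ^ of_bool ((g(k := y)) e)) = (\<Prod>e<k. wt e ^ of_bool (g e))"
      by (intro prod.cong) auto
    then show ?thesis by simp
  qed
  have IH: "Z es V \<psi> = (\<Sum>g \<in> {..<k} \<rightarrow>\<^sub>E UNIV. (\<Prod>e<k. wt e ^ of_bool (g e)) * (\<Prod>v\<in>V. \<psi> v (cnt k g v)))" for \<psi>
    using Suc.IH Suc.prems unfolding es_def cnt_def by simp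
  have sh: "shift u (shift v \<phi>) w i = \<phi> w (i + (if w = u \<or> w = v then 1 else 0))" for w i
    using uv by (simp add: shift_apply)
  have "Z (map (\<lambda>e. (fst (ep e), snd (ep e), wt e)) [0..<Suc k]) V \<phi> = Z (es @ [(u, v, wt k)]) V \<phi>"
    by (simp add: es_def u_def v_def)
  also have "\<dots> = Z es V \<phi> + wt k * Z es V (shift u (shift v \<phi>))"
    by (subst Z_move) simp
  also have "\<dots> = (\<Sum>g \<in> {..<k} \<rightarrow>\<^sub>E UNIV. (\<Prod>e<k. wt e ^ of_bool (g e)) * (\<Prod>v\<in>V. \<phi> v (cnt k g v))
      + wt k * ((\<Prod>e<k. wt e ^ of_bool (g e)) * (\<Prod>w\<in>V. shift u (shift v \<phi>) w (cnt k g w))))"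
    unfolding IH by (simp add: sum.distrib sum_distrib_left)
  also have "\<dots> = (\<Sum>\<sigma> \<in> {..<Suc k} \<rightarrow>\<^sub>E UNIV. (\<Prod>e<Suc k. wt e ^ of_bool (\<sigma> e)) * (\<Prod>v\<in>V. \<phi> v (cnt (Suc k) \<sigma> v)))"
    unfolding sum_PiE_lessThan_Suc prd cnt by (simp add: sh mult_ac)
  finally show ?case by (simp only: cnt_def)
qed simp

definition edges :: "holant_instance \<Rightarrow> edge list" where
  "edges \<Omega> = map (\<lambda>((u, v), l). (u, v, l)) (zip (endpoints \<Omega>) (weights \<Omega>))"

lemma edges_alt:
  assumes "length (weights \<Omega>) = length (endpoints \<Omega>)"
  shows "edges \<Omega> = map (\<lambda>e. (fst (endpoints \<Omega> ! e), snd (endpoints \<Omega> ! e), weights \<Omega> ! e)) [0..<length (endpoints \<Omega>)]"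
  using assms by (auto simp: edges_def case_prod_unfold intro!: nth_equalityI)

lemma count_list_True_le: "count_list (map \<sigma> xs) True \<le> length xs"
  using count_le_length[of "map \<sigma> xs"] by simp

lemma partition_function_eq_Z:
  assumes wf: "well_formed \<Omega>"
    and \<phi>: "\<And>v i. v < length (vertex_funs \<Omega>) \<Longrightarrow> i < length (vertex_funs \<Omega> ! v) \<Longrightarrow> \<phi> v i = vertex_funs \<Omega> ! v ! i"
  shows "partition_function \<Omega> = Z (edges \<Omega>) {..<length (vertex_funs \<Omega>)} \<phi>"
proof -
  have ne: "fst (endpoints \<Omega> ! e) \<noteq> snd (endpoints \<Omega> ! e)" if "e < length (endpoints \<Omega>)" for e
    using wf that by (auto simp: well_formed_def dest!: nth_mem[of e])
  have len: "length (weights \<Omega>) = length (endpoints \<Omega>)" using wf by (simp add: well_formed_def)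
  have *: "sym_fun (vertex_funs \<Omega> ! v) (map \<sigma> (incident_edges \<Omega> v)) =
      \<phi> v (count_list (map \<sigma> (incident_edges \<Omega> v)) True)" if "v < length (vertex_funs \<Omega>)" for v \<sigma>
  proof -
    have "count_list (map \<sigma> (incident_edges \<Omega> v)) True < length (vertex_funs \<Omega> ! v)"
      using count_list_True_le[of \<sigma> "incident_edges \<Omega> v"] wf that
      by (simp add: well_formed_def vertex_degree_def)
    then show ?thesis using \<phi>[OF that] by (simp add: sym_fun_def)
  qed
  have Z: "Z (edges \<Omega>) {..<length (vertex_funs \<Omega>)} \<phi> =
      (\<Sum>\<sigma> \<in> {..<length (endpoints \<Omega>)} \<rightarrow>\<^sub>E (UNIV :: bool set).
        (\<Prod>e < length (endpoints \<Omega>). (weights \<Omega> ! e) ^ of_bool (\<sigma> e)) *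
        (\<Prod>v < length (vertex_funs \<Omega>). \<phi> v (count_list (map \<sigma> (incident_edges \<Omega> v)) True)))"
    unfolding edges_alt[OF len] incident_edges_def by (rule Z_eq_sum) (rule ne)
  show ?thesis
    unfolding Z partition_function_def
    by (intro sum.cong refl arg_cong2[where f = "(*)"] prod.cong) (simp add: *)
qed

text \<open>Short functions do not determine the parameter of the recurrence; any admissible one will do.\<close>

definition seq :: "real list \<Rightarrow> nat \<Rightarrow> real" where
  "seq f = (if length f = 1 then fibs (117/100) (f ! 0) (f ! 0 + 1)
     else fibs (if length f = 2 then 117/100 else (f ! 2 - f ! 0) / f ! 1) (f ! 0) (f ! 1))"

lemma fibs_eqI:
  assumes "\<And>i. i + 2 < n \<Longrightarrow> f (i + 2) = c * f (i + 1) + f i"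
  shows "i < n \<Longrightarrow> fibs c (f 0) (f 1) i = f i"
proof (induction i rule: induct_nat_012)
  case (ge2 i)
  then show ?case using assms[of i] by simp
qed auto

text \<open>For arity 0 the second entry is free, and \<open>f ! 0 + 1\<close> is positive and at
  least \<open>f ! 0\<close>. For larger arity, K p >= 1 turns f1 >= p f0 into f0 <= K f1.\<close>

lemma seq_good:
  assumes f: "f \<in> fibonacci_from p 1.17" and pos: "length f \<ge> 2 \<Longrightarrow> 0 < f ! 1" and K: "K \<ge> 1" "K * p \<ge> 1"
  shows "good K (seq f)" "i < length f \<Longrightarrow> seq f i = f ! i"
proof -
  obtain c where c: "c \<ge> 117/100" and ne: "f \<noteq> []" and nn: "\<And>x. x \<in> set f \<Longrightarrow> 0 \<le> x"
    and rec: "\<And>i. i + 2 < length f \<Longrightarrow> f ! (i + 2) = c * f ! (i + 1) + f ! i"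
    and p: "\<And>i. i + 1 < length f \<Longrightarrow> f ! (i + 1) \<ge> p * f ! i"
    using f by (auto simp: fibonacci_from_def fibonacci_p_def fibonacci_def)
  have f0: "0 \<le> f ! 0" using nn ne by (cases f) auto
  have "good K (seq f) \<and> (\<forall>i<length f. seq f i = f ! i)"
  proof (cases "length f = 1")
    case True
    have "f ! 0 \<le> K * f ! 0" using K f0 mult_right_mono[of 1 K "f ! 0"] by simp
    then have "f ! 0 \<le> K * (f ! 0 + 1)" using K by (simp add: distrib_left)
    then have "good K (seq f)" using True f0 by (auto simp: good_def seq_def intro!: exI[of _ "117/100"])
    then show ?thesis using True by (simp add: seq_def)
  next
    case False
    then have len: "length f \<ge> 2" using ne by (cases f; cases "tl f") auto
    define d where "d = (if length f = 2 then 117/100 else (f ! 2 - f ! 0) / f ! 1)"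
    have d: "d = c \<or> length f = 2" "d \<ge> 117/100"
      using rec[of 0] pos[OF len] len c by (auto simp: d_def numeral_2_eq_2 field_simps)
    have eq: "seq f = fibs d (f ! 0) (f ! 1)" using False by (simp add: seq_def d_def)
    have "1 * f ! 0 \<le> K * p * f ! 0" using K f0 by (intro mult_right_mono) auto
    also have "\<dots> \<le> K * f ! 1" using p[of 0] len K mult_left_mono[of "p * f ! 0" "f ! 1" K] by (simp add: mult_ac)
    finally have "good K (seq f)"
      using f0 pos[OF len] d(2) by (auto simp: good_def eq intro!: exI[of _ d])
    moreover have "fibs d (f ! 0) (f ! 1) i = f ! i" if "i < length f" for i
      using that rec d(1) by (intro fibs_eqI[of "length f"]) auto
    ultimately show ?thesis by (simp add: eq)
  qed
  then show "good K (seq f)" "i < length f \<Longrightarrow> seq f i = f ! i" by auto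
qed

text \<open>These are the functions excluded by the positivity assumption of
  \<open>seq_good\<close>: f1 = 0 and p f0 <= f1 force f0 = 0, and the recurrence does the
  rest.\<close>

lemma zero_function:
  assumes f: "f \<in> fibonacci_from p 1.17" and p: "p > 0" and z: "length f \<ge> 2" "f ! 1 \<le> 0"
  shows "i < length f \<Longrightarrow> f ! i = 0"
proof -
  obtain c where nn: "\<And>x. x \<in> set f \<Longrightarrow> 0 \<le> x"
    and rec: "\<And>i. i + 2 < length f \<Longrightarrow> f ! (i + 2) = c * f ! (i + 1) + f ! i"
    and pi: "\<And>i. i + 1 < length f \<Longrightarrow> f ! (i + 1) \<ge> p * f ! i"
    using f by (auto simp: fibonacci_from_def fibonacci_p_def fibonacci_def)
  have f1: "f ! 1 = 0" using nn[of "f ! 1"] z by (simp add: antisym)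
  have "p * f ! 0 \<le> 0" using pi[of 0] z f1 by simp
  moreover have "0 \<le> f ! 0" using nn[of "f ! 0"] z by (cases f) auto
  ultimately have f0: "f ! 0 = 0" using p by (simp add: mult_le_0_iff)
  show "i < length f \<Longrightarrow> f ! i = 0"
  proof (induction i rule: induct_nat_012)
    case (ge2 i)
    then show ?case using rec[of i] by simp
  qed (use f0 f1 in auto)
qed

lemma partition_function_zero:
  assumes wf: "well_formed \<Omega>" and v: "v < length (vertex_funs \<Omega>)"
    and z: "\<And>i. i < length (vertex_funs \<Omega> ! v) \<Longrightarrow> vertex_funs \<Omega> ! v ! i = 0"
  shows "partition_function \<Omega> = 0"
proof -
  have "(\<Prod>v < length (vertex_funs \<Omega>). sym_fun (vertex_funs \<Omega> ! v) (map \<sigma> (incident_edges \<Omega> v))) = 0" for \<sigma>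
  proof (rule prod_zero)
    have "count_list (map \<sigma> (incident_edges \<Omega> v)) True < length (vertex_funs \<Omega> ! v)"
      using count_list_True_le[of \<sigma> "incident_edges \<Omega> v"] wf v
      by (simp add: well_formed_def vertex_degree_def)
    then show "\<exists>v\<in>{..<length (vertex_funs \<Omega>)}. sym_fun (vertex_funs \<Omega> ! v) (map \<sigma> (incident_edges \<Omega> v)) = 0"
      using v z by (auto simp: sym_fun_def intro!: bexI[of _ v])
  qed simp
  then show ?thesis unfolding partition_function_def by (simp only: mult_zero_right sum.neutral_const)
qed

text \<open>The error bounds are multiplicative, so an exact value 0 is reproduced exactly, as
  \<open>approximates\<close> demands.\<close>

lemma approximates_Z_approx:
  assumes K: "K \<ge> 1" and ok: "weights_ok es" "good_state K \<phi>" "finite V" "verts es \<subseteq> V"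
    and \<epsilon>: "\<epsilon> > 0" and L: "rate K ^ L \<le> \<epsilon> / ((1 + \<epsilon>) * (20 * K\<^sup>2 * (real (length es) + 1)))"
  shows "approximates \<epsilon> (Z es V \<phi>) (Z_approx K L es V \<phi>)"
proof -
  define m where "m = length es"
  define \<theta> where "\<theta> = \<epsilon> / ((1 + \<epsilon>) * (2 * (real m + 1)))"
  have K2: "K\<^sup>2 > 0" using K by simp
  have "10 * K\<^sup>2 * rate K ^ L \<le> 10 * K\<^sup>2 * (\<epsilon> / ((1 + \<epsilon>) * (20 * K\<^sup>2 * (real m + 1))))"
    using L K by (intro mult_left_mono) (auto simp: m_def)
  also have "\<dots> = \<theta>" using K2 \<epsilon> unfolding \<theta>_def by (simp add: divide_simps; simp add: algebra_simps)
  finally have 1: "10 * K\<^sup>2 * rate K ^ L \<le> \<theta>" .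
  have \<theta>0: "0 < \<theta>" using \<epsilon> by (simp add: \<theta>_def add_pos_nonneg)
  \<comment> \<open>The total relative loss. It is below 1 even for large \<open>\<epsilon>\<close>,
    and 1/(1 - s) stays below 1 + \<epsilon>.\<close>
  define s where "s = \<epsilon> / (2 * (1 + \<epsilon>))"
  have s: "0 < s" "s < 1" using \<epsilon> by (auto simp: s_def)
  have \<theta>s: "\<theta> = s / (real m + 1)" unfolding \<theta>_def s_def by (simp; simp add: algebra_simps)
  have \<theta>1: "\<theta> \<le> 1" using s by (simp add: \<theta>s divide_le_eq)
  have m\<theta>: "real m * \<theta> \<le> s" using s by (simp add: \<theta>s divide_le_eq mult.commute)
  have "1 + real m * (- \<theta>) \<le> (1 + (- \<theta>)) ^ m" using \<theta>1 by (intro Bernoulli_inequality) simp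
  then have low: "1 - s \<le> (1 - \<theta>) ^ m" using m\<theta> by simp
  \<comment> \<open>The upper estimate follows from the lower one, since (1 + \<theta>)(1 -
    \<theta>) <= 1.\<close>
  have "(1 + \<theta>) ^ m * (1 - \<theta>) ^ m = (1 - \<theta>\<^sup>2) ^ m"
    by (simp add: power_mult_distrib[symmetric] power2_eq_square algebra_simps)
  also have "\<dots> \<le> 1" using \<theta>0 \<theta>1 by (intro power_le_one) (auto simp: power_le_one)
  finally have "(1 + \<theta>) ^ m * (1 - \<theta>) ^ m \<le> 1" .
  moreover have "(1 + \<theta>) ^ m * (1 - s) \<le> (1 + \<theta>) ^ m * (1 - \<theta>) ^ m"
    using low \<theta>0 by (intro mult_left_mono) auto
  ultimately have "(1 + \<theta>) ^ m * (1 - s) \<le> 1" by linarith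
  then have "(1 + \<theta>) ^ m \<le> 1 / (1 - s)" using s by (simp add: pos_le_divide_eq)
  also have "1 / (1 - s) < 1 + \<epsilon>"
  proof -
    have "(1 + \<epsilon>) * (1 - s) = 1 + \<epsilon> / 2" using \<epsilon> by (simp add: s_def field_simps)
    then have "1 < (1 + \<epsilon>) * (1 - s)" using \<epsilon> by simp
    then show ?thesis using s by (simp add: pos_divide_less_eq)
  qed
  finally have up: "(1 + \<theta>) ^ m < 1 + \<epsilon>" .
  have "\<epsilon> < \<epsilon> * (2 * (1 + \<epsilon>))" using \<epsilon> by simp
  then have "s < \<epsilon>" using \<epsilon> by (simp add: s_def pos_divide_less_eq)
  then have low': "1 - \<epsilon> < (1 - \<theta>) ^ m" using low by simp
  note A = Z_approx_bounds[OF K \<theta>1 1 ok(3,1,2,4)]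
  have Z: "0 \<le> Z es V \<phi>" by (rule Z_nonneg[OF K ok(1,2)])
  show ?thesis
  proof (cases "Z es V \<phi> = 0")
    case True
    then show ?thesis using A by (simp add: approximates_def)
  next
    case False
    then have "0 < Z es V \<phi>" using Z by simp
    then have "(1 - \<epsilon>) * Z es V \<phi> < (1 - \<theta>) ^ m * Z es V \<phi>" "(1 + \<theta>) ^ m * Z es V \<phi> < (1 + \<epsilon>) * Z es V \<phi>"
      using low' up by simp_all
    then show ?thesis using A False by (simp add: approximates_def m_def[symmetric])
  qed
qed

section \<open>The program\<close>

text \<open>Numbers in \<open>Call\<close> are positions in \<open>prog k\<close>; \<open>k\<close> is a constant of the algorithm with \<open>k p \<ge> 1\<close>.
  Vertices are numbers, and \<open>VNil\<close> is false. Recursion depths are represented in unary, by lists of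
  \<open>VNil\<close>. The arguments of \<open>total_body\<close> are the depth, the edges and the functions, those of \<open>ratio_body\<close>
  the depth, the vertex, the edges and the functions.\<close>

fun num :: "nat \<Rightarrow> expr" where
  "num 0 = Zero_const"
| "num (Suc n) = Arith Add One_const (num n)"

definition zip_body :: expr where
  "zip_body = If_pair (Arg 0)
     (Mk_pair (Mk_pair (First (Arg 0)) (First (Arg 1))) (Call 1 [Second (Arg 0), Second (Arg 1)]))
     Nil_const"

text \<open>Counting starts at 1: the result is used as a divisor, and the precision formula
  contains the number of edges plus 1.\<close>

definition len_body :: expr where
  "len_body = If_pair (Arg 0) (Arith Add One_const (Call 2 [Second (Arg 0)])) One_const"

definition check_body :: expr where
  "check_body = If_pair (Arg 0)
     (If_pair (Second (First (Arg 0)))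
        (If_less Zero_const (First (Second (First (Arg 0)))) (Call 3 [Second (Arg 0)]) Nil_const)
        (Call 3 [Second (Arg 0)]))
     (Mk_pair Nil_const Nil_const)"

text \<open>The argument is divided by \<open>rate k\<close>, that is (49 + 100 k)/(50 + 100 k),
  until it is at least 1. The number of divisions is the required depth, so no logarithm has to be
  computed.\<close>

definition depth_body :: "nat \<Rightarrow> expr" where
  "depth_body k = If_less (Arg 0) One_const
     (Mk_pair Nil_const
        (Call 4 [Arith Div (Arith Mul (Arg 0) (num (50 + 100 * k))) (num (49 + 100 * k))]))
     Nil_const"

text \<open>Under all \<open>Let_in\<close>, the indices 0 to 6 are the functions shifted at
  \<open>u\<close>, the remaining edges, \<open>v\<close>, \<open>u\<close>, the depth, all edges
  and the functions.\<close>

definition total_body :: expr where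
  "total_body = If_pair (Arg 1)
     (Let_in (First (First (First (Arg 1))))
     (Let_in (Second (First (First (Arg 2))))
     (Let_in (Second (Arg 3))
     (Let_in (Call 10 [Arg 5, Arg 2])
        (Arith Mul
           (Arith Add (Second (First (Arg 5)))
              (Arith Mul (Call 7 [Arg 4, Arg 3, Arg 1, Arg 6]) (Call 7 [Arg 4, Arg 2, Arg 1, Arg 0])))
           (Call 5 [Arg 4, Arg 1, Call 10 [Arg 0, Arg 2]]))))))
     (Call 6 [Arg 2])"

definition heads_body :: expr where
  "heads_body = If_pair (Arg 0) (Arith Mul (First (First (Arg 0))) (Call 6 [Second (Arg 0)])) One_const"

text \<open>Under all \<open>Let_in\<close>, the indices 0 to 6 are the neighbour \<open>u\<close>,
  the result of the edge search, the sequence at \<open>v\<close>, the depth, \<open>v\<close>, the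
  edges and the functions.\<close>

definition ratio_body :: expr where
  "ratio_body =
     Let_in (Call 9 [Arg 3, Arg 1])
     (Let_in (Call 8 [Arg 2, Arg 3])
        (If_pair (Arg 0)
           (If_pair (Arg 2)
              (Let_in (First (First (Arg 0)))
                 (Call 11 [Arg 2,
                    Call 7 [Second (Arg 3), Arg 4, Second (Arg 1), Arg 6],
                    Call 7 [Second (Arg 3), Arg 4, Second (Arg 1), Call 10 [Arg 6, Arg 0]],
                    Arith Div
                      (Call 7 [Second (Arg 3), Arg 0, Second (Arg 1), Call 10 [Call 10 [Arg 6, Arg 4], Arg 4]])
                      (Second (First (Arg 1)))]))
              Zero_const)
           (Arith Div (First (Arg 1)) (First (Second (Arg 1))))))"

definition find_body :: expr where
  "find_body = If_pair (Arg 1)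
     (Let_in (First (Arg 1))
        (If_pair (Call 12 [First (First (Arg 0)), Arg 1])
           (Mk_pair (Mk_pair (Second (First (Arg 0))) (Second (Arg 0))) (Second (Arg 2)))
           (If_pair (Call 12 [Second (First (Arg 0)), Arg 1])
              (Mk_pair (Mk_pair (First (First (Arg 0))) (Second (Arg 0))) (Second (Arg 2)))
              (Let_in (Call 8 [Arg 1, Second (Arg 2)])
                 (If_pair (Arg 0) (Mk_pair (First (Arg 0)) (Mk_pair (Arg 1) (Second (Arg 0)))) Nil_const)))))
     Nil_const"

definition nth_body :: expr where
  "nth_body = If_less Zero_const (Arg 1)
     (Call 9 [Second (Arg 0), Arith Sub (Arg 1) One_const]) (First (Arg 0))"

definition shift_body :: expr where
  "shift_body = If_less Zero_const (Arg 1)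
     (Mk_pair (First (Arg 0)) (Call 10 [Second (Arg 0), Arith Sub (Arg 1) One_const]))
     (Mk_pair (Second (First (Arg 0))) (Second (Arg 0)))"

text \<open>The arguments are the sequence at \<open>v\<close>, \<open>a\<close>, \<open>b\<close>
  and \<open>x\<close>. The local variables, outermost first, are the parameter \<open>c\<close>,
  the uncapped value, the minimum of \<open>b\<close> and \<open>x\<close>, and the cap.\<close>

definition step_body :: "nat \<Rightarrow> expr" where
  "step_body k =
     Let_in (Arith Div (Arith Sub (First (Second (Second (Arg 0)))) (First (Arg 0))) (First (Second (Arg 0))))
     (Let_in
        (Arith Div
           (Arith Add (Arith Mul (Arg 4) (Arg 2)) (Arith Div (Arith Add (Arg 0) (Arg 2)) (Arith Add (Arg 0) (Arg 3))))
           (Arith Add (Arith Add (Arg 0) (Arg 2)) (Arg 4)))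
     (Let_in (If_less (Arg 4) (Arg 5) (Arg 4) (Arg 5))
     (Let_in
        (If_less (num 2) (Arg 0)
           (Arith Add (num 2) (Arith Mul (Arith Div (num k) (num (k + 1))) (Arith Sub (Arg 0) (num 2))))
           (num 2))
        (If_less (Arg 2) (Arg 0) (Arg 2) (Arg 0)))))"

definition eq_body :: expr where
  "eq_body = If_less (Arg 0) (Arg 1) Nil_const (If_less (Arg 1) (Arg 0) Nil_const (Mk_pair Nil_const Nil_const))"

text \<open>The initial check detects functions that vanish identically, for which 0 is the exact
  answer. Otherwise the argument of \<open>Call 4\<close> is the precision required in
  \<open>approximates_Z_approx\<close>.\<close>

definition main_body :: "nat \<Rightarrow> expr" where
  "main_body k = If_pair (Call 3 [First (Second (Arg 0))])
     (Let_in (Call 1 [First (Second (Second (Arg 0))), Second (Second (Second (Arg 0)))])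
        (Call 5 [Call 4 [Arith Div (First (Arg 1))
             (Arith Mul (Arith Add One_const (First (Arg 1))) (Arith Mul (num (20 * k * k)) (Call 2 [Arg 0])))],
           Arg 0, First (Second (Arg 1))]))
     Zero_const"

definition prog :: "nat \<Rightarrow> algorithm" where
  "prog k = [main_body k, zip_body, len_body, check_body, depth_body k, total_body, heads_body, ratio_body,
     find_body, nth_body, shift_body, step_body k, eq_body]"

lemma prog_nth:
  "prog k ! 0 = main_body k" "prog k ! 1 = zip_body" "prog k ! 2 = len_body" "prog k ! 3 = check_body"
  "prog k ! 4 = depth_body k" "prog k ! 5 = total_body" "prog k ! 6 = heads_body" "prog k ! 7 = ratio_body"
  "prog k ! 8 = find_body" "prog k ! 9 = nth_body" "prog k ! 10 = shift_body" "prog k ! 11 = step_body k"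
  "prog k ! 12 = eq_body" "length (prog k) = 13"
  by (simp_all add: prog_def)

lemma encode_list_simps [simp]:
  "encode_list enc [] = VNil" "encode_list enc (x # xs) = VPair (enc x) (encode_list enc xs)"
  by (simp_all add: encode_list_def)

abbreviation enc_funs :: "real list list \<Rightarrow> real val" where
  "enc_funs \<equiv> encode_list (encode_list VNum)"

abbreviation enc_edges :: "edge list \<Rightarrow> real val" where
  "enc_edges \<equiv> encode_list (\<lambda>(u, v, l). VPair (VPair (VNum (real u)) (VNum (real v))) (VNum l))"

section \<open>Correctness and cost of the program\<close>

text \<open>Common to the real RAM and the bit model. The factor 2 for sums and differences pays for
  the common denominator. The coarse bound on natural numbers suffices, since those that occur are
  vertices, lengths and constants of the program.\<close>

locale cost_model =
  fixes \<kappa> :: "real \<Rightarrow> nat" and N :: "real set" and k :: nat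
  assumes N_nat: "real n \<in> N" and N_op: "x \<in> N \<Longrightarrow> y \<in> N \<Longrightarrow> arith_op op x y \<in> N"
    and k_nat: "\<kappa> (real n) \<le> n + 3"
    and k_mult: "x \<in> N \<Longrightarrow> y \<in> N \<Longrightarrow> \<kappa> (x * y) \<le> \<kappa> x + \<kappa> y"
    and k_div: "x \<in> N \<Longrightarrow> y \<in> N \<Longrightarrow> \<kappa> (x / y) \<le> \<kappa> x + \<kappa> y"
    and k_add: "x \<in> N \<Longrightarrow> y \<in> N \<Longrightarrow> \<kappa> (x + y) \<le> 2 * (\<kappa> x + \<kappa> y)"
    and k_sub: "x \<in> N \<Longrightarrow> y \<in> N \<Longrightarrow> \<kappa> (x - y) \<le> 2 * (\<kappa> x + \<kappa> y)"
begin

text \<open>Time is only bounded from above, so that exact costs need not be tracked.\<close>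

definition ev :: "real val list \<Rightarrow> expr \<Rightarrow> real val \<Rightarrow> nat \<Rightarrow> bool" where
  "ev env e v T \<longleftrightarrow> (\<exists>t\<le>T. eval \<kappa> (prog k) env e v t)"

definition evs :: "real val list \<Rightarrow> expr list \<Rightarrow> real val list \<Rightarrow> nat \<Rightarrow> bool" where
  "evs env es vs T \<longleftrightarrow> (\<exists>t\<le>T. Defs.evals \<kappa> (prog k) env es vs t)"

lemma ev_mono: "ev env e v T \<Longrightarrow> T \<le> T' \<Longrightarrow> ev env e v T'"
  unfolding ev_def by (meson order_trans)

lemma ev_Arg: "i < length env \<Longrightarrow> ev env (Arg i) (env ! i) 1"
  unfolding ev_def by (blast intro: eval_evals.Arg)

lemma ev_Args:
  "ev (a # env) (Arg 0) a 1"
  "ev (a # b # env) (Arg 1) b 1"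
  "ev (a # b # c # env) (Arg 2) c 1"
  "ev (a # b # c # d # env) (Arg 3) d 1"
  "ev (a # b # c # d # e # env) (Arg 4) e 1"
  "ev (a # b # c # d # e # f # env) (Arg 5) f 1"
  "ev (a # b # c # d # e # f # g # env) (Arg 6) g 1"
  using ev_Arg[of 0 "a # env"] ev_Arg[of 1 "a # b # env"] ev_Arg[of 2 "a # b # c # env"]
    ev_Arg[of 3 "a # b # c # d # env"] ev_Arg[of 4 "a # b # c # d # e # env"]
    ev_Arg[of 5 "a # b # c # d # e # f # env"] ev_Arg[of 6 "a # b # c # d # e # f # g # env"]
  by simp_all

lemma ev_consts: "ev env Nil_const VNil 1" "ev env Zero_const (VNum 0) 1" "ev env One_const (VNum 1) 1"
  unfolding ev_def by (blast intro: eval_evals.intros)+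

lemma ev_Arith:
  "ev env a (VNum x) S \<Longrightarrow> ev env b (VNum y) T \<Longrightarrow> op = Div \<longrightarrow> y \<noteq> 0 \<Longrightarrow>
     ev env (Arith op a b) (VNum (arith_op op x y)) (1 + S + T + \<kappa> x + \<kappa> y)"
  unfolding ev_def by (elim exE conjE) (rule exI, rule conjI[rotated], rule eval_evals.Arith, assumption+, simp)

lemma ev_Add: "ev env a (VNum x) S \<Longrightarrow> ev env b (VNum y) T \<Longrightarrow>
     ev env (Arith Add a b) (VNum (x + y)) (1 + S + T + \<kappa> x + \<kappa> y)"
  using ev_Arith[of env a x S b y T Add] by simp

lemma ev_Sub: "ev env a (VNum x) S \<Longrightarrow> ev env b (VNum y) T \<Longrightarrow>
     ev env (Arith Sub a b) (VNum (x - y)) (1 + S + T + \<kappa> x + \<kappa> y)"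
  using ev_Arith[of env a x S b y T Sub] by simp

lemma ev_Mul: "ev env a (VNum x) S \<Longrightarrow> ev env b (VNum y) T \<Longrightarrow>
     ev env (Arith Mul a b) (VNum (x * y)) (1 + S + T + \<kappa> x + \<kappa> y)"
  using ev_Arith[of env a x S b y T Mul] by simp

lemma ev_Div: "ev env a (VNum x) S \<Longrightarrow> ev env b (VNum y) T \<Longrightarrow> y \<noteq> 0 \<Longrightarrow>
     ev env (Arith Div a b) (VNum (x / y)) (1 + S + T + \<kappa> x + \<kappa> y)"
  using ev_Arith[of env a x S b y T Div] by simp

lemma ev_Mk_pair: "ev env a v S \<Longrightarrow> ev env b w T \<Longrightarrow> ev env (Mk_pair a b) (VPair v w) (1 + S + T)"
  unfolding ev_def by (elim exE conjE) (rule exI, rule conjI[rotated], rule eval_evals.Mk_pair, assumption+, simp)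

lemma ev_First: "ev env a (VPair v w) S \<Longrightarrow> ev env (First a) v (1 + S)"
  unfolding ev_def by (elim exE conjE) (rule exI, rule conjI[rotated], rule eval_evals.First, assumption+, simp)

lemma ev_Second: "ev env a (VPair v w) S \<Longrightarrow> ev env (Second a) w (1 + S)"
  unfolding ev_def by (elim exE conjE) (rule exI, rule conjI[rotated], rule eval_evals.Second, assumption+, simp)

lemma ev_Let_in: "ev env a v S \<Longrightarrow> ev (v # env) b w T \<Longrightarrow> ev env (Let_in a b) w (1 + S + T)"
  unfolding ev_def by (elim exE conjE) (rule exI, rule conjI[rotated], rule eval_evals.Let_in, assumption+, simp)

lemma ev_If_pair:
  assumes "ev env a (VPair p q) S" "ev env b w T"
  shows "ev env (If_pair a b c) w (1 + S + T)"
proof -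
  obtain s t where st: "s \<le> S" "eval \<kappa> (prog k) env a (VPair p q) s" "t \<le> T" "eval \<kappa> (prog k) env b w t"
    using assms unfolding ev_def by blast
  have "eval \<kappa> (prog k) env (If_pair a b c) w (1 + s + t)"
    by (rule eval_evals.If_pair[OF st(2)]) (simp add: st(4))
  then show ?thesis using st unfolding ev_def by (intro exI[of _ "1 + s + t"]) simp
qed

lemma ev_If_nil:
  assumes "ev env a VNil S" "ev env c w T"
  shows "ev env (If_pair a b c) w (1 + S + T)"
proof -
  obtain s t where st: "s \<le> S" "eval \<kappa> (prog k) env a VNil s" "t \<le> T" "eval \<kappa> (prog k) env c w t"
    using assms unfolding ev_def by blast
  have "eval \<kappa> (prog k) env (If_pair a b c) w (1 + s + t)"
    by (rule eval_evals.If_pair[OF st(2)]) (simp add: st(4))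
  then show ?thesis using st unfolding ev_def by (intro exI[of _ "1 + s + t"]) simp
qed

lemma ev_If_less_cases:
  assumes "ev env a (VNum x) U" "ev env b (VNum y) S" "ev env (if x < y then c else d) w T"
  shows "ev env (If_less a b c d) w (1 + U + S + T + \<kappa> x + \<kappa> y)"
proof -
  obtain r s t where st: "r \<le> U" "eval \<kappa> (prog k) env a (VNum x) r" "s \<le> S" "eval \<kappa> (prog k) env b (VNum y) s"
    "t \<le> T" "eval \<kappa> (prog k) env (if x < y then c else d) w t"
    using assms unfolding ev_def by blast
  have "eval \<kappa> (prog k) env (If_less a b c d) w (1 + r + s + t + \<kappa> x + \<kappa> y)"
    by (rule eval_evals.If_less[OF st(2,4,6)])
  then show ?thesis using st unfolding ev_def by (intro exI[of _ "1 + r + s + t + \<kappa> x + \<kappa> y"]) simp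
qed

lemma ev_If_less: "ev env a (VNum x) U \<Longrightarrow> ev env b (VNum y) S \<Longrightarrow> x < y \<Longrightarrow> ev env c w T \<Longrightarrow>
    ev env (If_less a b c d) w (1 + U + S + T + \<kappa> x + \<kappa> y)"
  by (rule ev_If_less_cases) simp_all

lemma ev_If_not_less: "ev env a (VNum x) U \<Longrightarrow> ev env b (VNum y) S \<Longrightarrow> \<not> x < y \<Longrightarrow> ev env d w T \<Longrightarrow>
    ev env (If_less a b c d) w (1 + U + S + T + \<kappa> x + \<kappa> y)"
  by (rule ev_If_less_cases) simp_all

text \<open>The bound pays for both branches, which avoids a case distinction on the
  comparison.\<close>

lemma ev_If_num: 
  assumes "ev env a (VNum x) U" "ev env b (VNum y) S" "ev env c (VNum v) T" "ev env d (VNum w) T'"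
  shows "ev env (If_less a b c d) (VNum (if x < y then v else w)) (1 + U + S + (T + T') + \<kappa> x + \<kappa> y)"
proof (cases "x < y")
  case True
  then show ?thesis using ev_If_less[OF assms(1,2) True assms(3), of d] by (auto elim: ev_mono)
next
  case False
  then show ?thesis using ev_If_not_less[OF assms(1,2) False assms(4), of c] by (auto elim: ev_mono)
qed

lemma ev_Call: "evs env es vs S \<Longrightarrow> ev vs (prog k ! f) w T \<Longrightarrow> f < 13 \<Longrightarrow> ev env (Call f es) w (1 + S + T)"
  unfolding ev_def evs_def
  by (elim exE conjE) (rule exI, rule conjI[rotated], rule eval_evals.Call, simp add: prog_nth, assumption+, simp)

lemma evs_Nil: "evs env [] [] 0"
  unfolding evs_def by (blast intro: eval_evals.Nil_args)

lemma evs_Cons: "ev env e v S \<Longrightarrow> evs env es vs T \<Longrightarrow> evs env (e # es) (v # vs) (S + T)"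
  unfolding ev_def evs_def
  by (elim exE conjE) (rule exI, rule conjI[rotated], rule eval_evals.Cons_args, assumption+, simp)

lemmas ev_det = ev_Args ev_consts ev_Add ev_Sub ev_Mul ev_Div ev_Mk_pair ev_First ev_Second ev_Let_in evs_Nil evs_Cons

lemma k01: "\<kappa> 0 \<le> 3" "\<kappa> 1 \<le> 4" "0 \<in> N" "1 \<in> N"
  using k_nat[of 0] k_nat[of 1] N_nat[of 0] N_nat[of 1] by simp_all

lemma ev_num: "ev env (num n) (VNum (real n)) ((n + 1) * (n + 20))"
proof (induction n)
  case 0
  show ?case using ev_mono[OF ev_consts(2), of 20 env] by simp
next
  case (Suc n)
  have "ev env (num (Suc n)) (VNum (1 + real n)) (1 + 1 + (n + 1) * (n + 20) + \<kappa> 1 + \<kappa> (real n))"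
    unfolding num.simps by (rule ev_Add[OF ev_consts(3) Suc])
  then show ?case using k01(2) k_nat[of n] by (auto elim!: ev_mono simp: algebra_simps)
qed

section \<open>Cost of the list operations\<close>

lemma eq_ev:
  assumes "i \<le> M" "j \<le> M"
  shows "ev [VNum (real i), VNum (real j)] (prog k ! 12) (if i = j then VPair VNil VNil else VNil) (30 + 4 * M)"
proof -
  note b = k_nat[of i] k_nat[of j]
  consider "i < j" | "j < i" | "i = j" by linarith
  then show ?thesis
  proof cases
    case 1
    show ?thesis unfolding prog_nth eq_body_def
      by (rule ev_mono, rule ev_If_less, (rule ev_det)+) (use 1 assms b in \<open>auto intro: ev_consts\<close>)
  next
    case 2
    show ?thesis unfolding prog_nth eq_body_def
      by (rule ev_mono, rule ev_If_not_less, (rule ev_det)+, use 2 in simp, rule ev_If_less, (rule ev_det)+)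
        (use 2 assms b in \<open>auto intro: ev_consts\<close>)
  next
    case 3
    show ?thesis unfolding 3 if_P[OF refl] prog_nth eq_body_def
      by (rule ev_mono, rule ev_If_not_less, (rule ev_det)+, simp, rule ev_If_not_less, (rule ev_det)+, simp, (rule ev_det)+)
        (use 3 assms b in auto)
  qed
qed

text \<open>Covers the work on one list cell when all vertex numbers are at most
  \<open>M\<close>.\<close>

definition scan_cost :: "nat \<Rightarrow> nat" where "scan_cost M = 200 + 20 * M"

lemma nth_ev:
  "i < length xs \<Longrightarrow> i \<le> M \<Longrightarrow> ev [encode_list enc xs, VNum (real i)] (prog k ! 9) (enc (xs ! i)) ((i + 1) * scan_cost M)"
proof (induction xs arbitrary: i)
  case (Cons x xs)
  show ?case
  proof (cases i)
    case 0
    show ?thesis unfolding prog_nth nth_body_def 0 encode_list_simps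
      apply (rule ev_mono)
       apply (rule ev_If_not_less, (rule ev_det)+)
        apply simp
       apply simp
       apply (rule ev_det)+
      using k01 by (auto simp: scan_cost_def)
  next
    case (Suc j)
    have "ev [encode_list enc xs, VNum (real j)] (prog k ! 9) (enc (xs ! j)) ((j + 1) * scan_cost M)"
      using Cons Suc by simp
    then have IH: "ev [encode_list enc xs, VNum (real (Suc j) - 1)] (prog k ! 9) (enc (xs ! j)) ((j + 1) * scan_cost M)" by simp
    show ?thesis unfolding Suc prog_nth(10)[of k] nth_body_def encode_list_simps nth_Cons_Suc
      apply (rule ev_mono)
       apply (rule ev_If_less, (rule ev_det)+)
        apply simp
       apply (rule ev_Call, (rule ev_det)+, rule IH, simp)
      using k01 k_nat[of "Suc j"] Cons.prems Suc by (auto simp: scan_cost_def algebra_simps)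
  qed
qed simp

lemma shift_ev:
  "i < length fs \<Longrightarrow> i \<le> M \<Longrightarrow> fs ! i \<noteq> [] \<Longrightarrow>
    ev [enc_funs fs, VNum (real i)] (prog k ! 10) (enc_funs (fs[i := tl (fs ! i)])) ((i + 1) * scan_cost M)"
proof (induction fs arbitrary: i)
  case (Cons f fs)
  show ?case
  proof (cases i)
    case 0
    obtain y ys where f: "f = y # ys" using Cons.prems 0 by (cases f) auto
    show ?thesis unfolding prog_nth shift_body_def 0 encode_list_simps f nth_Cons_0 list_update_code list.sel
      apply (rule ev_mono)
       apply (rule ev_If_not_less, (rule ev_det)+)
        apply simp
       apply simp
       apply (rule ev_det)+
      using k01 by (auto simp: scan_cost_def)
  next
    case (Suc j)
    have "ev [enc_funs fs, VNum (real j)] (prog k ! 10) (enc_funs (fs[j := tl (fs ! j)])) ((j + 1) * scan_cost M)"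
      using Cons Suc by simp
    then have IH: "ev [enc_funs fs, VNum (real (Suc j) - 1)] (prog k ! 10) (enc_funs (fs[j := tl (fs ! j)])) ((j + 1) * scan_cost M)" by simp
    show ?thesis unfolding Suc prog_nth(11)[of k] shift_body_def encode_list_simps nth_Cons_Suc list_update_code
      apply (rule ev_mono)
       apply (rule ev_If_less, (rule ev_det)+)
        apply simp
       apply (rule ev_Mk_pair, (rule ev_det)+)
       apply (rule ev_Call, (rule ev_det)+, rule IH, simp)
      using k01 k_nat[of "Suc j"] Cons.prems Suc by (auto simp: scan_cost_def algebra_simps)
  qed
qed simp

definition enc_found :: "((nat \<times> real) \<times> edge list) option \<Rightarrow> real val" where
  "enc_found r = (case r of None \<Rightarrow> VNil
     | Some ((u, l), rest) \<Rightarrow> VPair (VPair (VNum (real u)) (VNum l)) (enc_edges rest))"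

definition ids_le :: "nat \<Rightarrow> edge list \<Rightarrow> bool" where
  "ids_le M es \<longleftrightarrow> (\<forall>(u, v, l) \<in> set es. u \<le> M \<and> v \<le> M)"

lemma find_ev:
  "v \<le> M \<Longrightarrow> ids_le M es \<Longrightarrow>
    ev [VNum (real v), enc_edges es] (prog k ! 8) (enc_found (find_edge v es)) ((length es + 1) * scan_cost M)"
proof (induction es)
  case Nil
  show ?case unfolding prog_nth find_body_def encode_list_simps
    apply (rule ev_mono)
     apply (rule ev_If_nil, (rule ev_det)+)
     apply (simp add: enc_found_def)
     apply (rule ev_det)+
    by (simp add: scan_cost_def)
next
  case (Cons e es)
  obtain a b l where e: "e = (a, b, l)" by (cases e)
  have ab: "a \<le> M" "b \<le> M" "ids_le M es" using Cons.prems by (auto simp: ids_le_def e)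
  note eqa = eq_ev[OF ab(1) Cons.prems(1)] and eqb = eq_ev[OF ab(2) Cons.prems(1)]
  note IH = Cons.IH[OF Cons.prems(1) ab(3)]
  show ?case
  proof (cases "a = v")
    case True
    have eqa': "ev [VNum (real a), VNum (real v)] (prog k ! 12) (VPair VNil VNil) (30 + 4 * M)"
      using eqa True by simp
    have res: "enc_found (find_edge v (e # es)) = VPair (VPair (VNum (real b)) (VNum l)) (enc_edges es)"
      using True by (simp add: e enc_found_def)
    show ?thesis unfolding prog_nth(9)[of k] find_body_def encode_list_simps res unfolding e prod.case
      apply (rule ev_mono)
       apply (rule ev_If_pair, (rule ev_det)+)
       apply (rule ev_If_pair, rule ev_Call, (rule ev_det)+, rule eqa', simp)
       apply (rule ev_det)+
      by (simp add: scan_cost_def)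
  next
    case False
    have eqa': "ev [VNum (real a), VNum (real v)] (prog k ! 12) VNil (30 + 4 * M)"
      using eqa False by simp
    show ?thesis
    proof (cases "b = v")
      case True
      have eqb': "ev [VNum (real b), VNum (real v)] (prog k ! 12) (VPair VNil VNil) (30 + 4 * M)"
        using eqb True by simp
      have res: "enc_found (find_edge v (e # es)) = VPair (VPair (VNum (real a)) (VNum l)) (enc_edges es)"
        using True False by (simp add: e enc_found_def)
      show ?thesis unfolding prog_nth(9)[of k] find_body_def encode_list_simps res unfolding e prod.case
        apply (rule ev_mono)
         apply (rule ev_If_pair, (rule ev_det)+)
         apply (rule ev_If_nil, rule ev_Call, (rule ev_det)+, rule eqa', simp)
         apply (rule ev_If_pair, rule ev_Call, (rule ev_det)+, rule eqb', simp)
         apply (rule ev_det)+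
        by (simp add: scan_cost_def)
    next
      case b: False
      have eqb': "ev [VNum (real b), VNum (real v)] (prog k ! 12) VNil (30 + 4 * M)"
        using eqb b by simp
      show ?thesis
      proof (cases "find_edge v es")
        case None
        have IH': "ev [VNum (real v), enc_edges es] (prog k ! 8) VNil ((length es + 1) * scan_cost M)"
          using IH None by (simp add: enc_found_def)
        have res: "enc_found (find_edge v (e # es)) = VNil"
          using b False None by (simp add: e enc_found_def)
        show ?thesis unfolding prog_nth(9)[of k] find_body_def encode_list_simps res unfolding e prod.case
          apply (rule ev_mono)
           apply (rule ev_If_pair, (rule ev_det)+)
           apply (rule ev_If_nil, rule ev_Call, (rule ev_det)+, rule eqa', simp)
           apply (rule ev_If_nil, rule ev_Call, (rule ev_det)+, rule eqb', simp)
           apply (rule ev_Let_in, rule ev_Call, (rule ev_det)+, rule IH', simp)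
           apply (rule ev_If_nil, (rule ev_det)+)
          by (simp add: scan_cost_def)
      next
        case (Some r)
        obtain u w rest where r: "r = ((u, w), rest)" by (cases r) auto
        have IH': "ev [VNum (real v), enc_edges es] (prog k ! 8) (VPair (VPair (VNum (real u)) (VNum w)) (enc_edges rest)) ((length es + 1) * scan_cost M)"
          using IH Some by (simp add: enc_found_def r)
        have res: "enc_found (find_edge v (e # es)) = VPair (VPair (VNum (real u)) (VNum w))
            (VPair (VPair (VPair (VNum (real a)) (VNum (real b))) (VNum l)) (enc_edges rest))"
          using b False Some by (simp add: e enc_found_def r)
        show ?thesis unfolding prog_nth(9)[of k] find_body_def encode_list_simps res unfolding e prod.case
          apply (rule ev_mono)
           apply (rule ev_If_pair, (rule ev_det)+)
           apply (rule ev_If_nil, rule ev_Call, (rule ev_det)+, rule eqa', simp)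
           apply (rule ev_If_nil, rule ev_Call, (rule ev_det)+, rule eqb', simp)
           apply (rule ev_Let_in, rule ev_Call, (rule ev_det)+, rule IH', simp)
           apply (rule ev_If_pair, (rule ev_det)+)
          by (simp add: scan_cost_def)
      qed
    qed
  qed
qed

lemma op_le:
  assumes "x \<in> N" "y \<in> N" "\<kappa> x \<le> m" "\<kappa> y \<le> n"
  shows "x + y \<in> N" "\<kappa> (x + y) \<le> 2 * (m + n)" "x - y \<in> N" "\<kappa> (x - y) \<le> 2 * (m + n)"
    "x * y \<in> N" "\<kappa> (x * y) \<le> m + n" "x / y \<in> N" "\<kappa> (x / y) \<le> m + n"
  using N_op[OF assms(1,2), of Add] N_op[OF assms(1,2), of Sub] N_op[OF assms(1,2), of Mul] N_op[OF assms(1,2), of Div]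
    k_add[OF assms(1,2)] k_sub[OF assms(1,2)] k_mult[OF assms(1,2)] k_div[OF assms(1,2)] assms(3,4)
  by auto

definition step_cost :: nat where "step_cost = 5000 + 500 * k * k"

text \<open>One application enlarges the sizes of the numbers by at most a constant factor. Over a
  recursion of depth L the growth is exponential in L, which is affordable because L is
  logarithmic.\<close>

lemma step_ev:
  assumes num: "{f0, f1, f2, a, b, x} \<subseteq> N" "\<kappa> f0 \<le> s" "\<kappa> f1 \<le> s" "\<kappa> f2 \<le> s" "\<kappa> a \<le> s" "\<kappa> b \<le> s" "\<kappa> x \<le> s"
    and nz: "f1 \<noteq> 0" "(f2 - f0) / f1 + b \<noteq> 0" "(f2 - f0) / f1 + a + x \<noteq> 0"
  defines "r \<equiv> capped_step (real k) ((f2 - f0) / f1) a b x"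
  shows "ev [VPair (VNum f0) (VPair (VNum f1) (VPair (VNum f2) fr)), VNum a, VNum b, VNum x] (prog k ! 11) (VNum r) (step_cost * (s + 1))
     \<and> r \<in> N \<and> \<kappa> r \<le> step_cost * (s + 1)"
proof -
  define c where "c = (f2 - f0) / f1"
  have in_N: "f0 \<in> N" "f1 \<in> N" "f2 \<in> N" "a \<in> N" "b \<in> N" "x \<in> N" using num by auto
  note o1 = op_le[OF in_N(3,1) num(4,2)]
  have c: "c \<in> N" "\<kappa> c \<le> 5 * s" using op_le(7,8)[OF o1(3) in_N(2) o1(4) num(3)] by (auto simp: c_def)
  note xa = op_le[OF in_N(6,4) num(7,5)]
  note ca = op_le[OF c(1) in_N(4) c(2) num(5)]
  note cb = op_le[OF c(1) in_N(5) c(2) num(6)]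
  note q = op_le[OF ca(1) cb(1) ca(2) cb(2)]
  note n1 = op_le[OF xa(5) q(7) xa(6) q(8)]
  note d1 = op_le[OF ca(1) in_N(6) ca(2) num(7)]
  define V where "V = (x * a + (c + a) / (c + b)) / (c + a + x)"
  have V: "V \<in> N" "\<kappa> V \<le> 100 * s" using op_le(7,8)[OF n1(1) d1(1) n1(2) d1(2)] by (auto simp: V_def)
  define mn where "mn = (if b < x then b else x)"
  have mn: "mn \<in> N" "\<kappa> mn \<le> s" using in_N num by (auto simp: mn_def)
  note kk = k_nat[of k] k_nat[of "k + 1"] k_nat[of 2]
  note w1 = op_le[OF N_nat[of k] N_nat[of "k + 1"] kk(1,2)]
  note w2 = op_le[OF mn(1) N_nat[of 2] mn(2) kk(3)]
  note w3 = op_le[OF w1(7) w2(3) w1(8) w2(4)]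
  note w4 = op_le[OF N_nat[of 2] w3(5) kk(3) w3(6)]
  define Uv where "Uv = (if real 2 < mn then real 2 + real k / real (k + 1) * (mn - real 2) else real 2)"
  have U: "Uv \<in> N" "\<kappa> Uv \<le> 4 * s + 4 * k + 60"
    using w4(1,2) N_nat[of 2] kk(3) by (auto simp: Uv_def)
  have r: "r = (if V < Uv then V else Uv)"
  proof -
    have "step c a b x = V" by (simp add: step_def V_def)
    moreover have "mn = min b x" by (auto simp: mn_def)
    then have "cap (real k) b x = Uv" by (auto simp: cap_def Uv_def max_def add.commute)
    ultimately show ?thesis by (auto simp: r_def c_def[symmetric] capped_step_def)
  qed
  have k2: "k \<le> k * k" by (cases k) auto
  define J' where "J' = step_cost * (s + 1)"
  have J: "5000 * s + 5000 + 500 * (k * k) \<le> J'" by (simp add: J'_def step_cost_def algebra_simps)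
  have "\<kappa> V \<le> J'" using V(2) k2 J by linarith
  moreover have "\<kappa> Uv \<le> J'" using U(2) k2 J by linarith
  ultimately have "\<kappa> V \<le> step_cost * (s + 1)" "\<kappa> Uv \<le> step_cost * (s + 1)" by (simp_all add: J'_def)
  then have rN: "r \<in> N" "\<kappa> r \<le> step_cost * (s + 1)" using V U by (auto simp: r)
  have bs: "\<kappa> (f2 - f0) \<le> 4 * s" "\<kappa> (x * a) \<le> 2 * s" "\<kappa> (c + a) \<le> 12 * s" "\<kappa> (c + b) \<le> 12 * s"
    "\<kappa> ((c + a) / (c + b)) \<le> 24 * s" "\<kappa> (x * a + (c + a) / (c + b)) \<le> 52 * s" "\<kappa> (c + a + x) \<le> 26 * s"
    "\<kappa> (real k / real (k + 1)) \<le> 2 * k + 7" "\<kappa> (mn - real 2) \<le> 2 * s + 10"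
    "\<kappa> (real k / real (k + 1) * (mn - real 2)) \<le> 2 * k + 2 * s + 17"
    subgoal using o1(4) by simp
    subgoal using xa(6) by simp
    subgoal using ca(2) by simp
    subgoal using cb(2) by simp
    subgoal using q(8) by simp
    subgoal using n1(2) by simp
    subgoal using d1(2) by simp
    subgoal using w1(8) by simp
    subgoal using w2(4) by simp
    subgoal using w3(6) by simp
    done
  have e1: "(k + 1) * (k + 20) = k * k + 21 * k + 20" "(k + 1 + 1) * (k + 1 + 20) = k * k + 23 * k + 42"
    "(2 + 1) * (2 + 20) = (66 :: nat)" by (simp_all add: algebra_simps)
  have "ev [VPair (VNum f0) (VPair (VNum f1) (VPair (VNum f2) fr)), VNum a, VNum b, VNum x] (prog k ! 11)
     (VNum (if V < Uv then V else Uv)) J'"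
    unfolding prog_nth step_body_def
    apply (rule ev_mono)
     apply (rule ev_Let_in)
      apply (rule ev_Div, (rule ev_det)+)
      apply (rule nz(1))
     apply (rule ev_Let_in)
      apply (rule ev_Div)
        apply (rule ev_Add, (rule ev_det)+)
        apply (rule nz(2))
       apply (rule ev_det)+
      apply (rule nz(3))
     apply (rule ev_Let_in)
      apply (rule ev_If_num, (rule ev_det)+)
      apply (rule ev_If_num)
         apply (rule ev_num)
        apply (rule ev_det)
       apply (rule ev_Add, rule ev_num, rule ev_Mul, rule ev_Div, rule ev_num, rule ev_num)
         apply simp
        apply (rule ev_Sub, rule ev_det, rule ev_num)
      apply (rule ev_num)
     apply (unfold c_def[symmetric])
     apply (unfold V_def[symmetric] mn_def[symmetric])
     apply (unfold Uv_def[symmetric])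
     apply (rule ev_If_num, (rule ev_det)+)
    unfolding e1
    using num(2-) c(2) V(2) mn(2) kk bs U(2) k2 J
    by linarith
  then show ?thesis using rN by (simp add: r J'_def)
qed

end

section \<open>Cost of the recursion for ratios and of the product\<close>

fun ulist :: "nat \<Rightarrow> real val" where
  "ulist 0 = VNil"
| "ulist (Suc n) = VPair VNil (ulist n)"

definition deg :: "edge list \<Rightarrow> nat \<Rightarrow> nat" where
  "deg es w = length (filter (\<lambda>(a, b, l). a = w \<or> b = w) es)"

lemma deg_Cons: "deg ((u, v, l) # es) w = deg es w + of_bool (w = u \<or> w = v)"
  by (auto simp: deg_def)

lemma find_edge_mem:
  assumes "find_edge v es = Some ((u, l), rest)"
  shows "deg es w = deg rest w + of_bool (w = u \<or> w = v)" "set rest \<subseteq> set es" "(v, u, l) \<in> set es \<or> (u, v, l) \<in> set es"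
proof -
  have "deg es w = deg rest w + of_bool (w = u \<or> w = v) \<and> set rest \<subseteq> set es \<and> ((v, u, l) \<in> set es \<or> (u, v, l) \<in> set es)"
    using assms
  proof (induction v es arbitrary: rest rule: find_edge.induct)
    case (2 v a b m es)
    consider "a = v" | "a \<noteq> v" "b = v" | "a \<noteq> v" "b \<noteq> v" by blast
    then show ?case
    proof cases
      case 3
      then obtain r where r: "find_edge v es = Some ((u, l), r)" "rest = (a, b, m) # r"
        using "2.prems" by auto
      show ?thesis using "2.IH"[OF 3 r(1)] by (auto simp: r(2) deg_Cons)
    qed (use "2.prems" in \<open>auto simp: deg_Cons\<close>)
  qed simp
  then show "deg es w = deg rest w + of_bool (w = u \<or> w = v)" "set rest \<subseteq> set es" "(v, u, l) \<in> set es \<or> (u, v, l) \<in> set es"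
    by auto
qed

context cost_model
begin

text \<open>The lists \<open>fs\<close> represent \<open>\<phi>\<close> and are long enough for the remaining edges \<open>es\<close> and \<open>ext w\<close> further
  half-edges at \<open>w\<close>.\<close>

definition invariant :: "nat \<Rightarrow> edge list \<Rightarrow> real list list \<Rightarrow> state \<Rightarrow> (nat \<Rightarrow> nat) \<Rightarrow> bool" where
  "invariant M es fs \<phi> ext \<longleftrightarrow> length fs \<le> M \<and> length es \<le> M \<and> verts es \<subseteq> {..<length fs} \<and> weights_ok es \<and>
     (\<forall>(u, v, l) \<in> set es. l \<in> N \<and> \<kappa> l \<le> M) \<and> (\<forall>f\<in>set fs. \<forall>x\<in>set f. x \<in> N \<and> \<kappa> x \<le> M) \<and>
     good_state (real k) \<phi> \<and>
     (\<forall>w<length fs. (\<forall>i<length (fs ! w). fs ! w ! i = \<phi> w i) \<and> deg es w + 1 + ext w \<le> length (fs ! w))"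

lemma invariant_mono: "invariant M es fs \<phi> ext \<Longrightarrow> (\<And>w. ext' w \<le> ext w) \<Longrightarrow> invariant M es fs \<phi> ext'"
  unfolding invariant_def by (meson add_left_mono order_trans)

text \<open>A shift consumes one entry of the list at \<open>u\<close>, which is taken from the
  reserve \<open>ext u\<close>.\<close>

lemma invariant_shift:
  assumes i: "invariant M es fs \<phi> ext" and k: "k \<ge> 1" and e: "\<And>w. w \<noteq> u \<Longrightarrow> ext' w \<le> ext w" "ext' u + 1 \<le> ext u"
  shows "invariant M es (fs[u := tl (fs ! u)]) (shift u \<phi>) ext'"
proof -
  have g: "good_state (real k) (shift u \<phi>)" using i k by (intro good_state_shift) (auto simp: invariant_def)
  have s: "f \<in> set fs \<or> (u < length fs \<and> f = tl (fs ! u))" if "f \<in> set (fs[u := tl (fs ! u)])" for f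
    using that set_update_subset_insert[of fs u "tl (fs ! u)"] by (cases "u < length fs") (auto simp: list_update_beyond)
  have t: "x \<in> N \<and> \<kappa> x \<le> M" if "f \<in> set (fs[u := tl (fs ! u)])" "x \<in> set f" for f x
    using s[OF that(1)]
  proof
    assume "f \<in> set fs"
    then show ?thesis using i that(2) by (simp add: invariant_def)
  next
    assume u: "u < length fs \<and> f = tl (fs ! u)"
    then have "x \<in> set (fs ! u)" using that(2) by (cases "fs ! u") auto
    moreover have "fs ! u \<in> set fs" using u by simp
    ultimately show ?thesis using i by (simp add: invariant_def)
  qed
  have w: "(\<forall>i<length (fs[u := tl (fs ! u)] ! w). fs[u := tl (fs ! u)] ! w ! i = shift u \<phi> w i) \<and>
      deg es w + 1 + ext' w \<le> length (fs[u := tl (fs ! u)] ! w)" if "w < length fs" for w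
  proof (cases "w = u")
    case True
    have "deg es u + 1 + ext u \<le> length (fs ! u)" "\<forall>i<length (fs ! u). fs ! u ! i = \<phi> u i"
      using i that True by (auto simp: invariant_def)
    then show ?thesis using True that e(2) by (auto simp: shift_apply nth_tl)
  next
    case False
    have "deg es w + 1 + ext w \<le> length (fs ! w)" "\<forall>i<length (fs ! w). fs ! w ! i = \<phi> w i"
      using i that by (auto simp: invariant_def)
    then show ?thesis using False e(1)[of w] by (auto simp: shift_apply)
  qed
  show ?thesis using i g t w unfolding invariant_def by auto
qed

lemma invariant_find:
  assumes i: "invariant M es fs \<phi> ext" and f: "find_edge v es = Some ((u, l), rest)"
  shows "invariant M rest fs \<phi> (\<lambda>w. ext w + of_bool (w = u \<or> w = v))" "l \<in> N" "\<kappa> l \<le> M" "u < length fs"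
proof -
  note F = find_edge_Some(2-4)[OF f] find_edge_mem[OF f]
  show "invariant M rest fs \<phi> (\<lambda>w. ext w + of_bool (w = u \<or> w = v))"
    using i F(1,2,3,5) unfolding invariant_def F(4) by (auto simp: algebra_simps)
  show "l \<in> N" "\<kappa> l \<le> M" "u < length fs" using i F(1,6) by (auto simp: invariant_def)
qed

definition visit_cost :: "nat \<Rightarrow> nat" where "visit_cost M = 5 * ((M + 1) * scan_cost M) + step_cost * (M + 1) + 5 * M + 101"

text \<open>Bounds the running time and also the size of the result. The 4 counts the three
  recursive calls and the size of the numerator in the division by the edge weight.\<close>

fun ratio_cost :: "nat \<Rightarrow> nat \<Rightarrow> nat" where
  "ratio_cost M 0 = visit_cost M"
| "ratio_cost M (Suc L) = (step_cost + 4) * ratio_cost M L + visit_cost M"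

lemma ids: "invariant M es fs \<phi> ext \<Longrightarrow> ids_le M es"
  unfolding invariant_def ids_le_def verts_def by fastforce

lemma visit_cost_le: "visit_cost M \<le> ratio_cost M L"
  by (cases L) auto

lemma ratio_ev:
  assumes k: "k \<ge> 1"
  shows "invariant M es fs \<phi> (\<lambda>w. of_bool (w = v)) \<Longrightarrow> v < length fs \<Longrightarrow>
    ev [ulist L, VNum (real v), enc_edges es, enc_funs fs] (prog k ! 7) (VNum (ratio_approx (real k) L v es \<phi>)) (ratio_cost M L)
    \<and> ratio_approx (real k) L v es \<phi> \<in> N \<and> \<kappa> (ratio_approx (real k) L v es \<phi>) \<le> ratio_cost M L"
proof (induction L arbitrary: v es fs \<phi>)
  have base: "ev [Lv, VNum (real v), enc_edges es, enc_funs fs] (prog k ! 7) (VNum (\<phi> v 0 / \<phi> v 1)) (visit_cost M)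
      \<and> \<phi> v 0 / \<phi> v 1 \<in> N \<and> \<kappa> (\<phi> v 0 / \<phi> v 1) \<le> visit_cost M"
    if i: "invariant M es fs \<phi> (\<lambda>w. of_bool (w = v))" and v: "v < length fs" and n: "find_edge v es = None"
    for v es fs \<phi> Lv
  proof -
    have vM: "v \<le> M" "length es \<le> M" using i v by (auto simp: invariant_def)
    have "deg es v + 1 + 1 \<le> length (fs ! v)" using i v by (auto simp: invariant_def)
    then obtain f0 f1 fr where f: "fs ! v = f0 # f1 # fr"
      by (metis Suc_le_length_iff add_2_eq_Suc' le_add1 le_trans nat_1_add_1 add.commute add.assoc)
    have num: "f0 \<in> N" "\<kappa> f0 \<le> M" "f1 \<in> N" "\<kappa> f1 \<le> M"
      using i nth_mem[OF v] by (auto simp: invariant_def f)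
    have eq: "\<forall>i<length (fs ! v). fs ! v ! i = \<phi> v i" using i v by (auto simp: invariant_def)
    have \<phi>: "\<phi> v 0 = f0" "\<phi> v 1 = f1" using eq[rule_format, of 0] eq[rule_format, of 1] by (auto simp: f)
    have f1: "f1 > 0" using i by (auto simp: invariant_def good_state_def good_def \<phi>(2)[symmetric])
    have nt: "ev [enc_funs fs, VNum (real v)] (prog k ! 9) (VPair (VNum f0) (VPair (VNum f1) (encode_list VNum fr))) ((v + 1) * scan_cost M)"
      using nth_ev[of v fs M "encode_list VNum"] v vM by (simp add: f)
    have fd: "ev [VNum (real v), enc_edges es] (prog k ! 8) VNil ((length es + 1) * scan_cost M)"
      using find_ev[OF vM(1) ids[OF i]] n by (simp add: enc_found_def)
    have "(v + 1) * scan_cost M \<le> (M + 1) * scan_cost M" "(length es + 1) * scan_cost M \<le> (M + 1) * scan_cost M" using vM by (intro mult_right_mono; simp)+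
    then have "ev [Lv, VNum (real v), enc_edges es, enc_funs fs] (prog k ! 7) (VNum (f0 / f1)) (visit_cost M)"
      unfolding prog_nth(8)[of k] ratio_body_def
      apply (intro ev_mono[where T' = "visit_cost M"])
       apply (rule ev_Let_in, rule ev_Call, (rule ev_det)+, rule nt, simp)
       apply (rule ev_Let_in, rule ev_Call, (rule ev_det)+, rule fd, simp)
       apply (rule ev_If_nil, (rule ev_det)+)
       using f1 apply simp
      using num unfolding visit_cost_def by linarith
    moreover have "f0 / f1 \<in> N" "\<kappa> (f0 / f1) \<le> visit_cost M"
      using op_le(7,8)[OF num(1,3,2,4)] by (auto simp: visit_cost_def)
    ultimately show ?thesis unfolding \<phi> by blast
  qed
  {
    case 0
    show ?case
    proof (cases "find_edge v es")
      case None
      then show ?thesis using base[OF 0 None, of VNil] by simp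
    next
      case (Some r)
      obtain u l rest where r: "r = ((u, l), rest)" by (cases r) auto
      have vM: "v \<le> M" "length es \<le> M" using 0 by (auto simp: invariant_def)
      have nt: "ev [enc_funs fs, VNum (real v)] (prog k ! 9) (encode_list VNum (fs ! v)) ((v + 1) * scan_cost M)"
        using nth_ev[of v fs M "encode_list VNum"] 0 vM by simp
      have fd: "ev [VNum (real v), enc_edges es] (prog k ! 8) (VPair (VPair (VNum (real u)) (VNum l)) (enc_edges rest)) ((length es + 1) * scan_cost M)"
        using find_ev[OF vM(1) ids[OF 0(1)]] Some by (simp add: enc_found_def r)
      have "(v + 1) * scan_cost M \<le> (M + 1) * scan_cost M" "(length es + 1) * scan_cost M \<le> (M + 1) * scan_cost M" using vM by (intro mult_right_mono; simp)+
      then have "ev [VNil, VNum (real v), enc_edges es, enc_funs fs] (prog k ! 7) (VNum 0) (visit_cost M)"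
        unfolding prog_nth(8)[of k] ratio_body_def
        apply (intro ev_mono[where T' = "visit_cost M"])
         apply (rule ev_Let_in, rule ev_Call, (rule ev_det)+, rule nt, simp)
         apply (rule ev_Let_in, rule ev_Call, (rule ev_det)+, rule fd, simp)
         apply (rule ev_If_pair, (rule ev_det)+)
         apply (rule ev_If_nil, (rule ev_det)+)
        unfolding visit_cost_def by linarith
      then show ?thesis using Some k01 by (simp add: visit_cost_def)
    qed
  next
    case (Suc L)
    show ?case
    proof (cases "find_edge v es")
      case None
      have "visit_cost M \<le> ratio_cost M (Suc L)" by (rule visit_cost_le)
      then show ?thesis using base[OF Suc.prems None, of "ulist (Suc L)"] None by (auto elim: ev_mono)
    next
      case (Some r)
      obtain u l rest where fe: "find_edge v es = Some ((u, l), rest)" using Some by (cases r) auto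
      note F = invariant_find[OF Suc.prems(1) fe]
      have vM: "v \<le> M" "length es \<le> M" "u \<le> M" using Suc.prems F(4) by (auto simp: invariant_def)
      have uv: "u \<noteq> v" "l \<ge> 1"
        using find_edge_Some(3)[OF fe] Suc.prems(1) by (auto simp: invariant_def)
      \<comment> \<open>The removed edge adds one unit of reserve at both ends. Together with the
        unit that \<open>v\<close> had before, its list has three entries, enough to read off the
        parameter.\<close>
      have len: "deg rest v + 1 + 2 \<le> length (fs ! v)" "deg rest u + 1 + 1 \<le> length (fs ! u)"
        using F(1) Suc.prems(2) F(4) uv by (auto simp: invariant_def)
      then obtain f0 f1 f2 fr where f: "fs ! v = f0 # f1 # f2 # fr"
        by (cases "fs ! v"; cases "tl (fs ! v)"; cases "tl (tl (fs ! v))") auto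
      have num: "f0 \<in> N" "\<kappa> f0 \<le> M" "f1 \<in> N" "\<kappa> f1 \<le> M" "f2 \<in> N" "\<kappa> f2 \<le> M"
        using Suc.prems(1) nth_mem[OF Suc.prems(2)] by (auto simp: invariant_def f)
      have eq: "\<forall>i<length (fs ! v). fs ! v ! i = \<phi> v i" using Suc.prems by (auto simp: invariant_def)
      have \<phi>: "\<phi> v 0 = f0" "\<phi> v 1 = f1" "\<phi> v 2 = f2"
        using eq[rule_format, of 0] eq[rule_format, of 1] eq[rule_format, of 2] by (auto simp: f)
      have gs: "good_state (real k) \<phi>" using Suc.prems(1) by (simp add: invariant_def)
      have f1: "f1 > 0" using gs by (auto simp: good_state_def good_def \<phi>(2)[symmetric])
      have coef: "coef (\<phi> v) = (f2 - f0) / f1" by (simp only: coef_def \<phi>)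
      have c1: "(f2 - f0) / f1 \<ge> 117/100" using good_coef(1)[of "real k" "\<phi> v"] gs coef by (simp add: good_state_def)
      define fu where "fu = fs[u := tl (fs ! u)]"
      define fv where "fv = fs[v := tl (fs ! v)]"
      define fvv where "fvv = fv[v := tl (fv ! v)]"
      have ia: "invariant M rest fs \<phi> (\<lambda>w. of_bool (w = v))" by (rule invariant_mono[OF F(1)]) auto
      have ib: "invariant M rest fu (shift u \<phi>) (\<lambda>w. of_bool (w = v))"
        unfolding fu_def by (rule invariant_shift[OF F(1) k]) (use uv in auto)
      have iv: "invariant M rest fv (shift v \<phi>) (\<lambda>w. of_bool (w = v) + of_bool (w = u))"
        unfolding fv_def by (rule invariant_shift[OF F(1) k]) (use uv in auto)
      have ix: "invariant M rest fvv (shift v (shift v \<phi>)) (\<lambda>w. of_bool (w = u))"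
        unfolding fvv_def by (rule invariant_shift[OF iv k]) (use uv in auto)
      define a b y where "a = ratio_approx (real k) L v rest \<phi>" and "b = ratio_approx (real k) L v rest (shift u \<phi>)"
        and "y = ratio_approx (real k) L u rest (shift v (shift v \<phi>))"
      define B where "B = ratio_cost M L"
      have A: "ev [ulist L, VNum (real v), enc_edges rest, enc_funs fs] (prog k ! 7) (VNum a) B" "a \<in> N" "\<kappa> a \<le> B"
        using Suc.IH[OF ia Suc.prems(2)] by (auto simp: a_def B_def)
      have Bb: "ev [ulist L, VNum (real v), enc_edges rest, enc_funs fu] (prog k ! 7) (VNum b) B" "b \<in> N" "\<kappa> b \<le> B"
        using Suc.IH[OF ib] Suc.prems(2) by (auto simp: b_def B_def fu_def)
      have Y: "ev [ulist L, VNum (real u), enc_edges rest, enc_funs fvv] (prog k ! 7) (VNum y) B" "y \<in> N" "\<kappa> y \<le> B"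
        using Suc.IH[OF ix] F(4) by (auto simp: y_def B_def fvv_def fv_def)
      have ok: "weights_ok rest" using F(1) by (simp add: invariant_def)
      have K: "real k \<ge> 1" using k by simp
      have nn: "0 \<le> a" "0 \<le> b" "0 \<le> y"
        using ratio_approx_close[OF K ok gs, of L v] ratio_approx_close[OF K ok good_state_shift[OF K gs], of L v u]
          ratio_approx_close[OF K ok good_state_shift[OF K good_state_shift[OF K gs]], of L u v v]
        by (auto simp: a_def b_def y_def)
      define x where "x = y / l"
      have x: "x \<in> N" "\<kappa> x \<le> B + M" "0 \<le> x"
        using op_le(7,8)[OF Y(2) F(2) Y(3) F(3)] nn uv by (auto simp: x_def)
      have ratio_approx: "ratio_approx (real k) (Suc L) v es \<phi> = capped_step (real k) ((f2 - f0) / f1) a b x"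
        by (simp add: fe a_def b_def y_def x_def coef[symmetric])
      have nz: "f1 \<noteq> 0" "(f2 - f0) / f1 + b \<noteq> 0" "(f2 - f0) / f1 + a + x \<noteq> 0"
      proof -
        show "f1 \<noteq> 0" using f1 by simp
        show "(f2 - f0) / f1 + b \<noteq> 0" using c1 nn by linarith
        show "(f2 - f0) / f1 + a + x \<noteq> 0" using c1 nn x(3) by linarith
      qed
      have st: "ev [VPair (VNum f0) (VPair (VNum f1) (VPair (VNum f2) (encode_list VNum fr))), VNum a, VNum b, VNum x]
          (prog k ! 11) (VNum (capped_step (real k) ((f2 - f0) / f1) a b x)) (step_cost * (B + M + 1))
         \<and> capped_step (real k) ((f2 - f0) / f1) a b x \<in> N \<and> \<kappa> (capped_step (real k) ((f2 - f0) / f1) a b x) \<le> step_cost * (B + M + 1)"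
        using step_ev[of f0 f1 f2 a b x "B + M" "encode_list VNum fr"] num A Bb x nz by simp
      have nt: "ev [enc_funs fs, VNum (real v)] (prog k ! 9) (VPair (VNum f0) (VPair (VNum f1) (VPair (VNum f2) (encode_list VNum fr)))) ((v + 1) * scan_cost M)"
        using nth_ev[of v fs M "encode_list VNum"] Suc.prems vM by (simp add: f)
      have fd: "ev [VNum (real v), enc_edges es] (prog k ! 8) (VPair (VPair (VNum (real u)) (VNum l)) (enc_edges rest)) ((length es + 1) * scan_cost M)"
        using find_ev[OF vM(1) ids[OF Suc.prems(1)]] fe by (simp add: enc_found_def)
      have su: "ev [enc_funs fs, VNum (real u)] (prog k ! 10) (enc_funs fu) ((u + 1) * scan_cost M)"
        unfolding fu_def using len by (intro shift_ev F(4) vM) auto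
      have sv: "ev [enc_funs fs, VNum (real v)] (prog k ! 10) (enc_funs fv) ((v + 1) * scan_cost M)"
        unfolding fv_def using len by (intro shift_ev Suc.prems vM) auto
      have svv: "ev [enc_funs fv, VNum (real v)] (prog k ! 10) (enc_funs fvv) ((v + 1) * scan_cost M)"
        unfolding fvv_def using Suc.prems(2) f by (intro shift_ev vM) (auto simp: fv_def)
      have bnd: "(v + 1) * scan_cost M \<le> (M + 1) * scan_cost M" "(length es + 1) * scan_cost M \<le> (M + 1) * scan_cost M" "(u + 1) * scan_cost M \<le> (M + 1) * scan_cost M"
        using vM by (intro mult_right_mono; simp)+
      have JB: "step_cost * (B + M + 1) = step_cost * B + step_cost * (M + 1)" "(step_cost + 4) * B = step_cost * B + 4 * B" by (simp_all add: algebra_simps)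
      have "ev [ulist (Suc L), VNum (real v), enc_edges es, enc_funs fs] (prog k ! 7)
         (VNum (capped_step (real k) ((f2 - f0) / f1) a b x)) (ratio_cost M (Suc L))"
        unfolding prog_nth(8)[of k] ratio_body_def ulist.simps
        apply (rule ev_mono)
         apply (rule ev_Let_in, rule ev_Call, (rule ev_det)+, rule nt, simp)
         apply (rule ev_Let_in, rule ev_Call, (rule ev_det)+, rule fd, simp)
         apply (rule ev_If_pair, (rule ev_det)+)
         apply (rule ev_If_pair, (rule ev_det)+)
         apply (rule ev_Call)
           apply (rule evs_Cons, (rule ev_det))
           apply (rule evs_Cons, rule ev_Call, (rule ev_det)+, rule A(1), simp)
           apply (rule evs_Cons, rule ev_Call, (rule ev_det)+, rule ev_Call, (rule ev_det)+, rule su, simp, rule evs_Nil, rule Bb(1), simp)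
           apply (rule evs_Cons, rule ev_Div, rule ev_Call, (rule ev_det)+, rule ev_Call, (rule ev_det)+, rule ev_Call, (rule ev_det)+, rule sv, simp, (rule ev_det)+, rule svv, simp, rule evs_Nil, rule Y(1), simp)
             apply (rule ev_det)+
            using uv apply simp
           apply (rule evs_Nil)
          apply (unfold x_def[symmetric])
          apply (rule st[THEN conjunct1])
         apply simp
        using bnd Y(3) F(3) JB unfolding ratio_cost.simps B_def[symmetric] visit_cost_def by linarith
      moreover have "step_cost * (B + M + 1) \<le> ratio_cost M (Suc L)" using JB unfolding ratio_cost.simps B_def[symmetric] visit_cost_def by linarith
      ultimately show ?thesis using st unfolding ratio_approx by simp
    qed
  }
qed

lemma len_ev:
  "length es \<le> M \<Longrightarrow> ev [enc_edges es] (prog k ! 2) (VNum (real (length es + 1))) ((length es + 1) * scan_cost M)"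
proof (induction es)
  case Nil
  have eq: "real (length ([] :: edge list) + 1) = 1" by simp
  show ?case unfolding prog_nth len_body_def encode_list_simps eq
    apply (rule ev_mono)
     apply (rule ev_If_nil, (rule ev_det)+)
    by (simp add: scan_cost_def)
next
  case (Cons e es)
  have eq: "real (length (e # es) + 1) = 1 + real (length es + 1)" by simp
  have IH: "ev [enc_edges es] (prog k ! 2) (VNum (real (length es + 1))) ((length es + 1) * scan_cost M)"
    using Cons by simp
  show ?case unfolding prog_nth(3)[of k] len_body_def encode_list_simps eq
    apply (rule ev_mono)
     apply (rule ev_If_pair, (rule ev_det)+)
     apply (rule ev_Call, (rule ev_det)+, rule IH, simp)
    using k01(2) k_nat[of "length es + 1"] Cons.prems by (simp add: scan_cost_def)
qed

lemma zip_ev: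
  "length ws = length ends \<Longrightarrow>
    ev [encode_list (\<lambda>(u, v). VPair (VNum (real u)) (VNum (real v))) ends, encode_list VNum ws] (prog k ! 1)
      (enc_edges (map (\<lambda>((u, v), l). (u, v, l)) (zip ends ws))) ((length ends + 1) * 30)"
proof (induction ends arbitrary: ws)
  case Nil
  show ?case unfolding prog_nth zip_body_def encode_list_simps zip_Nil list.map
    apply (rule ev_mono)
     apply (rule ev_If_nil, (rule ev_det)+)
    by simp
next
  case (Cons e ends)
  obtain a b where e: "e = (a, b)" by (cases e)
  obtain w ws' where ws: "ws = w # ws'" "length ws' = length ends" using Cons.prems by (cases ws) auto
  note IH = Cons.IH[OF ws(2)]
  show ?case unfolding prog_nth(2)[of k] zip_body_def e ws(1) zip_Cons_Cons list.map prod.case encode_list_simps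
    apply (rule ev_mono)
     apply (rule ev_If_pair, (rule ev_det)+)
     apply (rule ev_Call, (rule ev_det)+, rule IH, simp)
    by simp
qed

lemma check_ev:
  assumes "\<forall>f\<in>set fs. f \<noteq> [] \<and> (\<forall>x\<in>set f. \<kappa> x \<le> M)"
  shows "ev [enc_funs fs] (prog k ! 3)
     (if \<forall>f\<in>set fs. 2 \<le> length f \<longrightarrow> 0 < f ! 1 then VPair VNil VNil else VNil) ((length fs + 1) * scan_cost M)"
  using assms
proof (induction fs)
  case Nil
  have eq: "(if \<forall>f\<in>set ([] :: real list list). 2 \<le> length f \<longrightarrow> 0 < f ! 1 then VPair VNil VNil else VNil) = (VPair VNil VNil :: real val)" by simp
  show ?case unfolding eq prog_nth check_body_def encode_list_simps
    apply (rule ev_mono)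
     apply (rule ev_If_nil, (rule ev_det)+)
    by (simp add: scan_cost_def)
next
  case (Cons f fs)
  define r :: "real val" where "r = (if \<forall>f\<in>set fs. 2 \<le> length f \<longrightarrow> 0 < f ! 1 then VPair VNil VNil else VNil)"
  have IH: "ev [enc_funs fs] (prog k ! 3) r ((length fs + 1) * scan_cost M)" using Cons by (simp add: r_def)
  obtain y ys where f: "f = y # ys" using Cons.prems by (cases f) auto
  show ?case
  proof (cases ys)
    case Nil
    have eq: "(if \<forall>f\<in>set (f # fs). 2 \<le> length f \<longrightarrow> 0 < f ! 1 then VPair VNil VNil else VNil) = r"
      by (simp add: r_def f Nil)
    show ?thesis unfolding eq unfolding prog_nth(4)[of k] check_body_def f Nil encode_list_simps
      apply (rule ev_mono)
       apply (rule ev_If_pair, (rule ev_det)+)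
       apply (rule ev_If_nil, (rule ev_det)+)
       apply (rule ev_Call, (rule ev_det)+, rule IH, simp)
      by (simp add: scan_cost_def)
  next
    case ys: (Cons z zs)
    have z: "\<kappa> z \<le> M" using Cons.prems by (simp add: f ys)
    show ?thesis
    proof (cases "0 < z")
      case True
      have eq: "(if \<forall>f\<in>set (f # fs). 2 \<le> length f \<longrightarrow> 0 < f ! 1 then VPair VNil VNil else VNil) = r"
        using True by (simp add: r_def f ys)
      show ?thesis unfolding eq unfolding prog_nth(4)[of k] check_body_def f ys encode_list_simps
        apply (rule ev_mono)
         apply (rule ev_If_pair, (rule ev_det)+)
         apply (rule ev_If_pair, (rule ev_det)+)
         apply (rule ev_If_less, (rule ev_det)+, rule True)
         apply (rule ev_Call, (rule ev_det)+, rule IH, simp)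
        using z k01(1) by (simp add: scan_cost_def)
    next
      case False
      have eq: "(if \<forall>f\<in>set (f # fs). 2 \<le> length f \<longrightarrow> 0 < f ! 1 then VPair VNil VNil else VNil) = VNil"
        using False by (simp add: f ys)
      show ?thesis unfolding eq unfolding prog_nth(4)[of k] check_body_def f ys encode_list_simps
        apply (rule ev_mono)
         apply (rule ev_If_pair, (rule ev_det)+)
         apply (rule ev_If_pair, (rule ev_det)+)
         apply (rule ev_If_not_less, (rule ev_det)+, rule False, (rule ev_det)+)
        using z k01(1) by (simp add: scan_cost_def)
    qed
  qed
qed

lemma heads_ev:
  assumes "\<forall>f\<in>set fs. f \<noteq> [] \<and> (\<forall>x\<in>set f. x \<in> N \<and> \<kappa> x \<le> M)" "length fs \<le> M"
  shows "ev [enc_funs fs] (prog k ! 6) (VNum (prod_list (map hd fs))) ((length fs + 1) * (24 + M + M * M))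
    \<and> prod_list (map hd fs) \<in> N \<and> \<kappa> (prod_list (map hd fs)) \<le> length fs * M + 4"
  using assms
proof (induction fs)
  case Nil
  have "ev [VNil] (prog k ! 6) (VNum 1) (24 + M + M * M)"
    unfolding prog_nth heads_body_def
    apply (rule ev_mono)
     apply (rule ev_If_nil, (rule ev_det)+)
    by simp
  then show ?case using k01 by simp
next
  case (Cons f fs)
  define r where "r = prod_list (map hd fs)"
  have IH: "ev [enc_funs fs] (prog k ! 6) (VNum r) ((length fs + 1) * (24 + M + M * M))" "r \<in> N" "\<kappa> r \<le> length fs * M + 4"
    using Cons by (auto simp: r_def)
  obtain y ys where f: "f = y # ys" using Cons.prems by (cases f) auto
  have y: "y \<in> N" "\<kappa> y \<le> M" using Cons.prems by (auto simp: f)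
  have sm: "(length (f # fs) + 1) * (24 + M + M * M) = (length fs + 1) * (24 + M + M * M) + (24 + M + M * M)" by simp
  have lM: "length fs * M \<le> M * M" using Cons.prems by (intro mult_right_mono) auto
  have "ev [enc_funs (f # fs)] (prog k ! 6) (VNum (y * r)) ((length (f # fs) + 1) * (24 + M + M * M))"
    unfolding sm unfolding prog_nth(7)[of k] heads_body_def f encode_list_simps
    apply (rule ev_mono)
     apply (rule ev_If_pair, (rule ev_det)+)
     apply (rule ev_Call, (rule ev_det)+, rule IH(1), simp)
    using y IH(3) lM by linarith
  then show ?case using op_le(5,6)[OF y(1) IH(2) y(2) IH(3)] by (simp add: r_def f)
qed

lemma invariant_Cons:
  assumes i: "invariant M ((u, v, l) # es) fs \<phi> ext"
  shows "invariant M es fs \<phi> (\<lambda>w. ext w + of_bool (w = u \<or> w = v))" "l \<in> N" "\<kappa> l \<le> M" "u < length fs" "v < length fs" "u \<noteq> v"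
  using i unfolding invariant_def deg_Cons by (auto simp: algebra_simps)

definition edge_cost :: "nat \<Rightarrow> nat \<Rightarrow> nat" where
  "edge_cost M B = 200 + 2 * ((M + 1) * scan_cost M) + 10 * B + 3 * M + (M * M + 4 + M * (2 * M + 4 * B)) + (M + 1) * (24 + M + M * M)"

text \<open>Each factor has size at most 2 M + 4 B, and sizes add along the product, so the result
  grows only linearly with the number of edges.\<close>

lemma total_ev:
  fixes M L :: nat
  assumes k: "k \<ge> 1"
  defines "B \<equiv> ratio_cost M L"
  shows "invariant M es fs \<phi> (\<lambda>_. 0) \<Longrightarrow>
    ev [ulist L, enc_edges es, enc_funs fs] (prog k ! 5) (VNum (Z_approx (real k) L es {..<length fs} \<phi>)) ((length es + 1) * edge_cost M B)
    \<and> Z_approx (real k) L es {..<length fs} \<phi> \<in> N \<and> \<kappa> (Z_approx (real k) L es {..<length fs} \<phi>) \<le> M * M + 4 + length es * (2 * M + 4 * B)"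
proof (induction es arbitrary: fs \<phi>)
  case Nil
  have l: "length fs \<le> M" using Nil by (simp add: invariant_def)
  have ne: "f \<noteq> []" if f: "f \<in> set fs" for f
  proof -
    obtain w where "w < length fs" "f = fs ! w" using f by (auto simp: in_set_conv_nth)
    then show ?thesis using Nil by (auto simp: invariant_def)
  qed
  have "prod_list (map hd fs) = (\<Prod>w = 0..<length fs. hd (fs ! w))"
    by (subst prod.list_conv_set_nth) simp
  also have "\<dots> = (\<Prod>w<length fs. \<phi> w 0)"
    unfolding atLeast0LessThan
  proof (rule prod.cong)
    fix w assume "w \<in> {..<length fs}"
    then show "hd (fs ! w) = \<phi> w 0" using Nil ne[of "fs ! w"] by (auto simp: invariant_def hd_conv_nth)
  qed simp
  finally have eq: "Z_approx (real k) L [] {..<length fs} \<phi> = prod_list (map hd fs)" by simp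
  have num: "\<forall>f\<in>set fs. f \<noteq> [] \<and> (\<forall>x\<in>set f. x \<in> N \<and> \<kappa> x \<le> M)" using Nil ne by (auto simp: invariant_def)
  note h = heads_ev[OF num l]
  have m1: "(length fs + 1) * (24 + M + M * M) \<le> (M + 1) * (24 + M + M * M)" using l by (intro mult_right_mono) auto
  have m2: "length fs * M \<le> M * M" using l by (intro mult_right_mono) auto
  have "ev [ulist L, VNil, enc_funs fs] (prog k ! 5) (VNum (prod_list (map hd fs))) (edge_cost M B)"
    unfolding prog_nth(6)[of k] total_body_def
    apply (rule ev_mono)
     apply (rule ev_If_nil, (rule ev_det)+)
     apply (rule ev_Call, (rule ev_det)+, rule h[THEN conjunct1], simp)
    using m1 unfolding edge_cost_def by linarith
  moreover have "\<kappa> (prod_list (map hd fs)) \<le> M * M + 4" using h m2 by linarith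
  ultimately show ?case using h unfolding eq by simp
next
  case (Cons e es)
  obtain u v l where e: "e = (u, v, l)" by (cases e)
  note I = invariant_Cons[OF Cons.prems[unfolded e]]
  have vM: "u \<le> M" "v \<le> M" "length es \<le> M" using Cons.prems I by (auto simp: invariant_def)
  define fu where "fu = fs[u := tl (fs ! u)]"
  define fw where "fw = fu[v := tl (fu ! v)]"
  have ia: "invariant M es fs \<phi> (\<lambda>w. of_bool (w = u))" by (rule invariant_mono[OF I(1)]) auto
  have ib: "invariant M es fu (shift u \<phi>) (\<lambda>w. of_bool (w = v))"
    unfolding fu_def by (rule invariant_shift[OF I(1) k]) (use I in auto)
  have ic: "invariant M es fw (shift v (shift u \<phi>)) (\<lambda>_. 0)"
    unfolding fw_def by (rule invariant_shift[OF ib k]) (use I in auto)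
  define r1 r2 z where "r1 = ratio_approx (real k) L u es \<phi>" and "r2 = ratio_approx (real k) L v es (shift u \<phi>)"
    and "z = Z_approx (real k) L es {..<length fs} (shift v (shift u \<phi>))"
  have R1: "ev [ulist L, VNum (real u), enc_edges es, enc_funs fs] (prog k ! 7) (VNum r1) B" "r1 \<in> N" "\<kappa> r1 \<le> B"
    using ratio_ev[OF k ia I(4), of L] by (auto simp: r1_def B_def)
  have R2: "ev [ulist L, VNum (real v), enc_edges es, enc_funs fu] (prog k ! 7) (VNum r2) B" "r2 \<in> N" "\<kappa> r2 \<le> B"
    using ratio_ev[OF k ib, of L] I(5) by (auto simp: r2_def B_def fu_def)
  have IH: "ev [ulist L, enc_edges es, enc_funs fw] (prog k ! 5) (VNum z) ((length es + 1) * edge_cost M B)" "z \<in> N"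
    "\<kappa> z \<le> M * M + 4 + length es * (2 * M + 4 * B)"
    using Cons.IH[OF ic] by (auto simp: z_def fw_def fu_def)
  have ne: "fs ! u \<noteq> []" "fu ! v \<noteq> []"
    using I(1,4,5,6) by (auto simp: invariant_def fu_def)
  have su: "ev [enc_funs fs, VNum (real u)] (prog k ! 10) (enc_funs fu) ((u + 1) * scan_cost M)"
    unfolding fu_def by (rule shift_ev[OF I(4) vM(1) ne(1)])
  have sv: "ev [enc_funs fu, VNum (real v)] (prog k ! 10) (enc_funs fw) ((v + 1) * scan_cost M)"
    unfolding fw_def by (rule shift_ev[OF _ vM(2) ne(2)]) (use I in \<open>simp add: fu_def\<close>)
  have rr: "r1 * r2 \<in> N" "\<kappa> (r1 * r2) \<le> 2 * B" using op_le(5,6)[OF R1(2) R2(2) R1(3) R2(3)] by auto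
  have F: "l + r1 * r2 \<in> N" "\<kappa> (l + r1 * r2) \<le> 2 * M + 4 * B" using op_le(1,2)[OF I(2) rr(1) I(3) rr(2)] by auto
  have G: "(l + r1 * r2) * z \<in> N" "\<kappa> ((l + r1 * r2) * z) \<le> M * M + 4 + length (e # es) * (2 * M + 4 * B)"
    using op_le(5,6)[OF F(1) IH(2) F(2) IH(3)] by auto
  have eq: "Z_approx (real k) L (e # es) {..<length fs} \<phi> = (l + r1 * r2) * z"
    by (simp add: e r1_def r2_def z_def shift_commute)
  have bnd: "(u + 1) * scan_cost M \<le> (M + 1) * scan_cost M" "(v + 1) * scan_cost M \<le> (M + 1) * scan_cost M"
    "length es * (2 * M + 4 * B) \<le> M * (2 * M + 4 * B)"
    using vM by (intro mult_right_mono; simp)+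
  have sm: "(length (e # es) + 1) * edge_cost M B = (length es + 1) * edge_cost M B + edge_cost M B" by simp
  have "ev [ulist L, enc_edges (e # es), enc_funs fs] (prog k ! 5) (VNum ((l + r1 * r2) * z)) ((length (e # es) + 1) * edge_cost M B)"
    unfolding sm unfolding prog_nth(6)[of k] total_body_def e encode_list_simps prod.case
    apply (rule ev_mono)
     apply (rule ev_If_pair, (rule ev_det)+)
      apply (rule ev_Call, (rule ev_det)+, rule su, simp)
     apply (rule ev_Mul)
      apply (rule ev_Add, (rule ev_det)+)
       apply (rule ev_Call, (rule ev_det)+, rule R1(1), simp)
      apply (rule ev_Call, (rule ev_det)+, rule R2(1), simp)
     apply (rule ev_Call)
       apply (rule evs_Cons, rule ev_det)
       apply (rule evs_Cons, rule ev_det)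
       apply (rule evs_Cons, rule ev_Call, (rule ev_det)+, rule sv, simp)
       apply (rule evs_Nil)
      apply (rule IH(1))
     apply simp
    using bnd I(3) R1(3) R2(3) rr(2) F(2) IH(3) unfolding edge_cost_def by linarith
  then show ?case using G unfolding eq by simp
qed

definition depth_cost :: nat where "depth_cost = 2 * ((51 + 100 * k) * (70 + 100 * k)) + 1000 + 1000 * k"

lemma rate_alt: "rate (real k) = real (49 + 100 * k) / real (50 + 100 * k)"
  by (simp add: rate_def field_simps)

text \<open>The power \<open>n\<close> merely guarantees termination. The last conjunct says that
  the depth is not larger than necessary, which the time bound relies on; each division adds at most
  \<open>depth_cost\<close> to the size of the number.\<close>

lemma depth_ev:
  "y \<in> N \<Longrightarrow> 0 < y \<Longrightarrow> rate (real k) ^ n \<le> y \<Longrightarrow>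
    \<exists>L. ev [VNum y] (prog k ! 4) (ulist L) ((L + 1) * (3 * (\<kappa> y + L * depth_cost) + depth_cost)) \<and> rate (real k) ^ L \<le> y
      \<and> (0 < L \<longrightarrow> y < rate (real k) ^ (L - 1))"
proof (induction n arbitrary: y)
  have stop: "ev [VNum y] (prog k ! 4) (ulist 0) ((0 + 1) * (3 * (\<kappa> y + 0 * depth_cost) + depth_cost))" if "\<not> y < 1" for y
    unfolding prog_nth depth_body_def ulist.simps
    apply (rule ev_mono)
     apply (rule ev_If_not_less, (rule ev_det)+, rule that, (rule ev_det)+)
    using k01(2) by (simp add: depth_cost_def)
  {
    case 0
    then show ?case using stop[of y] by (intro exI[of _ 0]) auto
  next
    case (Suc n)
    define \<rho> where "\<rho> = rate (real k)"
    have \<rho>: "0 < \<rho>" using rate_bounds(1)[of "real k"] by (simp add: \<rho>_def)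
    show ?case
    proof (cases "y < 1")
      case False
      then show ?thesis using stop[of y] by (intro exI[of _ 0]) auto
    next
      case True
      define y' where "y' = y * real (50 + 100 * k) / real (49 + 100 * k)"
      have y'\<rho>: "y' = y / \<rho>" by (simp add: y'_def \<rho>_def rate_alt)
      note b = k_nat[of "50 + 100 * k"] k_nat[of "49 + 100 * k"]
      note o1 = op_le[OF Suc.prems(1) N_nat[of "50 + 100 * k"] order_refl b(1)]
      note o2 = op_le[OF o1(5) N_nat[of "49 + 100 * k"] o1(6) b(2)]
      have y'N: "y' \<in> N" "\<kappa> y' \<le> \<kappa> y + depth_cost" using o2(7,8) by (auto simp: y'_def depth_cost_def)
      have "0 < y'" "\<rho> ^ n \<le> y'" using Suc.prems(2,3) \<rho> by (auto simp: y'\<rho> \<rho>_def[symmetric] field_simps)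
      then obtain L where L: "ev [VNum y'] (prog k ! 4) (ulist L) ((L + 1) * (3 * (\<kappa> y' + L * depth_cost) + depth_cost))"
        "\<rho> ^ L \<le> y'" "0 < L \<longrightarrow> y' < \<rho> ^ (L - 1)"
        using Suc.IH[OF y'N(1)] by (auto simp: \<rho>_def)
      have "(L + 1) * (3 * (\<kappa> y' + L * depth_cost) + depth_cost) \<le> (L + 1) * (3 * (\<kappa> y + depth_cost + L * depth_cost) + depth_cost)"
        using y'N by (intro mult_left_mono) auto
      then have T: "ev [VNum y'] (prog k ! 4) (ulist L) ((L + 1) * (3 * (\<kappa> y + Suc L * depth_cost) + depth_cost))"
        using L(1) by (auto elim: ev_mono)
      define c0 where "c0 = 3 * (\<kappa> y + Suc L * depth_cost) + depth_cost"
      have sum: "(Suc L + 1) * c0 = (L + 1) * c0 + c0" by simp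
      have c0: "3 * \<kappa> y + depth_cost \<le> c0" by (simp add: c0_def)
      define p where "p = (51 + 100 * k) * (70 + 100 * k)"
      have c: "depth_cost = 2 * p + 1000 + 1000 * k" by (simp add: depth_cost_def p_def)
      have e: "(50 + 100 * k + 1) * (50 + 100 * k + 20) \<le> p" "(49 + 100 * k + 1) * (49 + 100 * k + 20) \<le> p"
        unfolding p_def by (intro mult_mono; simp)+
      have "ev [VNum y] (prog k ! 4) (ulist (Suc L)) ((Suc L + 1) * c0)"
        unfolding sum unfolding prog_nth(5)[of k] depth_body_def ulist.simps
        apply (rule ev_mono)
         apply (rule ev_If_less, (rule ev_det)+, rule True)
         apply (rule ev_Mk_pair, rule ev_det)
         apply (rule ev_Call)
           apply (rule evs_Cons)
            apply (rule ev_Div, rule ev_Mul, rule ev_det, rule ev_num, rule ev_num)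
            apply simp
           apply (rule evs_Nil)
          apply (rule T[unfolded y'_def, folded c0_def])
         apply simp
        using e c0 k01(2) b o1(6) unfolding c by linarith
      then have "ev [VNum y] (prog k ! 4) (ulist (Suc L)) ((Suc L + 1) * (3 * (\<kappa> y + Suc L * depth_cost) + depth_cost))"
        by (simp only: c0_def)
      moreover have "\<rho> ^ Suc L \<le> y" using L(2) \<rho> by (simp add: y'\<rho> field_simps)
      moreover have "y < \<rho> ^ (Suc L - 1)"
        using L(3) \<rho> True by (cases L) (auto simp: y'\<rho> field_simps)
      ultimately show ?thesis unfolding \<rho>_def by blast
    qed
  }
qed

end

section \<open>The whole run and its polynomial time bound\<close>

lemma val_size_encode_list:
  "length xs + 1 \<le> val_size \<kappa> (encode_list enc xs)"
  "x \<in> set xs \<Longrightarrow> val_size \<kappa> (enc x) \<le> val_size \<kappa> (encode_list enc xs)"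
  by (induction xs) auto

lemma nums_encode_list: "nums (encode_list enc xs) = (\<Union>x\<in>set xs. nums (enc x))"
  by (induction xs) auto

lemma deg_edges:
  assumes "well_formed \<Omega>"
  shows "deg (edges \<Omega>) w = vertex_degree \<Omega> w"
proof -
  have "length (weights \<Omega>) = length (endpoints \<Omega>)" using assms by (simp add: well_formed_def)
  then show ?thesis by (simp add: deg_def edges_alt vertex_degree_def incident_edges_def filter_map o_def)
qed

context cost_model
begin

definition main_time :: "nat \<Rightarrow> nat \<Rightarrow> nat" where
  "main_time M L = 2 * ((M + 1) * scan_cost M) + (M + 1) * 30 + (20 * k * k + 1) * (20 * k * k + 20) + 50 * M + 3 * (20 * k * k) + 300 +
     (L + 1) * (3 * (4 * M + 20 * k * k + 50 + L * depth_cost) + depth_cost) + (M + 1) * edge_cost M (ratio_cost M L)"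

lemma main_ev:
  assumes k: "k \<ge> 1" "real k * p \<ge> 1" "p > 0" and \<Omega>: "\<Omega> \<in> holant (fibonacci_from p 1.17) {1..}" and \<epsilon>: "\<epsilon> > 0"
    and N: "nums (VPair (VNum \<epsilon>) (encode_instance \<Omega>)) \<subseteq> N"
  defines "M \<equiv> val_size \<kappa> (VPair (VNum \<epsilon>) (encode_instance \<Omega>))"
  shows "\<exists>z L. ev [VPair (VNum \<epsilon>) (encode_instance \<Omega>)] (prog k ! 0) (VNum z) (main_time M L)
     \<and> approximates \<epsilon> (partition_function \<Omega>) z
     \<and> (0 < L \<longrightarrow> \<epsilon> / ((1 + \<epsilon>) * (real (20 * k * k) * real M)) < rate (real k) ^ (L - 1))"
proof -
  define fs ends ws where "fs = vertex_funs \<Omega>" and "ends = endpoints \<Omega>" and "ws = weights \<Omega>"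
  define es where "es = edges \<Omega>"
  have wf: "well_formed \<Omega>" and F: "\<And>f. f \<in> set fs \<Longrightarrow> f \<in> fibonacci_from p 1.17" and w1: "\<And>l. l \<in> set ws \<Longrightarrow> 1 \<le> l"
    using \<Omega> by (auto simp: holant_def fs_def ws_def)
  have lw: "length ws = length ends" and ends: "\<And>u v. (u, v) \<in> set ends \<Longrightarrow> u < length fs \<and> v < length fs \<and> u \<noteq> v"
    and lf: "\<And>v. v < length fs \<Longrightarrow> length (fs ! v) = deg es v + 1"
    using wf deg_edges[OF wf] unfolding well_formed_def fs_def ends_def ws_def es_def by auto
  have es: "es = map (\<lambda>((u, v), l). (u, v, l)) (zip ends ws)" by (simp add: es_def edges_def ends_def ws_def)
  have mem: "(u, v) \<in> set ends \<and> l \<in> set ws" if "(u, v, l) \<in> set es" for u v l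
    using that unfolding es by (auto dest: set_zip_leftD set_zip_rightD)
  have les: "length es = length ends" using lw by (simp add: es)
  have enc: "encode_instance \<Omega> = VPair (enc_funs fs)
     (VPair (encode_list (\<lambda>(u, v). VPair (VNum (real u)) (VNum (real v))) ends) (encode_list VNum ws))"
    by (simp add: encode_instance_def fs_def ends_def ws_def)
  have M: "M = 1 + \<kappa> \<epsilon> + (1 + val_size \<kappa> (enc_funs fs) + (1 + val_size \<kappa> (encode_list (\<lambda>(u, v). VPair (VNum (real u)) (VNum (real v))) ends)
      + val_size \<kappa> (encode_list VNum ws)))"
    by (simp add: M_def enc)
  have lM: "length fs \<le> M" "length ends + 1 \<le> M" "\<kappa> \<epsilon> \<le> M"
    using val_size_encode_list(1)[of fs \<kappa> "encode_list VNum"]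
      val_size_encode_list(1)[of ends \<kappa> "\<lambda>(u, v). VPair (VNum (real u)) (VNum (real v))"] unfolding M by linarith+
  have kw: "l \<in> N \<and> \<kappa> l \<le> M" if "l \<in> set ws" for l
    using val_size_encode_list(2)[OF that, of \<kappa> VNum] N that by (auto simp: M enc nums_encode_list)
  have kf: "x \<in> N \<and> \<kappa> x \<le> M" if "f \<in> set fs" "x \<in> set f" for f x
    using val_size_encode_list(2)[OF that(1), of \<kappa> "encode_list VNum"] val_size_encode_list(2)[OF that(2), of \<kappa> VNum] N that
    by (auto simp: M enc nums_encode_list)
  have \<epsilon>N: "\<epsilon> \<in> N" using N by simp
  have ne: "f \<noteq> []" if "f \<in> set fs" for f
    using that lf by (metis in_set_conv_nth length_0_conv add_is_0 one_neq_zero)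
  have check: "ev [enc_funs fs] (prog k ! 3) (if \<forall>f\<in>set fs. 2 \<le> length f \<longrightarrow> 0 < f ! 1 then VPair VNil VNil else VNil) ((length fs + 1) * scan_cost M)"
    using ne kf by (intro check_ev) auto
  have QM: "(length fs + 1) * scan_cost M \<le> (M + 1) * scan_cost M" "(length es + 1) * scan_cost M \<le> (M + 1) * scan_cost M"
    using lM les by (intro mult_right_mono; simp)+
  show ?thesis
  proof (cases "\<forall>f\<in>set fs. 2 \<le> length f \<longrightarrow> 0 < f ! 1")
    case False
    then obtain f where f: "f \<in> set fs" "2 \<le> length f" "f ! 1 \<le> 0" by force
    obtain v where v: "v < length fs" "f = fs ! v" using f(1) by (metis in_set_conv_nth)
    have "partition_function \<Omega> = 0"
      by (rule partition_function_zero[OF wf, of v]) (use v zero_function[OF F[OF f(1)] k(3) f(2,3)] in \<open>auto simp: fs_def\<close>)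
    moreover have "ev [VPair (VNum \<epsilon>) (encode_instance \<Omega>)] (prog k ! 0) (VNum 0) (main_time M 0)"
      unfolding prog_nth main_body_def enc
      apply (rule ev_mono)
       apply (rule ev_If_nil, rule ev_Call, (rule ev_det)+, rule check[unfolded if_not_P[OF False]], simp, (rule ev_det)+)
      using QM unfolding main_time_def by linarith
    ultimately show ?thesis by (intro exI[of _ 0]) (simp add: approximates_def)
  next
    case True
    define n where "n = length fs"
    \<comment> \<open>\<open>good_state\<close> ranges over all natural numbers, so numbers that are
      not vertices get an arbitrary good sequence.\<close>
    define \<phi> where "\<phi> v = (if v < n then seq (fs ! v) else fibs (117/100) 1 1)" for v
    have K: "real k \<ge> 1" using k by simp
    have sq: "good (real k) (seq (fs ! v))" "i < length (fs ! v) \<Longrightarrow> seq (fs ! v) i = fs ! v ! i" if "v < n" for v i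
      using seq_good[OF F[of "fs ! v"] _ K k(2)] True that by (auto simp: n_def)
    have gs: "good_state (real k) \<phi>"
      using sq(1) fibs_good[of "117/100" 1 "real k"] K by (auto simp: good_state_def \<phi>_def)
    have wo: "weights_ok es" using mem ends w1 by (fastforce simp: weights_ok_def)
    have vs: "verts es \<subseteq> {..<n}" using mem ends by (fastforce simp: verts_def n_def)
    have I: "invariant M es fs \<phi> (\<lambda>_. 0)"
      using lM les vs wo gs mem kw kf lf sq unfolding invariant_def n_def[symmetric]
      by (fastforce simp: \<phi>_def n_def)
    define d where "d = (1 + \<epsilon>) * (real (20 * k * k) * real (length es + 1))"
    define y where "y = \<epsilon> / d"
    have d: "0 < d" unfolding d_def using \<epsilon> k by (intro mult_pos_pos) auto
    have y: "0 < y" using \<epsilon> d by (simp add: y_def)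
    note o1 = op_le[OF k01(4) \<epsilon>N k01(2) lM(3)]
    note o2 = op_le[OF N_nat[of "20 * k * k"] N_nat[of "length es + 1"] k_nat k_nat]
    note o3 = op_le[OF o1(1) o2(5) o1(2) o2(6)]
    note o4 = op_le[OF \<epsilon>N o3(5) lM(3) o3(6)]
    have kd: "y \<in> N" "\<kappa> y \<le> 4 * M + 20 * k * k + 50" using o4(7,8) lM les by (auto simp: y_def d_def)
    obtain j where "rate (real k) ^ j \<le> y"
      using real_arch_pow_inv[OF y rate_bounds(2)[of "real k"]] by (auto intro: less_imp_le)
    then obtain L where L: "ev [VNum y] (prog k ! 4) (ulist L) ((L + 1) * (3 * (\<kappa> y + L * depth_cost) + depth_cost))"
      "rate (real k) ^ L \<le> y" "0 < L \<longrightarrow> y < rate (real k) ^ (L - 1)"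
      using depth_ev[OF kd(1) y] by blast
    have L1: "(L + 1) * (3 * (\<kappa> y + L * depth_cost) + depth_cost) \<le> (L + 1) * (3 * (4 * M + 20 * k * k + 50 + L * depth_cost) + depth_cost)"
      using kd by (intro mult_left_mono) auto
    define z where "z = Z_approx (real k) L es {..<n} \<phi>"
    have tot: "ev [ulist L, enc_edges es, enc_funs fs] (prog k ! 5) (VNum z) ((length es + 1) * edge_cost M (ratio_cost M L))"
      using total_ev[OF k(1) I, of L] by (simp add: z_def n_def)
    have YM: "(length es + 1) * edge_cost M (ratio_cost M L) \<le> (M + 1) * edge_cost M (ratio_cost M L)" "(length es + 1) * 30 \<le> (M + 1) * 30"
      using lM les by (intro mult_right_mono; simp)+
    have zip: "ev [encode_list (\<lambda>(u, v). VPair (VNum (real u)) (VNum (real v))) ends, encode_list VNum ws] (prog k ! 1)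
      (enc_edges es) ((length es + 1) * 30)"
      using zip_ev[OF lw] unfolding les unfolding es .
    have len: "ev [enc_edges es] (prog k ! 2) (VNum (real (length es + 1))) ((length es + 1) * scan_cost M)"
      using lM les by (intro len_ev) simp
    have arith: "1 + (1 + (1 + (1 + 1) + 0) + a) +
       (1 + (1 + (1 + (1 + (1 + 1)) + (1 + (1 + (1 + 1)) + 0)) + c) +
        (1 + (1 + (1 + (1 + 1) + (1 + (1 + 1 + (1 + 1) + k1 + ke) + (1 + p + (1 + (1 + 0) + b) + kr + kl) + k1e + kp) + ke + kd + 0) +
          e + (1 + (1 + (1 + 1) + 0))) + f))
       \<le> 2 * q + c' + p + 50 * m + 3 * r + 300 + e' + f'"
      if "a \<le> q" "b \<le> q" "c \<le> c'" "e \<le> e'" "f \<le> f'" "n + 1 \<le> m" "ke \<le> m" "kr \<le> r + 3" "kl \<le> n + 1 + 3" "k1 \<le> 4"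
        "k1e \<le> 2 * (4 + m)" "kp \<le> r + 3 + (n + 1 + 3)" "kd \<le> 2 * (4 + m) + (r + 3 + (n + 1 + 3))"
      for a b c e f p q c' e' f' m n r ke kr kl k1 k1e kp kd :: nat
      using that by simp
    have "ev [VPair (VNum \<epsilon>) (encode_instance \<Omega>)] (prog k ! 0) (VNum z) (main_time M L)"
      unfolding prog_nth(1)[of k] main_body_def enc
      apply (rule ev_mono)
       apply (rule ev_If_pair, rule ev_Call, (rule ev_det)+, rule check[unfolded if_P[OF True]], simp)
       apply (rule ev_Let_in, rule ev_Call, (rule ev_det)+, rule zip, simp)
       apply (rule ev_Call)
         apply (rule evs_Cons, rule ev_Call, rule evs_Cons, rule ev_Div, (rule ev_det)+)
              apply (rule ev_num, rule ev_Call, (rule ev_det)+, rule len, simp)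
            apply (rule d[unfolded d_def, THEN less_imp_neq, THEN not_sym])
           apply (rule evs_Nil)
          apply (rule L(1)[unfolded y_def d_def])
         apply simp
        apply (rule ev_det)+
       apply (rule tot)
      apply simp
      unfolding main_time_def
      apply (rule arith[OF QM YM(2) L1[unfolded y_def d_def] YM(1) _ lM(3) k_nat k_nat k01(2) o1(2) o2(6) o3(6)])
      using lM les by simp
    moreover have "approximates \<epsilon> (partition_function \<Omega>) z"
    proof -
      have "partition_function \<Omega> = Z es {..<n} \<phi>"
        unfolding es_def n_def fs_def
        by (rule partition_function_eq_Z[OF wf]) (use sq(2) in \<open>auto simp: \<phi>_def n_def fs_def\<close>)
      moreover have "rate (real k) ^ L \<le> \<epsilon> / ((1 + \<epsilon>) * (20 * (real k)\<^sup>2 * (real (length es) + 1)))"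
        using L(2) by (simp add: y_def d_def power2_eq_square mult_ac add_ac)
      ultimately show ?thesis
        using approximates_Z_approx[OF K wo gs _ vs \<epsilon>] by (simp add: z_def)
    qed
    moreover have "\<epsilon> / ((1 + \<epsilon>) * (real (20 * k * k) * real M)) < rate (real k) ^ (L - 1)" if "0 < L"
    proof -
      have "d \<le> (1 + \<epsilon>) * (real (20 * k * k) * real M)"
        unfolding d_def using \<epsilon> lM les by (intro mult_left_mono) auto
      then have "\<epsilon> / ((1 + \<epsilon>) * (real (20 * k * k) * real M)) \<le> y"
        unfolding y_def using d \<epsilon> by (intro divide_left_mono mult_pos_pos[of _ d]) linarith+
      then show ?thesis using L(3) that by linarith
    qed
    ultimately show ?thesis by blast
  qed
qed

lemma ratio_cost_le: "ratio_cost M L \<le> (step_cost + 5) ^ (L + 1) * visit_cost M"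
proof (induction L)
  case (Suc L)
  define P where "P = (step_cost + 5) ^ (L + 1) * visit_cost M"
  have "visit_cost M \<le> P" by (simp add: P_def)
  moreover have "(step_cost + 4) * ratio_cost M L \<le> (step_cost + 4) * P" using Suc unfolding P_def by (rule mult_left_mono) simp
  ultimately have "ratio_cost M (Suc L) \<le> (step_cost + 4) * P + P" unfolding ratio_cost.simps by linarith
  also have "\<dots> = (step_cost + 5) ^ (Suc L + 1) * visit_cost M" by (simp add: P_def algebra_simps)
  finally show ?case .
qed (simp add: algebra_simps)

lemma depth_le_ratio_cost: "L \<le> ratio_cost M L"
proof (induction L)
  case (Suc L)
  have "ratio_cost M L \<le> (step_cost + 4) * ratio_cost M L" by simp
  moreover have "1 \<le> visit_cost M" by (simp add: visit_cost_def)
  ultimately show ?case using Suc unfolding ratio_cost.simps by linarith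
qed simp

lemma visit_cost_le_square: "visit_cost M \<le> (1200 + step_cost) * (M + 1)\<^sup>2"
proof -
  have "M \<le> M * M" by (cases M) auto
  moreover have "step_cost * M \<le> step_cost * (M * M)" by (cases M) auto
  ultimately show ?thesis unfolding visit_cost_def scan_cost_def by (simp add: power2_eq_square algebra_simps)
qed

text \<open>All costs are polynomial in M + 1 + ratio_cost M L, which also dominates
  \<open>L\<close>. The degree 4 comes from \<open>(M + 1) * edge_cost M (ratio_cost M L)\<close>,
  as \<open>edge_cost\<close> is cubic.\<close>

lemma main_time_le: "\<exists>H. \<forall>M L. main_time M L \<le> H * (M + 1 + ratio_cost M L) ^ 4"
proof -
  define H where "H = 20000 + 30 * 30 + (20 * k * k + 1) * (20 * k * k + 20) + 60 * k * k + 300 + (200 + 60 * k * k + 4 * depth_cost)"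
  have "main_time M L \<le> H * (M + 1 + ratio_cost M L) ^ 4" for M L
  proof -
    define B t where "B = ratio_cost M L" and "t = M + 1 + B"
    have t: "M + 1 \<le> t" "L + 1 \<le> t" "B \<le> t" "M \<le> t" "L \<le> t" "1 \<le> t" using depth_le_ratio_cost[of L M] by (auto simp: t_def B_def)
    define t2 t3 t4 where "t2 = t * t" and "t3 = t * t2" and "t4 = t * t3"
    have m: "t \<le> t2" "t2 \<le> t3" "t3 \<le> t4" using t(6) by (auto simp: t2_def t3_def t4_def)
    have "(M + 1) * scan_cost M \<le> t * (200 * t)" using t by (intro mult_mono) (auto simp: scan_cost_def t_def)
    then have q: "(M + 1) * scan_cost M \<le> 200 * t2" by (simp add: t2_def mult_ac)
    have "M * M \<le> t * t" "M * (2 * M + 4 * B) \<le> t * (6 * t)" using t by (intro mult_mono; simp)+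
    then have mm: "M * M \<le> t2" "M * (2 * M + 4 * B) \<le> 6 * t2" by (simp_all add: t2_def mult_ac)
    have "(M + 1) * (24 + M + M * M) \<le> t * (26 * t2)" using t m mm(1) by (intro mult_mono) auto
    then have m3: "(M + 1) * (24 + M + M * M) \<le> 26 * t3" by (simp add: t3_def mult_ac)
    have "edge_cost M B \<le> 1000 * t3"
      using q mm m3 m t unfolding edge_cost_def by linarith
    then have "(M + 1) * edge_cost M B \<le> t * (1000 * t3)" using t by (intro mult_mono) auto
    then have y: "(M + 1) * edge_cost M B \<le> 1000 * t4" by (simp add: t4_def mult_ac)
    define c where "c = 20 * k * k"
    have ct: "c \<le> c * t" "depth_cost \<le> depth_cost * t" "L * depth_cost \<le> depth_cost * t" using t by (auto simp: mult.commute)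
    have "3 * (4 * M + c + 50 + L * depth_cost) + depth_cost \<le> (200 + 3 * c + 4 * depth_cost) * t"
      using ct t unfolding distrib_right distrib_left mult.assoc by linarith
    then have "(L + 1) * (3 * (4 * M + c + 50 + L * depth_cost) + depth_cost) \<le> t * ((200 + 3 * c + 4 * depth_cost) * t)"
      using t by (intro mult_mono) auto
    then have d: "(L + 1) * (3 * (4 * M + c + 50 + L * depth_cost) + depth_cost) \<le> (200 + 3 * c + 4 * depth_cost) * t2" by (simp add: t2_def mult_ac)
    have e: "a * 1 \<le> a * t4" "a * t \<le> a * t4" "a * t2 \<le> a * t4" for a
      using m t by (intro mult_left_mono; simp)+
    have "main_time M L \<le> 400 * t2 + 30 * t + (c + 1) * (c + 20) * 1 + 50 * t + (3 * c) * 1 + 300 * 1 + (200 + 3 * c + 4 * depth_cost) * t2 + 1000 * t4"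
      unfolding main_time_def B_def[symmetric] c_def[symmetric]
      by (intro add_mono; (rule d y | use q in linarith | use t in simp))
    also have "\<dots> \<le> 400 * t4 + 30 * t4 + (c + 1) * (c + 20) * t4 + 50 * t4 + (3 * c) * t4 + 300 * t4 + (200 + 3 * c + 4 * depth_cost) * t4 + 1000 * t4"
      by (intro add_mono e order_refl)
    also have "\<dots> = (1780 + (c + 1) * (c + 20) + 3 * c + (200 + 3 * c + 4 * depth_cost)) * t4" by (simp add: algebra_simps)
    also have "\<dots> \<le> H * t4" by (intro mult_right_mono) (auto simp: H_def c_def)
    also have "t4 = t ^ 4" by (simp add: t4_def t3_def t2_def eval_nat_numeral)
    finally show ?thesis by (simp add: t_def B_def)
  qed
  then show ?thesis by blast
qed

text \<open>The number of recursive calls is exponential in the depth \<open>L\<close>, and \<open>L - 1\<close> is at most the logarithm of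
  the required precision to the base \<open>1 / rate k\<close>.\<close>

lemma main_time_polynomial:
  assumes k: "k \<ge> 1"
  shows "\<exists>C q. \<forall>M L \<epsilon>. 1 \<le> M \<longrightarrow> 0 < \<epsilon> \<longrightarrow>
    (0 < L \<longrightarrow> \<epsilon> / ((1 + \<epsilon>) * (real (20 * k * k) * real M)) < rate (real k) ^ (L - 1)) \<longrightarrow>
    real (main_time M L) \<le> C * (real M + 1 / \<epsilon>) ^ q"
proof -
  define \<rho> where "\<rho> = rate (real k)"
  have \<rho>: "0 < \<rho>" "\<rho> < 1" using rate_bounds(1,2)[of "real k"] by (auto simp: \<rho>_def)
  have "1 < 1 / \<rho>" using \<rho> by simp
  \<comment> \<open>With this exponent, (step_cost + 5)^n is at most the q-th power of 1 / \<rho>^n,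
    and 1 / \<rho>^n is bounded by the inverse precision.\<close>
  then obtain q where q: "real (step_cost + 5) < (1 / \<rho>) ^ q" using real_arch_pow by blast
  obtain H where H: "\<And>M L. main_time M L \<le> H * (M + 1 + ratio_cost M L) ^ 4" using main_time_le by blast
  define a where "a = real (20 * k * k)"
  have "1 \<le> 20 * k * k" using k by simp
  then have "real 1 \<le> real (20 * k * k)" by (simp only: of_nat_le_iff)
  then have a: "1 \<le> a" unfolding a_def of_nat_1 .
  define C1 where "C1 = (real (step_cost + 5))\<^sup>2 * a ^ q * (4 * real (1200 + step_cost))"
  define C where "C = real H * (2 + C1) ^ 4"
  have "real (main_time M L) \<le> C * (real M + 1 / \<epsilon>) ^ (4 * (2 * q + 2))"
    if M: "1 \<le> M" and \<epsilon>: "0 < \<epsilon>" and L: "0 < L \<longrightarrow> \<epsilon> / ((1 + \<epsilon>) * (a * real M)) < \<rho> ^ (L - 1)" for M L \<epsilon>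
  proof -
    define X where "X = real M + 1 / \<epsilon>"
    have X: "1 \<le> X" "real M \<le> X" "1 + 1 / \<epsilon> \<le> X" using M \<epsilon> by (auto simp: X_def add_increasing2)
    define A where "A = a * X\<^sup>2"
    have X2: "1 \<le> X\<^sup>2" using X by simp
    have A: "1 \<le> A" using mult_mono[of 1 a 1 "X\<^sup>2"] a X2 by (simp add: A_def)
    \<comment> \<open>For L = n + 1 the exponent is n + 2, whence the square.\<close>
    have JL: "real (step_cost + 5) ^ (L + 1) \<le> (real (step_cost + 5))\<^sup>2 * A ^ q"
    proof (cases L)
      case 0
      have "1 \<le> A ^ q" using A by simp
      then have "(real (step_cost + 5))\<^sup>2 * 1 \<le> (real (step_cost + 5))\<^sup>2 * A ^ q" by (intro mult_left_mono) auto
      moreover have "real (step_cost + 5) ^ 1 \<le> (real (step_cost + 5))\<^sup>2" by (intro power_increasing) auto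
      ultimately have "real (step_cost + 5) ^ 1 \<le> (real (step_cost + 5))\<^sup>2 * A ^ q" by linarith
      then show ?thesis using 0 by simp
    next
      case (Suc n)
      define y where "y = \<epsilon> / ((1 + \<epsilon>) * (a * real M))"
      have y: "0 < y" "y < \<rho> ^ n" using L Suc \<epsilon> a M by (auto simp: y_def)
      have "1 / y = (1 + 1 / \<epsilon>) * (a * real M)" using \<epsilon> a M by (simp add: y_def field_simps)
      also have "\<dots> \<le> X * (a * X)" using X a M \<epsilon> by (intro mult_mono mult_left_mono) auto
      also have "\<dots> = A" by (simp add: A_def power2_eq_square)
      finally have "1 / y \<le> A" .
      moreover have "1 / \<rho> ^ n \<le> 1 / y" using y \<rho> by (intro divide_left_mono) auto
      ultimately have An: "(1 / \<rho>) ^ n \<le> A" by (simp add: power_one_over)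
      have "real (step_cost + 5) ^ n \<le> ((1 / \<rho>) ^ q) ^ n" using q by (intro power_mono) auto
      also have "\<dots> = ((1 / \<rho>) ^ n) ^ q" by (simp only: power_mult[symmetric] mult.commute)
      also have "\<dots> \<le> A ^ q" using An \<rho> by (intro power_mono) auto
      finally have "(real (step_cost + 5))\<^sup>2 * real (step_cost + 5) ^ n \<le> (real (step_cost + 5))\<^sup>2 * A ^ q" by (intro mult_left_mono) auto
      then show ?thesis by (simp only: Suc power2_eq_square power_Suc mult_ac add_Suc_right Suc_eq_plus1[symmetric])
    qed
    have "real (visit_cost M) \<le> real (1200 + step_cost) * (real M + 1)\<^sup>2"
      using visit_cost_le_square[of M, THEN of_nat_mono[where ?'a = real]] by (simp add: add.commute)
    also have "\<dots> \<le> real (1200 + step_cost) * (2 * X)\<^sup>2" using X by (intro mult_left_mono power_mono) auto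
    finally have Dm: "real (visit_cost M) \<le> 4 * real (1200 + step_cost) * X\<^sup>2" by (simp add: power_mult_distrib algebra_simps)
    have "real (ratio_cost M L) \<le> real (step_cost + 5) ^ (L + 1) * real (visit_cost M)"
      using ratio_cost_le[of M L, THEN of_nat_mono[where ?'a = real]] by simp
    also have "\<dots> \<le> ((real (step_cost + 5))\<^sup>2 * A ^ q) * (4 * real (1200 + step_cost) * X\<^sup>2)"
      using JL Dm A by (intro mult_mono) auto
    also have "\<dots> = C1 * ((X\<^sup>2) ^ q * X\<^sup>2)"
      by (simp only: C1_def A_def power_mult_distrib mult_ac)
    also have "(X\<^sup>2) ^ q * X\<^sup>2 = X ^ (2 * q + 2)" by (simp only: power_add power_mult)
    finally have B: "real (ratio_cost M L) \<le> C1 * X ^ (2 * q + 2)" .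
    define P where "P = X ^ (2 * q + 2)"
    have "X ^ 1 \<le> P" unfolding P_def using X(1) by (intro power_increasing) auto
    then have "real (M + 1 + ratio_cost M L) \<le> 2 * P + C1 * P" using B X unfolding P_def[symmetric] by simp
    then have "real (M + 1 + ratio_cost M L) \<le> (2 + C1) * P" by (simp only: distrib_right)
    then have "real (M + 1 + ratio_cost M L) ^ 4 \<le> ((2 + C1) * P) ^ 4" by (intro power_mono) auto
    then have "real H * real (M + 1 + ratio_cost M L) ^ 4 \<le> real H * ((2 + C1) * P) ^ 4" by (intro mult_left_mono) auto
    moreover have "P ^ 4 = X ^ (4 * (2 * q + 2))" unfolding P_def power_mult[symmetric] by (simp only: mult.commute)
    moreover have "real (main_time M L) \<le> real H * real (M + 1 + ratio_cost M L) ^ 4"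
      using H[of M L, THEN of_nat_mono[where ?'a = real]] by simp
    ultimately show ?thesis unfolding C_def X_def[symmetric] power_mult_distrib by (simp only: mult.assoc) 
  qed
  then show ?thesis unfolding a_def \<rho>_def by blast
qed

lemma fptas_prog:
  assumes k: "k \<ge> 1" "real k * p \<ge> 1" "p > 0"
  shows "fptas \<kappa> N encode_instance (holant (fibonacci_from p 1.17) {1..}) partition_function (prog k)"
proof -
  obtain C q where C: "\<And>M L \<epsilon>. 1 \<le> M \<Longrightarrow> 0 < \<epsilon> \<Longrightarrow>
      (0 < L \<longrightarrow> \<epsilon> / ((1 + \<epsilon>) * (real (20 * k * k) * real M)) < rate (real k) ^ (L - 1)) \<Longrightarrow>
      real (main_time M L) \<le> C * (real M + 1 / \<epsilon>) ^ q"
    using main_time_polynomial[OF k(1)] by blast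
  show ?thesis
    unfolding fptas_def Let_def
  proof (rule exI[of _ C], rule exI[of _ q], intro ballI allI impI)
    fix \<Omega> :: holant_instance and \<epsilon> :: real
    assume \<Omega>: "\<Omega> \<in> holant (fibonacci_from p 1.17) {1..}" and \<epsilon>: "0 < \<epsilon>" and N: "nums (VPair (VNum \<epsilon>) (encode_instance \<Omega>)) \<subseteq> N"
    define x where "x = VPair (VNum \<epsilon>) (encode_instance \<Omega>)"
    obtain z L where z: "ev [x] (prog k ! 0) (VNum z) (main_time (val_size \<kappa> x) L)"
      "approximates \<epsilon> (partition_function \<Omega>) z"
      "0 < L \<longrightarrow> \<epsilon> / ((1 + \<epsilon>) * (real (20 * k * k) * real (val_size \<kappa> x))) < rate (real k) ^ (L - 1)"
      using main_ev[OF k \<Omega> \<epsilon> N] unfolding x_def by blast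
    obtain t where t: "t \<le> main_time (val_size \<kappa> x) L" "eval \<kappa> (prog k) [x] (prog k ! 0) (VNum z) t"
      using z(1) unfolding ev_def by blast
    have "prog k \<noteq> []" by (simp add: prog_def)
    then have "runs \<kappa> (prog k) x (VNum z) t" using t(2) by (simp add: runs_def hd_conv_nth)
    moreover have "real t \<le> C * (real (val_size \<kappa> x) + 1 / \<epsilon>) ^ q"
      using C[OF _ \<epsilon> z(3)] t(1) by (simp add: x_def)
    ultimately show "\<exists>Z' t. runs \<kappa> (prog k) (VPair (VNum \<epsilon>) (encode_instance \<Omega>)) (VNum Z') t \<and>
        approximates \<epsilon> (partition_function \<Omega>) Z' \<and>
        real t \<le> C * (real (val_size \<kappa> (VPair (VNum \<epsilon>) (encode_instance \<Omega>))) + 1 / \<epsilon>) ^ q"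
      using z(2) unfolding x_def by blast
  qed
qed

end

section \<open>Bit sizes of rational numbers\<close>

definition bits :: "int \<Rightarrow> nat" where
  "bits a = nat (bitlen \<bar>a\<bar>)"

lemma bits_le:
  assumes "\<bar>a\<bar> < 2 ^ m"
  shows "bits a \<le> m"
  using assms bitlen_le_iff_power[of "\<bar>a\<bar>" "int m"] by (simp add: bits_def)

lemma less_two_power_bits: "\<bar>a\<bar> < 2 ^ bits a"
  using bitlen_bounds[of "\<bar>a\<bar>"] by (cases "a = 0") (auto simp: bits_def)

lemma bits_mono: "\<bar>a\<bar> \<le> \<bar>b\<bar> \<Longrightarrow> bits a \<le> bits b"
  by (rule bits_le) (use less_two_power_bits[of b] in linarith)

lemma bits_mult: "bits (a * b) \<le> bits a + bits b"
proof (rule bits_le)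
  show "\<bar>a * b\<bar> < 2 ^ (bits a + bits b)"
    unfolding abs_mult power_add by (intro mult_strict_mono less_two_power_bits) auto
qed

lemma bits_add:
  assumes "bits a \<le> m" "bits b \<le> m"
  shows "bits (a + b) \<le> m + 1"
proof (rule bits_le)
  have "(2 :: int) ^ bits a \<le> 2 ^ m" "(2 :: int) ^ bits b \<le> 2 ^ m"
    using assms by (intro power_increasing; simp)+
  then have "\<bar>a\<bar> < 2 ^ m" "\<bar>b\<bar> < 2 ^ m"
    using less_two_power_bits[of a] less_two_power_bits[of b] by (meson less_le_trans)+
  then show "\<bar>a + b\<bar> < 2 ^ (m + 1)" by simp
qed

lemma inv_of_rat [simp]: "inv (of_rat :: rat \<Rightarrow> real) (of_rat r) = r"
  by (intro inv_f_f injI) simp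

lemma bit_size_of_rat: "quotient_of r = (a, b) \<Longrightarrow> bit_size (of_rat r) = 1 + bits a + bits b"
  using quotient_of_denom_pos[of r a b] by (simp add: bit_size_def bits_def)

lemma Rats_quotient_cases:
  assumes "x \<in> \<rat>"
  obtains a b where "x = of_int a / of_int b" "b > 0" "coprime a b" "bit_size x = 1 + bits a + bits b"
proof -
  obtain r where r: "x = of_rat r" using assms by (auto simp: Rats_def)
  obtain a b where q: "quotient_of r = (a, b)" by (cases "quotient_of r")
  show ?thesis
    using that[of a b] quotient_of_div[OF q] quotient_of_denom_pos[OF q] quotient_of_coprime[OF q] bit_size_of_rat[OF q]
    by (simp add: r of_rat_divide)
qed

text \<open>In lowest terms, numerator and denominator divide \<open>A\<close> and \<open>B\<close>,
  so reducing a fraction does not increase its size.\<close>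

lemma bit_size_fraction_le:
  assumes "B \<noteq> 0" "x = of_int A / of_int B"
  shows "bit_size x \<le> 1 + bits A + bits B"
proof -
  have "x \<in> \<rat>" by (simp add: assms)
  then obtain a b where ab: "x = of_int a / of_int b" "b > 0" "coprime a b"
    "bit_size x = 1 + bits a + bits b" by (rule Rats_quotient_cases)
  have "real_of_int (A * b) = of_int (a * B)" using assms ab by (simp add: field_simps)
  then have eq: "A * b = a * B" by (simp only: of_int_eq_iff)
  then have "b dvd a * B" by (metis dvd_triv_right)
  then have "b dvd B" using ab(3) by (simp add: coprime_commute coprime_dvd_mult_right_iff)
  then have 1: "\<bar>b\<bar> \<le> \<bar>B\<bar>" using assms(1) by (simp add: dvd_imp_le_int)
  have "a dvd A * b" using eq by simp
  then have "a dvd A" using ab(3) by (simp add: coprime_dvd_mult_left_iff)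
  moreover have "A = 0 \<Longrightarrow> a = 0" using eq assms(1) by simp
  ultimately have "\<bar>a\<bar> \<le> \<bar>A\<bar>" using dvd_imp_le_int[of A a] by (cases "A = 0") auto
  then show ?thesis using bits_mono[OF 1] bits_mono[of a A] ab(4) by simp
qed

lemma bit_size_zero: "bit_size 0 = 2"
proof -
  have "bits (1 :: int) = 1" by (simp add: bits_def bitlen_alt_def)
  then show ?thesis using bit_size_of_rat[of 0 0 1] by (simp add: bits_def)
qed

lemma bit_size_ops:
  assumes "x \<in> \<rat>" "y \<in> \<rat>"
  shows "bit_size (x * y) \<le> bit_size x + bit_size y" "bit_size (x / y) \<le> bit_size x + bit_size y"
    "bit_size (x + y) \<le> 2 * (bit_size x + bit_size y)" "bit_size (x - y) \<le> 2 * (bit_size x + bit_size y)"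
proof -
  obtain a b where x: "x = of_int a / of_int b" "b > 0" "bit_size x = 1 + bits a + bits b"
    using assms(1) by (rule Rats_quotient_cases)
  obtain c d where y: "y = of_int c / of_int d" "d > 0" "bit_size y = 1 + bits c + bits d"
    using assms(2) by (rule Rats_quotient_cases)
  note m = bits_mult[of a c] bits_mult[of b d] bits_mult[of a d] bits_mult[of b c] bits_mult[of c b]
  have "bit_size (x * y) \<le> 1 + bits (a * c) + bits (b * d)"
    using x y by (intro bit_size_fraction_le) auto
  then show "bit_size (x * y) \<le> bit_size x + bit_size y" using m x(3) y(3) by linarith
  show "bit_size (x / y) \<le> bit_size x + bit_size y"
  \<comment> \<open>Division by 0 yields 0, whose size 2 is at most the sizes of \<open>x\<close>
    and \<open>y\<close> together.\<close>
  proof (cases "c = 0")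
    case True
    then show ?thesis using x(3) y by (simp add: bit_size_zero)
  next
    case False
    have "bit_size (x / y) \<le> 1 + bits (a * d) + bits (b * c)"
      using x y False by (intro bit_size_fraction_le) auto
    then show ?thesis using m x(3) y(3) by linarith
  qed
  define s where "s = bits a + bits b + bits c + bits d"
  have ad: "bits (a * d) \<le> s" "bits (c * b) \<le> s" "bits (- (c * b)) \<le> s"
    using m unfolding s_def by (auto simp: bits_def)
  have "bit_size (x + y) \<le> 1 + bits (a * d + c * b) + bits (b * d)"
    using x y by (intro bit_size_fraction_le) (auto simp: add_frac_eq)
  then show "bit_size (x + y) \<le> 2 * (bit_size x + bit_size y)"
    using bits_add[OF ad(1,2)] m(2) unfolding x(3) y(3) s_def by simp
  have "bit_size (x - y) \<le> 1 + bits (a * d + - (c * b)) + bits (b * d)"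
    using x y by (intro bit_size_fraction_le) (auto simp: diff_frac_eq)
  then show "bit_size (x - y) \<le> 2 * (bit_size x + bit_size y)"
    using bits_add[OF ad(1,3)] m(2) unfolding x(3) y(3) s_def by simp
qed

lemma bit_size_nat: "bit_size (real n) \<le> n + 3"
proof -
  have "n < 2 ^ n" by simp
  then have "int n < 2 ^ n" by (metis of_nat_less_iff of_nat_numeral of_nat_power)
  then have "bits (int n) \<le> n" by (intro bits_le) simp
  moreover have "bits (1 :: int) = 1" by (simp add: bits_def bitlen_alt_def)
  ultimately show ?thesis using bit_size_fraction_le[of 1 "real n" "int n"] by simp
qed

lemma cost_model_unit: "cost_model unit_size UNIV"
  by unfold_locales (simp_all add: unit_size_def)

lemma cost_model_bit: "cost_model bit_size \<rat>"
proof
  show "arith_op op x y \<in> \<rat>" if "x \<in> \<rat>" "y \<in> \<rat>" for op x y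
    using that by (cases op) auto
qed (use bit_size_ops bit_size_nat in auto)

theorem theorem3p2:
  fixes p :: real
  assumes "p > 0"
  shows "has_fptas (holant (fibonacci_from p 1.17) {1..})"
proof -
  \<comment> \<open>Programs have only the numeric constants 0 and 1, so the real bound 1/p is
    replaced by a natural number above it.\<close>
  obtain k :: nat where k: "1 / p < real k" using reals_Archimedean2 by blast
  have "0 < real k" using k assms by (meson less_trans zero_less_divide_1_iff)
  then have k1: "k \<ge> 1" by simp
  have kp: "real k * p \<ge> 1" using k assms by (simp add: divide_less_eq)
  show ?thesis
    unfolding has_fptas_def
    using cost_model.fptas_prog[OF cost_model_unit k1 kp assms] cost_model.fptas_prog[OF cost_model_bit k1 kp assms]
    by blast
qed

end
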